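(* Let $q\in\mathbb{C}\setminus\{0\}$. The $\mathbb{Z}_2$-graded algebra ${\cal F}(\mathbb{C}_q^{2|1})$ is a $\mathbb{Z}_2$-graded Hopf algebra, with coproduct $\Delta:{\cal F}(\mathbb{C}_q^{2|1})\to{\cal F}(\mathbb{C}_q^{2|1})\otimes{\cal F}(\mathbb{C}_q^{2|1})$, counit $\epsilon:{\cal F}(\mathbb{C}_q^{2|1})\to\mathbb{C}$ and antipode (coinverse) $S:{\cal F}(\mathbb{C}_q^{2|1})\to{\cal F}(\mathbb{C}_q^{2|1})$ given on generators ($i=1,2$) by $$\Delta(x_i)=x_i\otimes x_i,\qquad \Delta(\theta)=\theta\otimes x_1^{-1}x_2+\mathbf{1}\otimes\theta,$$ $$\epsilon(x_i)=1,\qquad \epsilon(\theta)=0,$$ $$S(x_i)=x_i^{-1},\qquad S(\theta)=-q^{-1}x_1\theta x_2^{-1}.$$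
   Context: ${\cal F}(\mathbb{C}_q^{2|1})$ is the unital associative $\mathbb{Z}_2$-graded $\mathbb{C}$-algebra generated by even elements $x_1,x_2$, their two-sided inverses $x_1^{-1},x_2^{-1}$, and an odd element $\theta$, with relations $x_1x_2=x_2x_1$, $x_i\theta=q\theta x_i$ ($i=1,2$), $\theta^2=0$. $p(a)\in\{0,1\}$ denotes the parity of a homogeneous element $a$. The tensor product of $\mathbb{Z}_2$-graded algebras carries the product $(a_1\otimes a_2)(b_1\otimes b_2)=(-1)^{p(a_2)p(b_1)}a_1b_1\otimes a_2b_2$. A $\mathbb{Z}_2$-graded Hopf algebra is a unital $\mathbb{Z}_2$-graded algebra ${\cal H}$ with multiplication $m$ and unit map $\eta$, together with algebra homomorphisms $\Delta:{\cal H}\to{\cal H}\otimes{\cal H}$, $\epsilon:{\cal H}\to\mathbb{C}$ and a linear graded antihomomorphism $S:{\cal H}\to{\cal H}$, meaning $S(ab)=(-1)^{p(a)p(b)}S(b)S(a)$, such that $(\Delta\otimes\mathrm{id})\Delta=(\mathrm{id}\otimes\Delta)\Delta$, $m(\epsilon\otimes\mathrm{id})\Delta=\mathrm{id}=m(\mathrm{id}\otimes\epsilon)\Delta$, $m(S\otimes\mathrm{id})\Delta=\eta\epsilon=m(\mathrm{id}\otimes S)\Delta$, and $\Delta(\mathbf 1)=\mathbf 1\otimes\mathbf 1$, $\epsilon(\mathbf 1)=1$, $S(\mathbf 1)=\mathbf 1$. *)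

theory Defs
  imports
    Complex_Main
    "HOL-Library.Poly_Mapping"
    "HOL-Library.Z2"
    "HOL-Algebra.Module"
    "HOL-Algebra.QuotRing"
begin

section \<open>Complex superalgebras\<close>

text \<open>
  Degrees are elements of the two-element field \<^typ>\<open>bit\<close>, so that adding degrees and
  multiplying degrees (in Koszul signs) are the operations of Z/2.
\<close>

record 'a superalg = "(complex, 'a) module" +
  grade :: "bit \<Rightarrow> 'a set"

definition koszul :: "bit \<Rightarrow> bit \<Rightarrow> complex" where
  "koszul i j = (if i * j = 1 then -1 else 1)"

text \<open>The complex numbers, purely even; they also serve as the ring of scalars.\<close>

definition complex_alg :: "complex superalg" where
  "complex_alg = \<lparr>carrier = UNIV, mult = (*), one = 1, zero = 0, add = (+), smult = (*),
     grade = (\<lambda>i. if i = 0 then UNIV else {0})\<rparr>"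

locale superalgebra = ring A + module complex_alg A for A (structure) +
  assumes smult_mult_left:
      "\<lbrakk>a \<in> carrier A; b \<in> carrier A\<rbrakk> \<Longrightarrow> (c \<odot> a) \<otimes> b = c \<odot> (a \<otimes> b)"
    and smult_mult_right:
      "\<lbrakk>a \<in> carrier A; b \<in> carrier A\<rbrakk> \<Longrightarrow> a \<otimes> (c \<odot> b) = c \<odot> (a \<otimes> b)"
    and grade_submodule: "submodule (grade A i) complex_alg A"
    and grade_decomp:
      "a \<in> carrier A \<Longrightarrow> \<exists>!p. p \<in> grade A 0 \<times> grade A 1 \<and> a = fst p \<oplus> snd p"
    and grade_mult:
      "\<lbrakk>a \<in> grade A i; b \<in> grade A j\<rbrakk> \<Longrightarrow> a \<otimes> b \<in> grade A (i + j)"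
    and grade_one: "\<one> \<in> grade A 0"

definition superalg_hom ::
    "('a, 'm) superalg_scheme \<Rightarrow> ('b, 'n) superalg_scheme \<Rightarrow> ('a \<Rightarrow> 'b) set" where
  "superalg_hom A B = {h \<in> ring_hom A B.
     (\<forall>c. \<forall>a\<in>carrier A. h (c \<odot>\<^bsub>A\<^esub> a) = c \<odot>\<^bsub>B\<^esub> h a) \<and>
     (\<forall>i. \<forall>a\<in>grade A i. h a \<in> grade B i)}"

definition graded_part :: "('a, 'm) superalg_scheme \<Rightarrow> bit \<Rightarrow> 'a \<Rightarrow> 'a" where
  "graded_part A i a = (THE u. u \<in> grade A i \<and> (\<exists>v\<in>grade A (i + 1). a = u \<oplus>\<^bsub>A\<^esub> v))"

text \<open>
  Quotient by a two-sided (homogeneous) ideal: the ring structure is that of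
  \<^const>\<open>FactRing\<close>; the homogeneous elements are the classes of homogeneous elements.
\<close>

definition quot_superalg :: "('a, 'm) superalg_scheme \<Rightarrow> 'a set \<Rightarrow> 'a set superalg" where
  "quot_superalg A I = \<lparr>carrier = carrier (A Quot I), mult = mult (A Quot I),
     one = one (A Quot I), zero = zero (A Quot I), add = add (A Quot I),
     smult = (\<lambda>c X. \<Union>x\<in>X. I +>\<^bsub>A\<^esub> (c \<odot>\<^bsub>A\<^esub> x)),
     grade = (\<lambda>i. (\<lambda>x. I +>\<^bsub>A\<^esub> x) ` grade A i)\<rparr>"


section \<open>Graded tensor product\<close>

text \<open>
  \<open>tensor_pre A B\<close> is the complex vector space with basis the set
  \<open>carrier A \<times> carrier B\<close>; its ring multiplication and unit are irrelevant. The tensor product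
  is its quotient by \<open>tensor_null A B\<close>, the subspace generated by the bilinearity relations.
\<close>

definition tensor_pre :: "('a, 'm) superalg_scheme \<Rightarrow> ('b, 'n) superalg_scheme
    \<Rightarrow> (complex, ('a \<times> 'b) \<Rightarrow>\<^sub>0 complex) module" where
  "tensor_pre A B = \<lparr>carrier = {f. Poly_Mapping.keys f \<subseteq> carrier A \<times> carrier B},
     mult = undefined, one = undefined, zero = 0, add = (+),
     smult = (\<lambda>c. Poly_Mapping.map ((*) c))\<rparr>"

definition tensor_relators :: "('a, 'm) superalg_scheme \<Rightarrow> ('b, 'n) superalg_scheme
    \<Rightarrow> (('a \<times> 'b) \<Rightarrow>\<^sub>0 complex) set" where
  "tensor_relators A B =
     {Poly_Mapping.single (a \<oplus>\<^bsub>A\<^esub> a', b) 1 - Poly_Mapping.single (a, b) 1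
        - Poly_Mapping.single (a', b) 1
      | a a' b. a \<in> carrier A \<and> a' \<in> carrier A \<and> b \<in> carrier B} \<union>
     {Poly_Mapping.single (a, b \<oplus>\<^bsub>B\<^esub> b') 1 - Poly_Mapping.single (a, b) 1
        - Poly_Mapping.single (a, b') 1
      | a b b'. a \<in> carrier A \<and> b \<in> carrier B \<and> b' \<in> carrier B} \<union>
     {Poly_Mapping.single (c \<odot>\<^bsub>A\<^esub> a, b) 1 - Poly_Mapping.single (a, b) c
      | c a b. a \<in> carrier A \<and> b \<in> carrier B} \<union>
     {Poly_Mapping.single (a, c \<odot>\<^bsub>B\<^esub> b) 1 - Poly_Mapping.single (a, b) c
      | c a b. a \<in> carrier A \<and> b \<in> carrier B}"

definition tensor_null :: "('a, 'm) superalg_scheme \<Rightarrow> ('b, 'n) superalg_scheme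
    \<Rightarrow> (('a \<times> 'b) \<Rightarrow>\<^sub>0 complex) set" where
  "tensor_null A B =
     \<Inter>{N. submodule N complex_alg (tensor_pre A B) \<and> tensor_relators A B \<subseteq> N}"

text \<open>
  The sign rule \<open>(a1 \<otimes> a2)(b1 \<otimes> b2) = (-1)^(p(a2) p(b1)) a1 b1 \<otimes> a2 b2\<close> only speaks about
  homogeneous \<open>a2\<close> and \<open>b1\<close>; here it is extended bilinearly, by splitting \<open>a2\<close> and \<open>b1\<close>
  into their graded parts.
\<close>

definition tensor_pre_mult :: "('a, 'm) superalg_scheme \<Rightarrow> ('b, 'n) superalg_scheme
    \<Rightarrow> (('a \<times> 'b) \<Rightarrow>\<^sub>0 complex) \<Rightarrow> (('a \<times> 'b) \<Rightarrow>\<^sub>0 complex) \<Rightarrow> (('a \<times> 'b) \<Rightarrow>\<^sub>0 complex)" where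
  "tensor_pre_mult A B f g =
     (\<Sum>(a1, a2)\<in>Poly_Mapping.keys f. \<Sum>(b1, b2)\<in>Poly_Mapping.keys g. \<Sum>i\<in>UNIV. \<Sum>j\<in>UNIV.
        Poly_Mapping.single
          (a1 \<otimes>\<^bsub>A\<^esub> graded_part A j b1, graded_part B i a2 \<otimes>\<^bsub>B\<^esub> b2)
          (koszul i j * Poly_Mapping.lookup f (a1, a2) * Poly_Mapping.lookup g (b1, b2)))"

definition tens :: "('a, 'm) superalg_scheme \<Rightarrow> ('b, 'n) superalg_scheme
    \<Rightarrow> 'a \<Rightarrow> 'b \<Rightarrow> (('a \<times> 'b) \<Rightarrow>\<^sub>0 complex) set" where
  "tens A B a b = tensor_null A B +>\<^bsub>tensor_pre A B\<^esub> Poly_Mapping.single (a, b) 1"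

definition tensor :: "('a, 'm) superalg_scheme \<Rightarrow> ('b, 'n) superalg_scheme
    \<Rightarrow> (('a \<times> 'b) \<Rightarrow>\<^sub>0 complex) set superalg" where
  "tensor A B = \<lparr>carrier = a_rcosets\<^bsub>tensor_pre A B\<^esub> (tensor_null A B),
     mult = (\<lambda>X Y. \<Union>f\<in>X. \<Union>g\<in>Y. tensor_null A B +>\<^bsub>tensor_pre A B\<^esub> tensor_pre_mult A B f g),
     one = tens A B \<one>\<^bsub>A\<^esub> \<one>\<^bsub>B\<^esub>,
     zero = tensor_null A B,
     add = set_add (tensor_pre A B),
     smult = (\<lambda>c X. \<Union>f\<in>X. tensor_null A B +>\<^bsub>tensor_pre A B\<^esub> (c \<odot>\<^bsub>tensor_pre A B\<^esub> f)),
     grade = (\<lambda>k. (\<lambda>f. tensor_null A B +>\<^bsub>tensor_pre A B\<^esub> f) `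
       {f. Poly_Mapping.keys f \<subseteq> (\<Union>i. grade A i \<times> grade B (k - i))})\<rparr>"

text \<open>
  \<open>tensor_lift V \<phi>\<close> is the linear map into \<open>V\<close> with \<open>a \<otimes> b \<mapsto> \<phi> a b\<close>; it is meaningful for
  bilinear \<open>\<phi>\<close>, where the value does not depend on the representative of the class.
\<close>

definition tensor_lift :: "('c, 'm) superalg_scheme \<Rightarrow> ('a \<Rightarrow> 'b \<Rightarrow> 'c)
    \<Rightarrow> (('a \<times> 'b) \<Rightarrow>\<^sub>0 complex) set \<Rightarrow> 'c" where
  "tensor_lift V \<phi> X = the_elem
     ((\<lambda>f. \<Oplus>\<^bsub>V\<^esub>x\<in>Poly_Mapping.keys f. Poly_Mapping.lookup f x \<odot>\<^bsub>V\<^esub> \<phi> (fst x) (snd x)) ` X)"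

text \<open>The map \<open>f \<otimes> g\<close> into \<open>C \<otimes> D\<close>; no Koszul sign occurs because it is used for even maps only.\<close>

definition tensor_map :: "('c, 'm) superalg_scheme \<Rightarrow> ('d, 'n) superalg_scheme
    \<Rightarrow> ('a \<Rightarrow> 'c) \<Rightarrow> ('b \<Rightarrow> 'd)
    \<Rightarrow> (('a \<times> 'b) \<Rightarrow>\<^sub>0 complex) set \<Rightarrow> (('c \<times> 'd) \<Rightarrow>\<^sub>0 complex) set" where
  "tensor_map C D f g = tensor_lift (tensor C D) (\<lambda>a b. tens C D (f a) (g b))"

text \<open>The canonical isomorphism from \<open>(A \<otimes> B) \<otimes> C\<close> to \<open>A \<otimes> (B \<otimes> C)\<close>.\<close>

definition tensor_assoc :: "('a, 'm) superalg_scheme \<Rightarrow> ('b, 'n) superalg_scheme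
    \<Rightarrow> ('c, 'k) superalg_scheme
    \<Rightarrow> (((('a \<times> 'b) \<Rightarrow>\<^sub>0 complex) set \<times> 'c) \<Rightarrow>\<^sub>0 complex) set
    \<Rightarrow> (('a \<times> (('b \<times> 'c) \<Rightarrow>\<^sub>0 complex) set) \<Rightarrow>\<^sub>0 complex) set" where
  "tensor_assoc A B C = tensor_lift (tensor A (tensor B C))
     (\<lambda>t c. tensor_lift (tensor A (tensor B C)) (\<lambda>a b. tens A (tensor B C) a (tens B C b c)) t)"

definition mult_map :: "('a, 'm) superalg_scheme \<Rightarrow> (('a \<times> 'a) \<Rightarrow>\<^sub>0 complex) set \<Rightarrow> 'a" where
  "mult_map A = tensor_lift A (\<lambda>a b. a \<otimes>\<^bsub>A\<^esub> b)"

definition unit_map :: "('a, 'm) superalg_scheme \<Rightarrow> complex \<Rightarrow> 'a" where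
  "unit_map A c = c \<odot>\<^bsub>A\<^esub> \<one>\<^bsub>A\<^esub>"


section \<open>Graded Hopf algebras\<close>

text \<open>
  In the counit axioms the multiplication \<open>m\<close> on \<open>\<complex> \<otimes> H\<close> and \<open>H \<otimes> \<complex>\<close> is the action of the
  scalars.
\<close>

locale super_hopf_algebra = superalgebra H for H (structure) +
  fixes \<Delta> :: "'a \<Rightarrow> (('a \<times> 'a) \<Rightarrow>\<^sub>0 complex) set"
    and \<epsilon> :: "'a \<Rightarrow> complex"
    and S :: "'a \<Rightarrow> 'a"
  assumes comult_hom: "\<Delta> \<in> superalg_hom H (tensor H H)"
    and counit_hom: "\<epsilon> \<in> superalg_hom H complex_alg"
    and antipode_closed: "a \<in> carrier H \<Longrightarrow> S a \<in> carrier H"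
    and antipode_add: "\<lbrakk>a \<in> carrier H; b \<in> carrier H\<rbrakk> \<Longrightarrow> S (a \<oplus> b) = S a \<oplus> S b"
    and antipode_smult: "a \<in> carrier H \<Longrightarrow> S (c \<odot> a) = c \<odot> S a"
    and antipode_grade: "a \<in> grade H i \<Longrightarrow> S a \<in> grade H i"
    and antipode_mult: "\<lbrakk>a \<in> grade H i; b \<in> grade H j\<rbrakk>
      \<Longrightarrow> S (a \<otimes> b) = koszul i j \<odot> (S b \<otimes> S a)"
    and coassoc: "a \<in> carrier H \<Longrightarrow>
      tensor_assoc H H H (tensor_map (tensor H H) H \<Delta> id (\<Delta> a))
        = tensor_map H (tensor H H) id \<Delta> (\<Delta> a)"
    and counit_left: "a \<in> carrier H \<Longrightarrow>
      tensor_lift H (\<lambda>c x. c \<odot> x) (tensor_map complex_alg H \<epsilon> id (\<Delta> a)) = a"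
    and counit_right: "a \<in> carrier H \<Longrightarrow>
      tensor_lift H (\<lambda>x c. c \<odot> x) (tensor_map H complex_alg id \<epsilon> (\<Delta> a)) = a"
    and antipode_left: "a \<in> carrier H \<Longrightarrow>
      mult_map H (tensor_map H H S id (\<Delta> a)) = unit_map H (\<epsilon> a)"
    and antipode_right: "a \<in> carrier H \<Longrightarrow>
      mult_map H (tensor_map H H id S (\<Delta> a)) = unit_map H (\<epsilon> a)"
    and comult_one: "\<Delta> \<one> = tens H H \<one> \<one>"
    and counit_one: "\<epsilon> \<one> = 1"
    and antipode_one: "S \<one> = \<one>"


section \<open>The algebra of functions on the quantum superspace\<close>

text \<open>
  Lists form the free monoid; with this instance the ring structure of
  \<^typ>\<open>'g list \<Rightarrow>\<^sub>0 complex\<close> is the free associative algebra on \<^typ>\<open>'g\<close>.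
\<close>

instantiation list :: (type) monoid_add
begin

definition "0 = ([] :: 'a list)"
definition "xs + ys = (xs @ ys :: 'a list)"

instance
  by standard (simp_all add: zero_list_def plus_list_def)

end

datatype index = I1 | I2

datatype gen = X index | Xinv index | Theta

definition gen_parity :: "gen \<Rightarrow> bit" where
  "gen_parity g = (if g = Theta then 1 else 0)"

definition free_alg :: "(gen list \<Rightarrow>\<^sub>0 complex) superalg" where
  "free_alg = \<lparr>carrier = UNIV, mult = (*), one = 1, zero = 0, add = (+),
     smult = (\<lambda>c. Poly_Mapping.map ((*) c)),
     grade = (\<lambda>i. {f. \<forall>w\<in>Poly_Mapping.keys f. sum_list (map gen_parity w) = i})\<rparr>"

definition gen_poly :: "gen \<Rightarrow> gen list \<Rightarrow>\<^sub>0 complex" where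
  "gen_poly g = Poly_Mapping.single [g] 1"

definition superspace_relators :: "complex \<Rightarrow> (gen list \<Rightarrow>\<^sub>0 complex) set" where
  "superspace_relators q =
     {gen_poly (X i) * gen_poly (Xinv i) - 1 | i. True} \<union>
     {gen_poly (Xinv i) * gen_poly (X i) - 1 | i. True} \<union>
     {gen_poly (X I1) * gen_poly (X I2) - gen_poly (X I2) * gen_poly (X I1)} \<union>
     {gen_poly (X i) * gen_poly Theta
        - Poly_Mapping.single [] q * (gen_poly Theta * gen_poly (X i)) | i. True} \<union>
     {gen_poly Theta * gen_poly Theta}"

definition superspace_ideal :: "complex \<Rightarrow> (gen list \<Rightarrow>\<^sub>0 complex) set" where
  "superspace_ideal q = Idl\<^bsub>free_alg\<^esub> (superspace_relators q)"

definition superspace :: "complex \<Rightarrow> (gen list \<Rightarrow>\<^sub>0 complex) set superalg" where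
  "superspace q = quot_superalg free_alg (superspace_ideal q)"

definition superspace_gen :: "complex \<Rightarrow> gen \<Rightarrow> (gen list \<Rightarrow>\<^sub>0 complex) set" where
  "superspace_gen q g = superspace_ideal q +>\<^bsub>free_alg\<^esub> gen_poly g"

end

(*
  The algebra F is a quotient of a free algebra, so a homomorphism out of it amounts to a choice of
  images of the generators satisfying the relations.  This yields the coproduct as a homomorphism
  into the graded tensor product (once that is known to be an associative superalgebra) and the
  counit.  The antipode is a graded antihomomorphism; rescaling its odd part by the imaginary unit
  turns it into an ordinary antihomomorphism, that is, a homomorphism into the opposite algebra.
  The remaining axioms are equalities of linear maps.  By the relations F is spanned by the elements
  g and theta g with g a product of the x_i and their inverses.  With k = x_1^-1 x_2 one has
  Delta(g) = g (x) g and Delta(theta g) = theta g (x) k g + g (x) theta g, so the axioms only need to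
  be checked on these.
*)
theory Submission
  imports Defs
begin

section \<open>Linear extensions and quotients of complex vector spaces\<close>

text \<open>Linear independence of the spanning set is never established. What a basis would
  otherwise supply is uniqueness of the decomposition into even and odd parts. It comes from the
  grading involution \<sigma>, equal to (-1)^i in degree i: from u + v one recovers 2u as (u + v) +
  \<sigma>(u + v). On F this involution exists because the relations are homogeneous; on a tensor
  product it is the tensor product of two involutions. Elements of the quotients are cosets, and
  operations on them are unions over representatives or values of \<open>the_elem\<close>. Much of
  the work is therefore well-definedness, above all of the signed product: it is defined on formal
  combinations of pairs, and the subspace generated by the bilinearity relations must absorb
  products from both sides. The element k has total degree zero in the x_i and so commutes with
  \<theta>; this is why the two mixed terms of \<Delta>(\<theta>)^2, which carry opposite signs,
  cancel. The scalar q is inverted whenever some x_i^-1 moves past \<theta>.\<close>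

lemma complex_alg_simps [simp]:
  "carrier complex_alg = UNIV" "mult complex_alg = (*)" "one complex_alg = 1"
  "zero complex_alg = 0" "add complex_alg = (+)" "smult complex_alg = (*)"
  "grade complex_alg i = (if i = 0 then UNIV else {0})"
  by (simp_all add: complex_alg_def)

text \<open>For structures whose addition is that of the underlying type: the complex numbers, the
  free algebra, and the free vector space on pairs, whose carrier may be a proper subset of the
  type.\<close>

lemma abelian_group_typeI:
  fixes G :: "('a::ab_group_add, 'm) ring_scheme"
  assumes "add G = (+)" "zero G = 0" "carrier G = S"
    and "0 \<in> S" "\<And>x y. x \<in> S \<Longrightarrow> y \<in> S \<Longrightarrow> x + y \<in> S" "\<And>x. x \<in> S \<Longrightarrow> - x \<in> S"
  shows "abelian_group G"
proof (rule abelian_groupI)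
  fix x assume "x \<in> carrier G"
  then show "\<exists>y\<in>carrier G. y \<oplus>\<^bsub>G\<^esub> x = \<zero>\<^bsub>G\<^esub>"
    using assms by (intro bexI[of _ "- x"]) auto
qed (use assms in \<open>auto simp: ac_simps\<close>)

lemma a_inv_typeI:
  fixes G :: "('a::ab_group_add, 'm) ring_scheme"
  assumes "abelian_group G" "add G = (+)" "zero G = 0" "x \<in> carrier G" "- x \<in> carrier G"
  shows "\<ominus>\<^bsub>G\<^esub> x = - x"
proof -
  interpret abelian_group G by fact
  show ?thesis
    using minus_equality[of "- x" x] assms by simp
qed

lemma cring_complex_alg: "cring complex_alg"
proof (rule cringI)
  show "abelian_group complex_alg"
    by (rule abelian_group_typeI) auto
qed (unfold_locales, auto simp: distrib_right)

text \<open>The laws of \<open>module\<close> are phrased with the operations of the record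
  \<open>complex_alg\<close>. Fixing the scalars allows the rules below to use ordinary arithmetic
  on complex numbers.\<close>

locale cmodule = module complex_alg V for V (structure)

lemma cmoduleI:
  assumes "abelian_group V"
    and "\<And>c x. x \<in> carrier V \<Longrightarrow> c \<odot>\<^bsub>V\<^esub> x \<in> carrier V"
    and "\<And>c d x. x \<in> carrier V \<Longrightarrow> (c + d) \<odot>\<^bsub>V\<^esub> x = c \<odot>\<^bsub>V\<^esub> x \<oplus>\<^bsub>V\<^esub> d \<odot>\<^bsub>V\<^esub> x"
    and "\<And>c x y. x \<in> carrier V \<Longrightarrow> y \<in> carrier V \<Longrightarrow> c \<odot>\<^bsub>V\<^esub> (x \<oplus>\<^bsub>V\<^esub> y) = c \<odot>\<^bsub>V\<^esub> x \<oplus>\<^bsub>V\<^esub> c \<odot>\<^bsub>V\<^esub> y"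
    and "\<And>c d x. x \<in> carrier V \<Longrightarrow> (c * d) \<odot>\<^bsub>V\<^esub> x = c \<odot>\<^bsub>V\<^esub> (d \<odot>\<^bsub>V\<^esub> x)"
    and "\<And>x. x \<in> carrier V \<Longrightarrow> 1 \<odot>\<^bsub>V\<^esub> x = x"
  shows "cmodule V"
  unfolding cmodule_def
  by (rule moduleI) (use assms cring_complex_alg in auto)

context cmodule
begin

lemma scale_closed [simp]: "x \<in> carrier V \<Longrightarrow> c \<odot> x \<in> carrier V"
  using smult_closed by simp

lemma scale_add_left: "x \<in> carrier V \<Longrightarrow> (c + d) \<odot> x = c \<odot> x \<oplus> d \<odot> x"
  using smult_l_distr by simp

lemma scale_add_right:
  "x \<in> carrier V \<Longrightarrow> y \<in> carrier V \<Longrightarrow> c \<odot> (x \<oplus> y) = c \<odot> x \<oplus> c \<odot> y"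
  using smult_r_distr by simp

lemma scale_scale: "x \<in> carrier V \<Longrightarrow> c \<odot> (d \<odot> x) = (c * d) \<odot> x"
  using smult_assoc1 by simp

lemma scale_one [simp]: "x \<in> carrier V \<Longrightarrow> 1 \<odot> x = x"
  using smult_one by simp

lemma scale_zero_left [simp]: "x \<in> carrier V \<Longrightarrow> 0 \<odot> x = \<zero>"
  using smult_l_null by simp

lemma scale_zero_right [simp]: "c \<odot> \<zero> = \<zero>"
  using smult_r_null by simp

text \<open>Negation reduces to scaling, so that subspaces and linear maps need only be checked on
  sums and multiples.\<close>

lemma a_inv_eq_scale: "x \<in> carrier V \<Longrightarrow> \<ominus> x = (- 1) \<odot> x"
  using scale_add_left[of x "- 1" 1] minus_equality[of "(-1) \<odot> x" x] by simp

lemma csubmoduleI: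
  assumes "H \<subseteq> carrier V" "\<zero> \<in> H"
    and "\<And>a b. a \<in> H \<Longrightarrow> b \<in> H \<Longrightarrow> a \<oplus> b \<in> H"
    and "\<And>c a. a \<in> H \<Longrightarrow> c \<odot> a \<in> H"
  shows "submodule H complex_alg V"
  by (rule submoduleI) (use assms a_inv_eq_scale in auto)

lemma submodule_facts:
  assumes "submodule H complex_alg V"
  shows "H \<subseteq> carrier V" "\<zero> \<in> H" "a \<in> H \<Longrightarrow> b \<in> H \<Longrightarrow> a \<oplus> b \<in> H"
    "a \<in> H \<Longrightarrow> \<ominus> a \<in> H" "a \<in> H \<Longrightarrow> c \<odot> a \<in> H"
  using submoduleE[OF assms] subgroup.one_closed[OF submodule.axioms(1)[OF assms]] by auto

lemma finsum_in_submodule: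
  assumes "submodule H complex_alg V" "finite K" "\<And>x. x \<in> K \<Longrightarrow> f x \<in> H"
  shows "(\<Oplus>x\<in>K. f x) \<in> H"
  using assms(2,3)
proof (induction K)
  case (insert x K)
  then show ?case
    using submodule_facts[OF assms(1)] by (subst finsum_insert) (auto simp: Pi_iff)
qed (use submodule_facts[OF assms(1)] in auto)

end

lemma cmodule_complex_alg: "cmodule complex_alg"
  by (rule cmoduleI) (use cring_complex_alg in \<open>auto simp: algebra_simps cring_def ring_def\<close>)

text \<open>The sum inside \<open>tensor_lift\<close> has this shape. The same expression evaluates
  noncommutative polynomials and, used twice, describes the product on formal combinations of
  pairs.\<close>

definition lin_ext :: "(complex, 'v, 'm) module_scheme \<Rightarrow> ('x \<Rightarrow> 'v) \<Rightarrow> ('x \<Rightarrow>\<^sub>0 complex) \<Rightarrow> 'v" where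
  "lin_ext V \<phi> f = (\<Oplus>\<^bsub>V\<^esub>x\<in>Poly_Mapping.keys f. Poly_Mapping.lookup f x \<odot>\<^bsub>V\<^esub> \<phi> x)"

lemma lookup_map_scale [simp]:
  "Poly_Mapping.lookup (Poly_Mapping.map ((*) c) f) x = c * Poly_Mapping.lookup f x"
  for f :: "'x \<Rightarrow>\<^sub>0 complex"
  by (simp add: Poly_Mapping.map.rep_eq when_def)

lemma keys_map_scale: "Poly_Mapping.keys (Poly_Mapping.map ((*) c) f) \<subseteq> Poly_Mapping.keys f"
  for f :: "'x \<Rightarrow>\<^sub>0 complex"
  by (auto simp: in_keys_iff)

lemma map_scale_linear:
  fixes f g :: "'x \<Rightarrow>\<^sub>0 complex"
  shows "Poly_Mapping.map ((*) (c + d)) f = Poly_Mapping.map ((*) c) f + Poly_Mapping.map ((*) d) f"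
    "Poly_Mapping.map ((*) c) (f + g) = Poly_Mapping.map ((*) c) f + Poly_Mapping.map ((*) c) g"
    "Poly_Mapping.map ((*) (c * d)) f = Poly_Mapping.map ((*) c) (Poly_Mapping.map ((*) d) f)"
    "Poly_Mapping.map ((*) 1) f = f"
    "Poly_Mapping.map ((*) (-1)) f = - f"
  by (rule poly_mapping_eqI; simp add: lookup_add algebra_simps)+

text \<open>The mapping is built up one new key at a time, so each update is the addition of a
  monomial without cancellation. The bound \<open>K\<close> is carried along because membership in
  the carrier of \<open>tensor_pre\<close>, and homogeneity, are conditions on keys.\<close>

lemma poly_mapping_induct_keys [consumes 1, case_names zero single add]:
  fixes f :: "'x \<Rightarrow>\<^sub>0 complex"
  assumes "Poly_Mapping.keys f \<subseteq> K"
    and zero: "P 0"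
    and single: "\<And>x c. x \<in> K \<Longrightarrow> P (Poly_Mapping.single x c)"
    and add: "\<And>f g. Poly_Mapping.keys f \<subseteq> K \<Longrightarrow> Poly_Mapping.keys g \<subseteq> K \<Longrightarrow> P f \<Longrightarrow> P g \<Longrightarrow> P (f + g)"
  shows "P f"
  using assms(1)
proof (induction f rule: update_induct)
  case (update f a b)
  have eq: "Poly_Mapping.update a b f = Poly_Mapping.single a b + f"
    using update.hyps
    by (intro poly_mapping_eqI) (auto simp: lookup_update lookup_add lookup_single in_keys_iff when_def)
  have sub: "insert a (Poly_Mapping.keys f) \<subseteq> K"
    using update.hyps update.prems by (simp add: keys_update)
  then have "P f" using update.IH by simp
  moreover have "P (Poly_Mapping.single a b)" using sub single by simp
  ultimately show ?case
    unfolding eq using sub update.hyps by (intro add) auto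
qed (rule zero)

context cmodule
begin

text \<open>The additional summands have coefficient 0. Keys may disappear when mappings are added
  or scaled, and a common larger index set makes the sums comparable.\<close>

lemma lin_ext_superset:
  assumes "finite K" "Poly_Mapping.keys f \<subseteq> K" "\<And>x. x \<in> K \<Longrightarrow> \<phi> x \<in> carrier V"
  shows "lin_ext V \<phi> f = (\<Oplus>x\<in>K. Poly_Mapping.lookup f x \<odot> \<phi> x)"
  unfolding lin_ext_def
  by (rule add.finprod_mono_neutral_cong_left) (use assms in \<open>auto simp: in_keys_iff Pi_iff\<close>)

lemma lin_ext_closed [intro]:
  "(\<And>x. x \<in> Poly_Mapping.keys f \<Longrightarrow> \<phi> x \<in> carrier V) \<Longrightarrow> lin_ext V \<phi> f \<in> carrier V"
  unfolding lin_ext_def by (rule finsum_closed) auto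

lemma lin_ext_in_submodule:
  assumes "submodule H complex_alg V" "\<And>x. x \<in> Poly_Mapping.keys f \<Longrightarrow> \<phi> x \<in> H"
  shows "lin_ext V \<phi> f \<in> H"
  unfolding lin_ext_def
  by (rule finsum_in_submodule) (use assms submodule_facts[OF assms(1)] in auto)

lemma lin_ext_zero [simp]: "lin_ext V \<phi> 0 = \<zero>"
  by (simp add: lin_ext_def)

lemma lin_ext_single [simp]:
  "\<phi> x \<in> carrier V \<Longrightarrow> lin_ext V \<phi> (Poly_Mapping.single x c) = c \<odot> \<phi> x"
  by (subst lin_ext_superset[where K = "{x}"]) auto

lemma lin_ext_add:
  assumes "\<And>x. x \<in> Poly_Mapping.keys f \<Longrightarrow> \<phi> x \<in> carrier V"
    and "\<And>x. x \<in> Poly_Mapping.keys g \<Longrightarrow> \<phi> x \<in> carrier V"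
  shows "lin_ext V \<phi> (f + g) = lin_ext V \<phi> f \<oplus> lin_ext V \<phi> g"
proof -
  let ?K = "Poly_Mapping.keys f \<union> Poly_Mapping.keys g"
  have "lin_ext V \<phi> h = (\<Oplus>x\<in>?K. Poly_Mapping.lookup h x \<odot> \<phi> x)"
    if "Poly_Mapping.keys h \<subseteq> ?K" for h
    by (rule lin_ext_superset) (use that assms in auto)
  from this[OF Poly_Mapping.keys_add] this[of f] this[of g]
  have "lin_ext V \<phi> (f + g) = (\<Oplus>x\<in>?K. Poly_Mapping.lookup (f + g) x \<odot> \<phi> x)"
    "lin_ext V \<phi> f = (\<Oplus>x\<in>?K. Poly_Mapping.lookup f x \<odot> \<phi> x)"
    "lin_ext V \<phi> g = (\<Oplus>x\<in>?K. Poly_Mapping.lookup g x \<odot> \<phi> x)"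
    by auto
  moreover have "(\<Oplus>x\<in>?K. Poly_Mapping.lookup (f + g) x \<odot> \<phi> x)
      = (\<Oplus>x\<in>?K. Poly_Mapping.lookup f x \<odot> \<phi> x \<oplus> Poly_Mapping.lookup g x \<odot> \<phi> x)"
    by (rule finsum_cong') (use assms in \<open>auto simp: lookup_add scale_add_left\<close>)
  moreover have "(\<Oplus>x\<in>?K. Poly_Mapping.lookup f x \<odot> \<phi> x \<oplus> Poly_Mapping.lookup g x \<odot> \<phi> x)
      = (\<Oplus>x\<in>?K. Poly_Mapping.lookup f x \<odot> \<phi> x) \<oplus> (\<Oplus>x\<in>?K. Poly_Mapping.lookup g x \<odot> \<phi> x)"
    by (rule finsum_addf) (use assms in auto)
  ultimately show ?thesis
    by simp
qed

lemma lin_ext_scale: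
  assumes "\<And>x. x \<in> Poly_Mapping.keys f \<Longrightarrow> \<phi> x \<in> carrier V"
  shows "lin_ext V \<phi> (Poly_Mapping.map ((*) c) f) = c \<odot> lin_ext V \<phi> f"
proof -
  have "lin_ext V \<phi> (Poly_Mapping.map ((*) c) f)
      = (\<Oplus>x\<in>Poly_Mapping.keys f. Poly_Mapping.lookup (Poly_Mapping.map ((*) c) f) x \<odot> \<phi> x)"
    by (rule lin_ext_superset[OF _ keys_map_scale]) (use assms in auto)
  also have "\<dots> = (\<Oplus>x\<in>Poly_Mapping.keys f. c \<odot> (Poly_Mapping.lookup f x \<odot> \<phi> x))"
    by (rule finsum_cong') (use assms in \<open>auto simp: scale_scale\<close>)
  also have "\<dots> = c \<odot> lin_ext V \<phi> f"
    unfolding lin_ext_def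
    by (rule finsum_smult_ldistr[symmetric]) (use assms in auto)
  finally show ?thesis .
qed

lemma lin_ext_diff:
  assumes "\<And>x. x \<in> Poly_Mapping.keys f \<Longrightarrow> \<phi> x \<in> carrier V"
    and "\<And>x. x \<in> Poly_Mapping.keys g \<Longrightarrow> \<phi> x \<in> carrier V"
  shows "lin_ext V \<phi> (f - g) = lin_ext V \<phi> f \<ominus> lin_ext V \<phi> g"
proof -
  have "lin_ext V \<phi> (f + Poly_Mapping.map ((*) (-1)) g)
      = lin_ext V \<phi> f \<oplus> (-1) \<odot> lin_ext V \<phi> g"
    using assms keys_map_scale[of "-1" g]
    by (subst lin_ext_add) (auto simp: lin_ext_scale)
  then show ?thesis
    using assms by (simp add: map_scale_linear a_minus_def a_inv_eq_scale lin_ext_closed)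
qed

end

section \<open>Linear maps and quotients by a subspace\<close>

definition clinear :: "(complex, 'v, 'm) module_scheme \<Rightarrow> (complex, 'w, 'n) module_scheme \<Rightarrow> ('v \<Rightarrow> 'w) set" where
  "clinear V W = {h \<in> carrier V \<rightarrow> carrier W.
     (\<forall>x\<in>carrier V. \<forall>y\<in>carrier V. h (x \<oplus>\<^bsub>V\<^esub> y) = h x \<oplus>\<^bsub>W\<^esub> h y) \<and>
     (\<forall>c. \<forall>x\<in>carrier V. h (c \<odot>\<^bsub>V\<^esub> x) = c \<odot>\<^bsub>W\<^esub> h x)}"

lemma clinearI:
  assumes "\<And>x. x \<in> carrier V \<Longrightarrow> h x \<in> carrier W"
    and "\<And>x y. x \<in> carrier V \<Longrightarrow> y \<in> carrier V \<Longrightarrow> h (x \<oplus>\<^bsub>V\<^esub> y) = h x \<oplus>\<^bsub>W\<^esub> h y"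
    and "\<And>c x. x \<in> carrier V \<Longrightarrow> h (c \<odot>\<^bsub>V\<^esub> x) = c \<odot>\<^bsub>W\<^esub> h x"
  shows "h \<in> clinear V W"
  using assms by (auto simp: clinear_def)

lemma clinearD:
  assumes "h \<in> clinear V W"
  shows "x \<in> carrier V \<Longrightarrow> h x \<in> carrier W"
    and "x \<in> carrier V \<Longrightarrow> y \<in> carrier V \<Longrightarrow> h (x \<oplus>\<^bsub>V\<^esub> y) = h x \<oplus>\<^bsub>W\<^esub> h y"
    and "x \<in> carrier V \<Longrightarrow> h (c \<odot>\<^bsub>V\<^esub> x) = c \<odot>\<^bsub>W\<^esub> h x"
  using assms by (auto simp: clinear_def)

lemma clinear_comp: "g \<in> clinear V W \<Longrightarrow> h \<in> clinear U V \<Longrightarrow> (\<lambda>x. g (h x)) \<in> clinear U W"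
  by (auto simp: clinear_def Pi_iff)

lemma clinear_id: "id \<in> clinear V V"
  by (simp add: clinear_def)

lemma (in cmodule) clinear_facts:
  assumes "cmodule W" "h \<in> clinear V W"
  shows "h \<zero> = \<zero>\<^bsub>W\<^esub>" "x \<in> carrier V \<Longrightarrow> h (\<ominus> x) = \<ominus>\<^bsub>W\<^esub> h x"
    "x \<in> carrier V \<Longrightarrow> y \<in> carrier V \<Longrightarrow> h (x \<ominus> y) = h x \<ominus>\<^bsub>W\<^esub> h y"
proof -
  interpret W: cmodule W by fact
  note h = clinearD[OF assms(2)]
  show "h \<zero> = \<zero>\<^bsub>W\<^esub>"
    using h(3)[of \<zero> 0] h(1)[of \<zero>] by simp
  show neg: "h (\<ominus> x) = \<ominus>\<^bsub>W\<^esub> h x" if "x \<in> carrier V" for x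
    using that h(3)[of x "-1"] h(1)[of x] by (simp add: a_inv_eq_scale W.a_inv_eq_scale)
  show "h (x \<ominus> y) = h x \<ominus>\<^bsub>W\<^esub> h y" if "x \<in> carrier V" "y \<in> carrier V"
    using that neg h(2)[of x "\<ominus> y"] by (simp add: a_minus_def)
qed

text \<open>Only the vector space operations of \<open>Q\<close> are prescribed and its product is
  left open. Hence the same theory serves the tensor product and the quotient of the free algebra,
  whose products arise differently.\<close>

locale quotient_cmodule = M: cmodule M for M :: "(complex, 'a, 'k) module_scheme" +
  fixes N and Q :: "(complex, 'a set, 'm) module_scheme"
  assumes N: "submodule N complex_alg M"
    and Q: "carrier Q = a_rcosets\<^bsub>M\<^esub> N" "zero Q = N" "add Q = set_add M"
      "smult Q = (\<lambda>c Z. \<Union>x\<in>Z. N +>\<^bsub>M\<^esub> (c \<odot>\<^bsub>M\<^esub> x))"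
begin

abbreviation proj where "proj x \<equiv> N +>\<^bsub>M\<^esub> x"

sublocale AS: abelian_subgroup N M
  by (rule abelian_subgroupI3)
    (auto intro!: additive_subgroup.intro submodule.axioms(1)[OF N] M.M.abelian_group_axioms)

lemmas N_facts = M.submodule_facts[OF N]

lemma in_proj_iff:
  assumes "x \<in> carrier M" "y \<in> carrier M"
  shows "x \<in> proj y \<longleftrightarrow> x \<ominus>\<^bsub>M\<^esub> y \<in> N"
proof
  assume "x \<in> proj y"
  then obtain h where "h \<in> N" "x = h \<oplus>\<^bsub>M\<^esub> y" by (auto simp: a_r_coset_def')
  then show "x \<ominus>\<^bsub>M\<^esub> y \<in> N"
    using assms N_facts(1) by (auto simp: M.a_assoc M.r_neg a_minus_def subset_iff)
next
  assume *: "x \<ominus>\<^bsub>M\<^esub> y \<in> N"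
  have "x = (x \<ominus>\<^bsub>M\<^esub> y) \<oplus>\<^bsub>M\<^esub> y"
    using assms by (simp add: M.a_assoc M.l_neg a_minus_def)
  with * show "x \<in> proj y" by (auto simp: a_r_coset_def')
qed

lemma proj_eq_iff:
  assumes "x \<in> carrier M" "y \<in> carrier M"
  shows "proj x = proj y \<longleftrightarrow> x \<ominus>\<^bsub>M\<^esub> y \<in> N"
  using in_proj_iff[OF assms] AS.a_rcos_self[OF assms(1)]
    M.a_repr_independence[OF _ assms(2) AS.a_subgroup, of x] by blast

lemma proj_subset: "x \<in> carrier M \<Longrightarrow> proj x \<subseteq> carrier M"
  using M.a_r_coset_subset_G[OF N_facts(1)] by blast

lemma proj_memD:
  assumes "x \<in> proj y" "y \<in> carrier M"
  shows "x \<in> carrier M" "x \<ominus>\<^bsub>M\<^esub> y \<in> N" "proj x = proj y"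
proof -
  show x: "x \<in> carrier M" using assms proj_subset by auto
  show "x \<ominus>\<^bsub>M\<^esub> y \<in> N" using assms x in_proj_iff by simp
  then show "proj x = proj y" using assms x proj_eq_iff by simp
qed

lemma carrier_eq: "carrier Q = proj ` carrier M"
  by (auto simp: Q A_RCOSETS_def')

lemma proj_closed [simp]: "x \<in> carrier M \<Longrightarrow> proj x \<in> carrier Q"
  by (simp add: carrier_eq)

lemma carrierE:
  assumes "Z \<in> carrier Q"
  obtains x where "x \<in> carrier M" "Z = proj x"
  using assms by (auto simp: carrier_eq)

lemma proj_zero: "\<zero>\<^bsub>Q\<^esub> = proj \<zero>\<^bsub>M\<^esub>"
  using N_facts(1) by (simp add: Q)

lemma proj_eq_zero_iff: "x \<in> carrier M \<Longrightarrow> proj x = \<zero>\<^bsub>Q\<^esub> \<longleftrightarrow> x \<in> N"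
  by (simp add: proj_zero proj_eq_iff a_minus_def M.a_inv_eq_scale)

lemma proj_add: "x \<in> carrier M \<Longrightarrow> y \<in> carrier M \<Longrightarrow> proj x \<oplus>\<^bsub>Q\<^esub> proj y = proj (x \<oplus>\<^bsub>M\<^esub> y)"
  by (simp add: Q AS.a_rcos_sum)

text \<open>Operations on the quotient are unions over all representatives. A coset contains its
  representative, so the union collapses to one value as soon as that value does not depend on the
  choice.\<close>

lemma UN_const_on_coset:
  assumes "x \<in> carrier M" "\<And>y. y \<in> proj x \<Longrightarrow> G y = G x"
  shows "(\<Union>y\<in>proj x. G y) = G x"
  using assms AS.a_rcos_self[OF assms(1)] by blast

lemma proj_scale:
  assumes "x \<in> carrier M"
  shows "c \<odot>\<^bsub>Q\<^esub> proj x = proj (c \<odot>\<^bsub>M\<^esub> x)"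
  unfolding Q
proof (rule UN_const_on_coset[OF assms])
  fix y assume y: "y \<in> proj x"
  note D = proj_memD[OF y assms]
  have "c \<odot>\<^bsub>M\<^esub> y \<ominus>\<^bsub>M\<^esub> c \<odot>\<^bsub>M\<^esub> x = c \<odot>\<^bsub>M\<^esub> (y \<ominus>\<^bsub>M\<^esub> x)"
    using D assms
    by (simp add: a_minus_def M.a_inv_eq_scale M.scale_scale M.scale_add_right mult.commute)
  then show "proj (c \<odot>\<^bsub>M\<^esub> y) = proj (c \<odot>\<^bsub>M\<^esub> x)"
    using D assms N_facts(5) by (simp add: proj_eq_iff)
qed

sublocale Q: cmodule Q
proof (rule cmoduleI)
  show "abelian_group Q"
  proof (rule abelian_groupI)
    fix Z assume "Z \<in> carrier Q"
    then obtain x where x: "x \<in> carrier M" "Z = proj x" by (rule carrierE)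
    then show "\<exists>Y\<in>carrier Q. Y \<oplus>\<^bsub>Q\<^esub> Z = \<zero>\<^bsub>Q\<^esub>"
      by (intro bexI[of _ "proj (\<ominus>\<^bsub>M\<^esub> x)"]) (auto simp: proj_add proj_zero M.l_neg)
  qed (auto elim!: carrierE simp: proj_add proj_zero M.a_ac)
qed (auto elim!: carrierE
    simp: proj_add proj_scale M.scale_add_left M.scale_add_right M.scale_scale)

lemma proj_clinear: "proj \<in> clinear M Q"
  by (rule clinearI) (auto simp: proj_add proj_scale)

text \<open>Since \<open>h\<close> kills \<open>N\<close>, it is constant on each coset, so the
  image is a singleton and \<open>the_elem\<close> is meaningful. This is the factorization of a
  linear map through the quotient.\<close>

lemma the_elem_image_proj:
  assumes W: "cmodule W" and h: "h \<in> clinear M W" and ker: "\<And>n. n \<in> N \<Longrightarrow> h n = \<zero>\<^bsub>W\<^esub>"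
    and x: "x \<in> carrier M"
  shows "the_elem (h ` proj x) = h x"
proof -
  interpret W: cmodule W by fact
  have "h y = h x" if "y \<in> proj x" for y
  proof -
    note D = proj_memD[OF that x]
    have "h y \<ominus>\<^bsub>W\<^esub> h x = \<zero>\<^bsub>W\<^esub>"
      using ker[OF D(2)] M.clinear_facts(3)[OF W h D(1) x] by simp
    then show ?thesis
      using clinearD(1)[OF h] D(1) x W.minus_equality[of "h y" "\<ominus>\<^bsub>W\<^esub> h x"]
      by (simp add: a_minus_def)
  qed
  then have "h ` proj x = {h x}"
    using AS.a_rcos_self[OF x] by blast
  then show ?thesis by simp
qed

lemma the_elem_image_clinear:
  assumes "cmodule W" "h \<in> clinear M W" "\<And>n. n \<in> N \<Longrightarrow> h n = \<zero>\<^bsub>W\<^esub>"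
  shows "(\<lambda>Z. the_elem (h ` Z)) \<in> clinear Q W"
  by (rule clinearI)
    (auto elim!: carrierE simp: the_elem_image_proj[OF assms] proj_add proj_scale clinearD[OF assms(2)])

end

section \<open>Universal property of the tensor product\<close>

definition cbilinear :: "(complex, 'a, 'k) module_scheme \<Rightarrow> (complex, 'b, 'l) module_scheme
    \<Rightarrow> (complex, 'v, 'm) module_scheme \<Rightarrow> ('a \<Rightarrow> 'b \<Rightarrow> 'v) \<Rightarrow> bool" where
  "cbilinear A B V \<phi> \<longleftrightarrow>
     (\<forall>a\<in>carrier A. \<phi> a \<in> clinear B V) \<and> (\<forall>b\<in>carrier B. (\<lambda>a. \<phi> a b) \<in> clinear A V)"

lemma cbilinearI:
  assumes "\<And>a. a \<in> carrier A \<Longrightarrow> \<phi> a \<in> clinear B V"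
    and "\<And>b. b \<in> carrier B \<Longrightarrow> (\<lambda>a. \<phi> a b) \<in> clinear A V"
  shows "cbilinear A B V \<phi>"
  using assms by (simp add: cbilinear_def)

lemma cbilinearD:
  assumes "cbilinear A B V \<phi>"
  shows "a \<in> carrier A \<Longrightarrow> b \<in> carrier B \<Longrightarrow> \<phi> a b \<in> carrier V"
    and "a \<in> carrier A \<Longrightarrow> a' \<in> carrier A \<Longrightarrow> b \<in> carrier B \<Longrightarrow>
      \<phi> (a \<oplus>\<^bsub>A\<^esub> a') b = \<phi> a b \<oplus>\<^bsub>V\<^esub> \<phi> a' b"
    and "a \<in> carrier A \<Longrightarrow> b \<in> carrier B \<Longrightarrow> b' \<in> carrier B \<Longrightarrow>
      \<phi> a (b \<oplus>\<^bsub>B\<^esub> b') = \<phi> a b \<oplus>\<^bsub>V\<^esub> \<phi> a b'"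
    and "a \<in> carrier A \<Longrightarrow> b \<in> carrier B \<Longrightarrow> \<phi> (c \<odot>\<^bsub>A\<^esub> a) b = c \<odot>\<^bsub>V\<^esub> \<phi> a b"
    and "a \<in> carrier A \<Longrightarrow> b \<in> carrier B \<Longrightarrow> \<phi> a (c \<odot>\<^bsub>B\<^esub> b) = c \<odot>\<^bsub>V\<^esub> \<phi> a b"
  using assms by (auto simp: cbilinear_def clinear_def Pi_iff)

lemma tensor_pre_simps [simp]:
  "carrier (tensor_pre A B) = {f. Poly_Mapping.keys f \<subseteq> carrier A \<times> carrier B}"
  "zero (tensor_pre A B) = 0" "add (tensor_pre A B) = (+)"
  "smult (tensor_pre A B) = (\<lambda>c. Poly_Mapping.map ((*) c))"
  by (simp_all add: tensor_pre_def)

lemma keys_add_subset: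
  "Poly_Mapping.keys f \<subseteq> K \<Longrightarrow> Poly_Mapping.keys g \<subseteq> K \<Longrightarrow> Poly_Mapping.keys (f + g) \<subseteq> K"
  using Poly_Mapping.keys_add[of f g] by blast

lemma keys_scale_subset:
  "Poly_Mapping.keys f \<subseteq> K \<Longrightarrow> Poly_Mapping.keys (Poly_Mapping.map ((*) c) f) \<subseteq> K"
  for f :: "'x \<Rightarrow>\<^sub>0 complex"
  using keys_map_scale[of c f] by blast

lemma keys_uminus_complex: "Poly_Mapping.keys (- f) = Poly_Mapping.keys f"
  for f :: "'x \<Rightarrow>\<^sub>0 complex"
  by (auto simp: in_keys_iff)

lemma cmodule_tensor_pre: "cmodule (tensor_pre A B)"
proof (rule cmoduleI)
  show "abelian_group (tensor_pre A B)"
    by (rule abelian_group_typeI[OF _ _ tensor_pre_simps(1)])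
      (simp_all add: keys_add_subset keys_uminus_complex)
qed (auto dest: keys_scale_subset simp: map_scale_linear)

locale tensor_modules = A: cmodule A + B: cmodule B
  for A :: "('a, 'm) superalg_scheme" and B :: "('b, 'n) superalg_scheme"
begin

lemma pre_minus:
  assumes "g \<in> carrier (tensor_pre A B)"
  shows "f \<ominus>\<^bsub>tensor_pre A B\<^esub> g = f - g"
proof -
  interpret P: cmodule "tensor_pre A B" by (rule cmodule_tensor_pre)
  show ?thesis
    using assms P.a_inv_eq_scale[of g] by (simp add: a_minus_def map_scale_linear)
qed

lemma relators_subset: "tensor_relators A B \<subseteq> carrier (tensor_pre A B)"
proof -
  have *: "f - g \<in> carrier (tensor_pre A B)"
    if "f \<in> carrier (tensor_pre A B)" "g \<in> carrier (tensor_pre A B)" for f g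
    using that Poly_Mapping.keys_diff[of f g] by auto
  show ?thesis
    unfolding tensor_relators_def by (auto simp del: tensor_pre_simps intro!: *) auto
qed

text \<open>Subspaces are stable under intersection. The whole carrier belongs to the intersected
  family, which keeps the result inside the carrier.\<close>

lemma tensor_null_submodule: "submodule (tensor_null A B) complex_alg (tensor_pre A B)"
proof -
  interpret P: cmodule "tensor_pre A B" by (rule cmodule_tensor_pre)
  have car: "submodule (carrier (tensor_pre A B)) complex_alg (tensor_pre A B)"
    by (rule P.carrier_is_submodule)
  show ?thesis
  proof (rule P.csubmoduleI)
    show "tensor_null A B \<subseteq> carrier (tensor_pre A B)"
      unfolding tensor_null_def using car relators_subset by blast
  qed (auto simp: tensor_null_def simp del: tensor_pre_simps dest: P.submodule_facts)
qed

lemma tensor_null_relators: "tensor_relators A B \<subseteq> tensor_null A B"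
  by (auto simp: tensor_null_def)

sublocale T: quotient_cmodule "tensor_pre A B" "tensor_null A B" "tensor A B"
  by (intro quotient_cmodule.intro quotient_cmodule_axioms.intro cmodule_tensor_pre
      tensor_null_submodule) (simp_all add: tensor_def)

lemma tens_eq_proj: "tens A B a b = T.proj (Poly_Mapping.single (a, b) 1)"
  by (simp add: tens_def)

lemma single_in_pre [simp]:
  "a \<in> carrier A \<Longrightarrow> b \<in> carrier B \<Longrightarrow> Poly_Mapping.single (a, b) c \<in> carrier (tensor_pre A B)"
  by simp

lemma tens_closed [simp]:
  "a \<in> carrier A \<Longrightarrow> b \<in> carrier B \<Longrightarrow> tens A B a b \<in> carrier (tensor A B)"
  by (simp add: tens_eq_proj del: tensor_pre_simps)

lemma proj_eqI:
  assumes "f \<in> carrier (tensor_pre A B)" "g \<in> carrier (tensor_pre A B)" "f - g \<in> tensor_null A B"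
  shows "T.proj f = T.proj g"
  using assms by (simp add: T.proj_eq_iff pre_minus del: tensor_pre_simps)

lemma scale_tens:
  "a \<in> carrier A \<Longrightarrow> b \<in> carrier B \<Longrightarrow>
    c \<odot>\<^bsub>tensor A B\<^esub> tens A B a b = T.proj (Poly_Mapping.single (a, b) c)"
  by (simp add: tens_eq_proj T.proj_scale)

lemma add_tens:
  "a \<in> carrier A \<Longrightarrow> b \<in> carrier B \<Longrightarrow> a' \<in> carrier A \<Longrightarrow> b' \<in> carrier B \<Longrightarrow>
    tens A B a b \<oplus>\<^bsub>tensor A B\<^esub> tens A B a' b'
      = T.proj (Poly_Mapping.single (a, b) 1 + Poly_Mapping.single (a', b') 1)"
  by (simp add: tens_eq_proj T.proj_add)

lemma pre_add_closed:
  "f \<in> carrier (tensor_pre A B) \<Longrightarrow> g \<in> carrier (tensor_pre A B) \<Longrightarrow> f + g \<in> carrier (tensor_pre A B)"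
  by (simp add: keys_add_subset)

text \<open>Each of the four laws is one family of relators read modulo the subspace that they
  generate.\<close>

lemma tens_bilinear: "cbilinear A B (tensor A B) (tens A B)"
proof (intro cbilinearI clinearI)
  note [simp del] = tensor_pre_simps
  fix a b c assume ab: "a \<in> carrier A" "b \<in> carrier B"
  show "tens A B a b \<in> carrier (tensor A B)" "tens A B a b \<in> carrier (tensor A B)"
    using ab by auto
  show "tens A B (c \<odot>\<^bsub>A\<^esub> a) b = c \<odot>\<^bsub>tensor A B\<^esub> tens A B a b"
    unfolding scale_tens[OF ab] unfolding tens_eq_proj using ab
    by (intro proj_eqI subsetD[OF tensor_null_relators]) (auto simp: tensor_relators_def)
  show "tens A B a (c \<odot>\<^bsub>B\<^esub> b) = c \<odot>\<^bsub>tensor A B\<^esub> tens A B a b"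
    unfolding scale_tens[OF ab] unfolding tens_eq_proj using ab
    by (intro proj_eqI subsetD[OF tensor_null_relators]) (auto simp: tensor_relators_def)
  show "tens A B (a \<oplus>\<^bsub>A\<^esub> a') b = tens A B a b \<oplus>\<^bsub>tensor A B\<^esub> tens A B a' b"
    if "a' \<in> carrier A" for a'
    using ab that
    by (subst add_tens, simp_all, unfold tens_eq_proj,
        intro proj_eqI subsetD[OF tensor_null_relators] pre_add_closed)
      (auto simp: tensor_relators_def diff_diff_eq)
  show "tens A B a (b \<oplus>\<^bsub>B\<^esub> b') = tens A B a b \<oplus>\<^bsub>tensor A B\<^esub> tens A B a b'"
    if "b' \<in> carrier B" for b'
    using ab that
    by (subst add_tens, simp_all, unfold tens_eq_proj,
        intro proj_eqI subsetD[OF tensor_null_relators] pre_add_closed)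
      (auto simp: tensor_relators_def diff_diff_eq)
qed

lemmas tens_add_left = cbilinearD(2)[OF tens_bilinear]
  and tens_add_right = cbilinearD(3)[OF tens_bilinear]
  and tens_scale_left = cbilinearD(4)[OF tens_bilinear]
  and tens_scale_right = cbilinearD(5)[OF tens_bilinear]

lemma tens_zero_left [simp]: "b \<in> carrier B \<Longrightarrow> tens A B \<zero>\<^bsub>A\<^esub> b = \<zero>\<^bsub>tensor A B\<^esub>"
  using tens_scale_left[of "\<zero>\<^bsub>A\<^esub>" b 0] by simp

lemma tens_zero_right [simp]: "a \<in> carrier A \<Longrightarrow> tens A B a \<zero>\<^bsub>B\<^esub> = \<zero>\<^bsub>tensor A B\<^esub>"
  using tens_scale_right[of a "\<zero>\<^bsub>B\<^esub>" 0] by simp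

text \<open>There is no case for multiples or for zero: a scalar is absorbed into the left factor of
  a pure tensor, and zero is itself the pure tensor of two zeros.\<close>

lemma tensor_induct [consumes 1, case_names tens add]:
  assumes "t \<in> carrier (tensor A B)"
    and tens: "\<And>a b. a \<in> carrier A \<Longrightarrow> b \<in> carrier B \<Longrightarrow> P (tens A B a b)"
    and add: "\<And>s t. s \<in> carrier (tensor A B) \<Longrightarrow> t \<in> carrier (tensor A B) \<Longrightarrow> P s \<Longrightarrow> P t \<Longrightarrow>
      P (s \<oplus>\<^bsub>tensor A B\<^esub> t)"
  shows "P t"
proof -
  obtain f where f: "f \<in> carrier (tensor_pre A B)" and t: "t = T.proj f"
    using assms(1) by (rule T.carrierE)
  have "Poly_Mapping.keys f \<subseteq> carrier A \<times> carrier B" using f by simp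
  then have "P (T.proj f)"
  proof (induction f rule: poly_mapping_induct_keys)
    case zero
    have "T.proj 0 = tens A B \<zero>\<^bsub>A\<^esub> \<zero>\<^bsub>B\<^esub>"
      using T.proj_zero by simp
    then show ?case using tens[of "\<zero>\<^bsub>A\<^esub>" "\<zero>\<^bsub>B\<^esub>"] by (simp del: tens_zero_left tens_zero_right)
  next
    case (single x c)
    then obtain a b where x: "x = (a, b)" "a \<in> carrier A" "b \<in> carrier B" by auto
    then have "T.proj (Poly_Mapping.single x c) = tens A B (c \<odot>\<^bsub>A\<^esub> a) b"
      by (simp add: scale_tens tens_scale_left)
    then show ?case using x tens by simp
  next
    case (add f g)
    then show ?case
      using assms(3)[of "T.proj f" "T.proj g"] T.proj_closed[of f] T.proj_closed[of g]
        T.proj_add[of f g] by simp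
  qed
  then show ?thesis using t by simp
qed

context
  fixes V :: "('v, 'k) superalg_scheme" and \<phi> :: "'a \<Rightarrow> 'b \<Rightarrow> 'v"
  assumes V: "cmodule V" and \<phi>: "cbilinear A B V \<phi>"
begin

abbreviation (input) pre_lift where "pre_lift \<equiv> lin_ext V (\<lambda>x. \<phi> (fst x) (snd x))"

interpretation V: cmodule V by (rule V)

lemma bilinear_closed: "x \<in> carrier A \<times> carrier B \<Longrightarrow> \<phi> (fst x) (snd x) \<in> carrier V"
  using cbilinearD(1)[OF \<phi>] by auto

lemma pre_lift_clinear: "pre_lift \<in> clinear (tensor_pre A B) V"
proof (rule clinearI)
  fix f g c
  assume f: "f \<in> carrier (tensor_pre A B)"
  then have f': "\<And>x. x \<in> Poly_Mapping.keys f \<Longrightarrow> \<phi> (fst x) (snd x) \<in> carrier V"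
    using bilinear_closed by auto
  show "pre_lift f \<in> carrier V"
    using f' by (rule V.lin_ext_closed)
  show "pre_lift (c \<odot>\<^bsub>tensor_pre A B\<^esub> f) = c \<odot>\<^bsub>V\<^esub> pre_lift f"
    using f' by (simp add: V.lin_ext_scale)
  assume "g \<in> carrier (tensor_pre A B)"
  then have "\<And>x. x \<in> Poly_Mapping.keys g \<Longrightarrow> \<phi> (fst x) (snd x) \<in> carrier V"
    using bilinear_closed by auto
  with f' show "pre_lift (f \<oplus>\<^bsub>tensor_pre A B\<^esub> g) = pre_lift f \<oplus>\<^bsub>V\<^esub> pre_lift g"
    by (simp add: V.lin_ext_add)
qed

lemma pre_lift_single:
  "a \<in> carrier A \<Longrightarrow> b \<in> carrier B \<Longrightarrow> pre_lift (Poly_Mapping.single (a, b) c) = c \<odot>\<^bsub>V\<^esub> \<phi> a b"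
  using bilinear_closed[of "(a, b)"] by simp

lemma pre_lift_diff:
  assumes "f \<in> carrier (tensor_pre A B)" "g \<in> carrier (tensor_pre A B)"
  shows "pre_lift (f - g) = pre_lift f \<ominus>\<^bsub>V\<^esub> pre_lift g"
  using T.M.clinear_facts(3)[OF V pre_lift_clinear assms] pre_minus[OF assms(2)] by simp

text \<open>The kernel is a subspace, and bilinearity of \<open>\<phi>\<close> puts every relator
  into it. Minimality of \<open>tensor_null\<close> then gives the inclusion.\<close>

lemma pre_lift_null:
  assumes "n \<in> tensor_null A B"
  shows "pre_lift n = \<zero>\<^bsub>V\<^esub>"
proof -
  let ?K = "{f \<in> carrier (tensor_pre A B). pre_lift f = \<zero>\<^bsub>V\<^esub>}"
  note lin = clinearD[OF pre_lift_clinear]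
  have "submodule ?K complex_alg (tensor_pre A B)"
    by (rule T.M.csubmoduleI)
      (use lin T.M.clinear_facts(1)[OF V pre_lift_clinear] 
        in \<open>simp_all add: keys_add_subset keys_scale_subset Collect_mono_iff\<close>)
  moreover have "tensor_relators A B \<subseteq> ?K"
  proof -
    have diff_zero: "pre_lift (f - g) = \<zero>\<^bsub>V\<^esub>" if "f \<in> carrier (tensor_pre A B)"
      "g \<in> carrier (tensor_pre A B)" "pre_lift f = pre_lift g" for f g
      using that pre_lift_diff[OF that(1,2)] lin(1)[of g] by (simp add: a_minus_def V.r_neg)
    have diff_add_zero: "pre_lift (f - g - h) = \<zero>\<^bsub>V\<^esub>" if "f \<in> carrier (tensor_pre A B)"
      "g \<in> carrier (tensor_pre A B)" "h \<in> carrier (tensor_pre A B)"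
      "pre_lift f = pre_lift g \<oplus>\<^bsub>V\<^esub> pre_lift h" for f g h
      unfolding diff_diff_eq
      by (rule diff_zero) (use that pre_add_closed[of g h] lin(2)[of g h] in auto)
    show ?thesis
      unfolding tensor_relators_def Un_subset_iff
    proof (intro conjI subsetI; elim CollectE exE conjE; hypsubst)
      note [simp] = pre_lift_single cbilinearD[OF \<phi>]
        and [simp del] = tensor_pre_simps V.lin_ext_single
      have K: "r \<in> ?K" if "r \<in> tensor_relators A B" "pre_lift r = \<zero>\<^bsub>V\<^esub>" for r
        using that relators_subset by auto
      fix a a' b b' c
      assume ab: "a \<in> carrier A" "b \<in> carrier B"
      show "Poly_Mapping.single (a \<oplus>\<^bsub>A\<^esub> a', b) 1 - Poly_Mapping.single (a, b) 1
          - Poly_Mapping.single (a', b) 1 \<in> ?K" if "a' \<in> carrier A"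
        by (rule K; (rule diff_add_zero)?; use ab that in \<open>auto simp: tensor_relators_def\<close>)
      show "Poly_Mapping.single (a, b \<oplus>\<^bsub>B\<^esub> b') 1 - Poly_Mapping.single (a, b) 1
          - Poly_Mapping.single (a, b') 1 \<in> ?K" if "b' \<in> carrier B"
        by (rule K; (rule diff_add_zero)?; use ab that in \<open>auto simp: tensor_relators_def\<close>)
      show "Poly_Mapping.single (c \<odot>\<^bsub>A\<^esub> a, b) 1 - Poly_Mapping.single (a, b) c \<in> ?K"
        by (rule K; (rule diff_zero)?; use ab in \<open>auto simp: tensor_relators_def\<close>)
      show "Poly_Mapping.single (a, c \<odot>\<^bsub>B\<^esub> b) 1 - Poly_Mapping.single (a, b) c \<in> ?K"
        by (rule K; (rule diff_zero)?; use ab in \<open>auto simp: tensor_relators_def\<close>)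
    qed
  qed
  ultimately have "tensor_null A B \<subseteq> ?K"
    unfolding tensor_null_def by blast
  then show ?thesis using assms by auto
qed

lemma tensor_lift_proj:
  "f \<in> carrier (tensor_pre A B) \<Longrightarrow> tensor_lift V \<phi> (T.proj f) = pre_lift f"
  using T.the_elem_image_proj[OF V pre_lift_clinear pre_lift_null]
  by (simp add: tensor_lift_def lin_ext_def)

lemma tensor_lift_clinear: "tensor_lift V \<phi> \<in> clinear (tensor A B) V"
  using T.the_elem_image_clinear[OF V pre_lift_clinear pre_lift_null]
  by (simp add: tensor_lift_def[abs_def] lin_ext_def)

lemma tensor_lift_tens:
  "a \<in> carrier A \<Longrightarrow> b \<in> carrier B \<Longrightarrow> tensor_lift V \<phi> (tens A B a b) = \<phi> a b"
  using cbilinearD(1)[OF \<phi>]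
  by (simp add: tens_eq_proj tensor_lift_proj pre_lift_single del: V.lin_ext_single)

end

end

lemma tensor_map_facts:
  assumes "cmodule A" "cmodule B" "cmodule C" "cmodule D"
    and f: "f \<in> clinear A C" and g: "g \<in> clinear B D"
  shows tensor_map_clinear: "tensor_map C D f g \<in> clinear (tensor A B) (tensor C D)"
    and tensor_map_tens: "a \<in> carrier A \<Longrightarrow> b \<in> carrier B \<Longrightarrow>
      tensor_map C D f g (tens A B a b) = tens C D (f a) (g b)"
proof -
  interpret AB: tensor_modules A B using assms by (simp add: tensor_modules_def)
  interpret CD: tensor_modules C D using assms by (simp add: tensor_modules_def)
  have bil: "cbilinear A B (tensor C D) (\<lambda>a b. tens C D (f a) (g b))"
    by (intro cbilinearI clinearI)
      (simp_all add: clinearD[OF f] clinearD[OF g] CD.tens_add_left CD.tens_add_right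
        CD.tens_scale_left CD.tens_scale_right)
  show "tensor_map C D f g \<in> clinear (tensor A B) (tensor C D)"
    unfolding tensor_map_def by (rule AB.tensor_lift_clinear[OF CD.T.Q.cmodule_axioms bil])
  show "tensor_map C D f g (tens A B a b) = tens C D (f a) (g b)"
    if "a \<in> carrier A" "b \<in> carrier B"
    unfolding tensor_map_def
    using AB.tensor_lift_tens[OF CD.T.Q.cmodule_axioms bil that] .
qed

lemma cmodule_tensor: "cmodule A \<Longrightarrow> cmodule B \<Longrightarrow> cmodule (tensor A B)"
proof -
  assume "cmodule A" "cmodule B"
  then interpret tensor_modules A B by (simp add: tensor_modules_def)
  show ?thesis by (rule T.Q.cmodule_axioms)
qed

text \<open>The universal property is used twice: for fixed c in the pair (a, b), then for the
  resulting map of t and c. Linearity in c has to be known for every tensor t, not only for pure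
  ones, and follows by induction on t.\<close>

lemma tensor_assoc_facts:
  assumes "cmodule A" "cmodule B" "cmodule C"
  shows tensor_assoc_clinear:
      "tensor_assoc A B C \<in> clinear (tensor (tensor A B) C) (tensor A (tensor B C))"
    and tensor_assoc_tens: "a \<in> carrier A \<Longrightarrow> b \<in> carrier B \<Longrightarrow> c \<in> carrier C \<Longrightarrow>
      tensor_assoc A B C (tens (tensor A B) C (tens A B a b) c)
        = tens A (tensor B C) a (tens B C b c)"
proof -
  interpret AB: tensor_modules A B using assms by (simp add: tensor_modules_def)
  interpret BC: tensor_modules B C using assms by (simp add: tensor_modules_def)
  interpret ABC: tensor_modules "tensor A B" C
    using assms by (simp add: tensor_modules_def cmodule_tensor)
  interpret A_BC: tensor_modules A "tensor B C"
    using assms by (simp add: tensor_modules_def cmodule_tensor)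
  let ?W = "tensor A (tensor B C)"
  let ?\<phi> = "\<lambda>c a b. tens A (tensor B C) a (tens B C b c)"
  let ?\<psi> = "\<lambda>t c. tensor_lift ?W (?\<phi> c) t"
  have W: "cmodule ?W" by (rule A_BC.T.Q.cmodule_axioms)
  have bil: "cbilinear A B ?W (?\<phi> c)" if "c \<in> carrier C" for c
    by (intro cbilinearI clinearI)
      (simp_all add: that A_BC.tens_add_left A_BC.tens_add_right
        A_BC.tens_scale_left A_BC.tens_scale_right BC.tens_add_left BC.tens_scale_left)
  note lift_lin = AB.tensor_lift_clinear[OF W bil] and lift_tens = AB.tensor_lift_tens[OF W bil]
  have in_c: "?\<psi> t \<in> clinear C ?W" if t: "t \<in> carrier (tensor A B)" for t
  proof (rule clinearI)
    fix c d z assume c: "c \<in> carrier C"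
    show "?\<psi> t c \<in> carrier ?W" using clinearD(1)[OF lift_lin[OF c] t] .
    show "?\<psi> t (z \<odot>\<^bsub>C\<^esub> c) = z \<odot>\<^bsub>?W\<^esub> ?\<psi> t c"
      using t
      by (induction t rule: AB.tensor_induct)
        (simp_all add: lift_tens c clinearD[OF lift_lin] BC.tens_scale_right A_BC.tens_scale_right
          A_BC.T.Q.scale_add_right)
    assume d: "d \<in> carrier C"
    show "?\<psi> t (c \<oplus>\<^bsub>C\<^esub> d) = ?\<psi> t c \<oplus>\<^bsub>?W\<^esub> ?\<psi> t d"
      using t
      by (induction t rule: AB.tensor_induct)
        (simp_all add: lift_tens c d clinearD[OF lift_lin] BC.tens_add_right A_BC.tens_add_right
          A_BC.T.Q.M.a_ac)
  qed
  have bil2: "cbilinear (tensor A B) C ?W ?\<psi>"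
    by (rule cbilinearI) (simp_all add: in_c lift_lin)
  show "tensor_assoc A B C \<in> clinear (tensor (tensor A B) C) ?W"
    unfolding tensor_assoc_def by (rule ABC.tensor_lift_clinear[OF W bil2])
  show "tensor_assoc A B C (tens (tensor A B) C (tens A B a b) c)
      = tens A (tensor B C) a (tens B C b c)"
    if "a \<in> carrier A" "b \<in> carrier B" "c \<in> carrier C"
    unfolding tensor_assoc_def
    using ABC.tensor_lift_tens[OF W bil2, of "tens A B a b" c] that lift_tens by simp
qed

section \<open>Superalgebras\<close>

lemmas (in cmodule) vec_ac = M.a_assoc M.a_comm M.a_lcomm

text \<open>The ungraded part of a superalgebra. It is separate because evaluation at generators and
  passage to the opposite algebra make sense before a grading is available, and because
  \<open>superalgebraI\<close> builds the grading on top of it.\<close>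

locale calgebra = cmodule A + A?: ring A for A :: "('a, 'm) superalg_scheme" (structure) +
  assumes scale_mult_left:
      "\<lbrakk>a \<in> carrier A; b \<in> carrier A\<rbrakk> \<Longrightarrow> (c \<odot> a) \<otimes> b = c \<odot> (a \<otimes> b)"
    and scale_mult_right:
      "\<lbrakk>a \<in> carrier A; b \<in> carrier A\<rbrakk> \<Longrightarrow> a \<otimes> (c \<odot> b) = c \<odot> (a \<otimes> b)"

lemmas (in calgebra) alg_distrib = A.l_distr A.r_distr
  and alg_assoc = A.m_assoc

text \<open>These two rewrite sums and products of degrees to bitwise operations, which hides the grading.\<close>

declare add_bit_eq_xor [simp del] mult_bit_eq_and [simp del]

lemma bit_cases [case_names zero one]: "(i = 0 \<Longrightarrow> P) \<Longrightarrow> (i = 1 \<Longrightarrow> P) \<Longrightarrow> P" for i :: bit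
  by (cases i) auto

lemma koszul_simps [simp]: "koszul 0 j = 1" "koszul i 0 = 1" "koszul 1 1 = -1"
  by (simp_all add: koszul_def)

text \<open>The sign is a bicharacter of Z/2. Associativity of the signed product and
  multiplicativity of the grading involution on words both rest on this.\<close>

lemma koszul_add:
  "koszul (i + j) k = koszul i k * koszul j k" "koszul i (j + k) = koszul i j * koszul i k"
  by (cases i; cases j; cases k; simp)+

context superalgebra
begin

sublocale calgebra A
  by (intro calgebra.intro calgebra_axioms.intro cmodule.intro superalgebra.axioms[OF superalgebra_axioms]
      smult_mult_left smult_mult_right)

lemma grade_closed: "a \<in> grade A i \<Longrightarrow> a \<in> carrier A"
  using submodule_facts(1)[OF grade_submodule] by blast

lemmas grade_zero [simp] = submodule_facts(2)[OF grade_submodule]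
  and grade_add = submodule_facts(3)[OF grade_submodule]
  and grade_scale = submodule_facts(5)[OF grade_submodule]

lemma grade_decomp_unique:
  assumes "u \<in> grade A 0" "v \<in> grade A 1" "u' \<in> grade A 0" "v' \<in> grade A 1"
    "u \<oplus> v = u' \<oplus> v'"
  shows "u = u'" "v = v'"
proof -
  have "u \<oplus> v \<in> carrier A" using assms grade_closed by auto
  from grade_decomp[OF this] have "(u, v) = (u', v')"
    using assms by (metis (no_types, lifting) mem_Sigma_iff fst_conv snd_conv)
  then show "u = u'" "v = v'" by simp_all
qed

text \<open>Uniqueness of the decomposition is what makes the definite description in
  \<open>graded_part\<close> denote. The complementary degree \<open>i + 1\<close> is taken in Z/2,
  so that 1 + 1 = 0.\<close>

lemma graded_part_add_homogeneous:
  assumes "u \<in> grade A 0" "v \<in> grade A 1"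
  shows "graded_part A 0 (u \<oplus> v) = u" "graded_part A 1 (u \<oplus> v) = v"
proof -
  show "graded_part A 0 (u \<oplus> v) = u"
    unfolding graded_part_def
  proof (rule the_equality)
    show "u \<in> grade A 0 \<and> (\<exists>w\<in>grade A (0 + 1). u \<oplus> v = u \<oplus> w)"
      using assms by auto
    fix w assume "w \<in> grade A 0 \<and> (\<exists>z\<in>grade A (0 + 1). u \<oplus> v = w \<oplus> z)"
    then obtain z where z: "w \<in> grade A 0" "z \<in> grade A 1" "u \<oplus> v = w \<oplus> z" by auto
    then show "w = u" using grade_decomp_unique(1)[OF assms z(1,2)] by simp
  qed
  show "graded_part A 1 (u \<oplus> v) = v"
    unfolding graded_part_def
  proof (rule the_equality)
    show "v \<in> grade A 1 \<and> (\<exists>w\<in>grade A (1 + 1). u \<oplus> v = v \<oplus> w)"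
      using assms vec_ac(2)[OF assms[THEN grade_closed]] by (intro conjI bexI[of _ u]) simp_all
    fix w assume "w \<in> grade A 1 \<and> (\<exists>z\<in>grade A (1 + 1). u \<oplus> v = w \<oplus> z)"
    then obtain z where z: "w \<in> grade A 1" "z \<in> grade A 0" "u \<oplus> v = w \<oplus> z" by auto
    then have "u \<oplus> v = z \<oplus> w"
      by (simp only: vec_ac(2)[OF z(1,2)[THEN grade_closed]])
    then show "w = v" using grade_decomp_unique(2)[OF assms z(2,1)] by simp
  qed
qed

lemma carrier_decompE:
  assumes "a \<in> carrier A"
  obtains u v where "u \<in> grade A 0" "v \<in> grade A 1" "a = u \<oplus> v"
  using ex1_implies_ex[OF grade_decomp[OF assms]] by auto

lemma graded_part_grade:
  assumes "a \<in> carrier A"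
  shows "graded_part A i a \<in> grade A i"
proof -
  obtain u v where "u \<in> grade A 0" "v \<in> grade A 1" "a = u \<oplus> v"
    using assms by (rule carrier_decompE)
  then show ?thesis by (cases i) (simp_all add: graded_part_add_homogeneous)
qed

lemma graded_part_closed [simp]: "a \<in> carrier A \<Longrightarrow> graded_part A i a \<in> carrier A"
  using graded_part_grade grade_closed by blast

lemma graded_part_decomp:
  assumes "a \<in> carrier A"
  shows "graded_part A 0 a \<oplus> graded_part A 1 a = a"
proof -
  obtain u v where "u \<in> grade A 0" "v \<in> grade A 1" "a = u \<oplus> v"
    using assms by (rule carrier_decompE)
  then show ?thesis by (simp add: graded_part_add_homogeneous)
qed

lemma graded_part_homogeneous:
  assumes "a \<in> grade A i"
  shows "graded_part A j a = (if j = i then a else \<zero>)"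
proof (cases i)
  case zero
  then show ?thesis
    using assms graded_part_add_homogeneous[of a \<zero>] grade_closed[OF assms] by (cases j) simp_all
next
  case one
  then show ?thesis
    using assms graded_part_add_homogeneous[of \<zero> a] grade_closed[OF assms] by (cases j) simp_all
qed

lemma graded_part_clinear: "graded_part A i \<in> clinear A A"
proof (rule clinearI)
  fix a b c assume a: "a \<in> carrier A"
  then obtain u v where u: "u \<in> grade A 0" "v \<in> grade A 1" "a = u \<oplus> v" by (rule carrier_decompE)
  note u' = u(1,2)[THEN grade_closed]
  show "graded_part A i a \<in> carrier A" using a by simp
  show "graded_part A i (c \<odot> a) = c \<odot> graded_part A i a"
    using u u' by (cases i) (simp_all add: graded_part_add_homogeneous scale_add_right grade_scale)
  assume b: "b \<in> carrier A"
  then obtain w z where w: "w \<in> grade A 0" "z \<in> grade A 1" "b = w \<oplus> z" by (rule carrier_decompE)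
  note w' = w(1,2)[THEN grade_closed]
  have "a \<oplus> b = (u \<oplus> w) \<oplus> (v \<oplus> z)"
    using u' w' u(3) w(3) by (simp add: vec_ac)
  then show "graded_part A i (a \<oplus> b) = graded_part A i a \<oplus> graded_part A i b"
    using u w by (cases i) (simp_all add: graded_part_add_homogeneous grade_add)
qed

lemmas graded_part_add = clinearD(2)[OF graded_part_clinear]
  and graded_part_scale = clinearD(3)[OF graded_part_clinear]

text \<open>The grading involution, an operator and not the degree of an element. It is the witness
  for \<open>superalgebraI\<close> when tensor products and opposite algebras are formed.\<close>

definition parity where "parity a = graded_part A 0 a \<oplus> (- 1) \<odot> graded_part A 1 a"

lemma parity_clinear: "parity \<in> clinear A A"
  by (rule clinearI)
    (simp_all add: parity_def graded_part_add graded_part_scale scale_add_right scale_scale vec_ac)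

lemma parity_homogeneous: "a \<in> grade A i \<Longrightarrow> parity a = koszul i 1 \<odot> a"
  using grade_closed[of a i] by (cases i) (simp_all add: parity_def graded_part_homogeneous)

end

text \<open>Existence of a decomposition is usually easy, while its uniqueness would call for a
  basis. A linear \<open>\<sigma>\<close> acting by (-1)^i in degree i replaces the basis: (u + v) +
  \<sigma>(u + v) = 2u determines u, and then v.\<close>

lemma superalgebraI:
  fixes A (structure)
  assumes "calgebra A" and sub: "\<And>i. submodule (grade A i) complex_alg A"
    and "\<And>i j a b. a \<in> grade A i \<Longrightarrow> b \<in> grade A j \<Longrightarrow> a \<otimes> b \<in> grade A (i + j)"
    and "\<one> \<in> grade A 0"
    and ex: "\<And>a. a \<in> carrier A \<Longrightarrow> \<exists>u\<in>grade A 0. \<exists>v\<in>grade A 1. a = u \<oplus> v"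
    and \<sigma>: "\<sigma> \<in> clinear A A" "\<And>i a. a \<in> grade A i \<Longrightarrow> \<sigma> a = koszul i 1 \<odot> a"
  shows "superalgebra A"
proof -
  interpret calgebra A by fact
  note closed = subsetD[OF submodule_facts(1)[OF sub]]
  have double: "(u \<oplus> v) \<oplus> \<sigma> (u \<oplus> v) = 2 \<odot> u" if "u \<in> grade A 0" "v \<in> grade A 1" for u v
  proof -
    note uv = that[THEN closed]
    have "(u \<oplus> v) \<oplus> \<sigma> (u \<oplus> v) = (u \<oplus> v) \<oplus> (u \<oplus> (- 1) \<odot> v)"
      using uv \<sigma>(2)[OF that(1)] \<sigma>(2)[OF that(2)] by (simp add: clinearD(2)[OF \<sigma>(1)])
    also have "\<dots> = (1 \<odot> u \<oplus> 1 \<odot> u) \<oplus> (1 \<odot> v \<oplus> (- 1) \<odot> v)"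
      using uv by (simp add: vec_ac)
    also have "\<dots> = 2 \<odot> u"
      using uv by (simp add: scale_add_left[symmetric] del: scale_one)
    finally show ?thesis .
  qed
  have unique: "u = u' \<and> v = v'" if "u \<in> grade A 0" "v \<in> grade A 1" "u' \<in> grade A 0"
    "v' \<in> grade A 1" "u \<oplus> v = u' \<oplus> v'" for u v u' v'
  proof -
    note cl = that(1-4)[THEN closed]
    have "(1/2) \<odot> (2 \<odot> u) = (1/2) \<odot> (2 \<odot> u')"
      using double[OF that(1,2)] double[OF that(3,4)] that(5) by simp
    then have "u = u'" using cl by (simp add: scale_scale)
    then show ?thesis using cl that(5) by simp
  qed
  show ?thesis
  proof (intro superalgebra.intro superalgebra_axioms.intro)
    fix a assume "a \<in> carrier A"
    then obtain u v where "u \<in> grade A 0" "v \<in> grade A 1" "a = u \<oplus> v" using ex by blast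
    then show "\<exists>!p. p \<in> grade A 0 \<times> grade A 1 \<and> a = fst p \<oplus> snd p"
      using unique by (intro ex1I[of _ "(u, v)"]) auto
  qed (use assms A.ring_axioms module_axioms scale_mult_left scale_mult_right in auto)
qed

lemma (in cmodule) lin_ext_clinear:
  assumes "cmodule W" "h \<in> clinear V W" "\<And>x. x \<in> Poly_Mapping.keys f \<Longrightarrow> \<phi> x \<in> carrier V"
  shows "h (lin_ext V \<phi> f) = lin_ext W (\<lambda>x. h (\<phi> x)) f"
proof -
  interpret W: cmodule W by fact
  note h = clinearD[OF assms(2)]
  have "h (\<Oplus>x\<in>K. c x \<odot> \<phi> x) = (\<Oplus>\<^bsub>W\<^esub>x\<in>K. c x \<odot>\<^bsub>W\<^esub> h (\<phi> x))"
    if "finite K" "\<And>x. x \<in> K \<Longrightarrow> \<phi> x \<in> carrier V" for K c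
    using that
  proof (induction K)
    case (insert x K)
    then show ?case
      using h by (subst finsum_insert W.finsum_insert, auto)+
  qed (simp add: clinear_facts(1)[OF assms(1,2)])
  then show ?thesis
    unfolding lin_ext_def using assms(3) by simp
qed

lemma (in tensor_modules) tens_clinear_bilinear:
  assumes "cmodule C" "cmodule D" "f \<in> clinear C A" "g \<in> clinear D B"
  shows "cbilinear C D (tensor A B) (\<lambda>c d. tens A B (f c) (g d))"
  by (intro cbilinearI clinearI)
    (simp_all add: clinearD[OF assms(3)] clinearD[OF assms(4)] tens_add_left tens_add_right
      tens_scale_left tens_scale_right)

lemma (in cmodule) cbilinear_add:
  assumes "cbilinear A B V \<phi>" "cbilinear A B V \<psi>"
  shows "cbilinear A B V (\<lambda>a b. \<phi> a b \<oplus> \<psi> a b)"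
  by (intro cbilinearI clinearI)
    (simp_all add: cbilinearD[OF assms(1)] cbilinearD[OF assms(2)] scale_add_right vec_ac)

lemma (in cmodule) cbilinear_scale:
  assumes "cbilinear A B V \<phi>"
  shows "cbilinear A B V (\<lambda>a b. c \<odot> \<phi> a b)"
  by (intro cbilinearI clinearI)
    (simp_all add: cbilinearD[OF assms] scale_add_right scale_scale mult.commute)

lemma (in calgebra) mult_clinear:
  assumes "a \<in> carrier A"
  shows "(\<otimes>) a \<in> clinear A A" "(\<lambda>b. b \<otimes> a) \<in> clinear A A"
  by (simp_all add: clinear_def assms alg_distrib scale_mult_left scale_mult_right)

section \<open>The tensor product of superalgebras\<close>

lemma UNIV_bit: "UNIV = {0, 1 :: bit}"
  using bit_cases by blast

lemma map_scale_sum: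
  "Poly_Mapping.map ((*) c) (\<Sum>x\<in>K. F x) = (\<Sum>x\<in>K. Poly_Mapping.map ((*) c) (F x))"
  for F :: "'i \<Rightarrow> ('x \<Rightarrow>\<^sub>0 complex)"
  by (rule poly_mapping_eqI) (simp add: lookup_sum sum_distrib_left)

lemma map_scale_single:
  "Poly_Mapping.map ((*) c) (Poly_Mapping.single x d) = Poly_Mapping.single x (c * d)"
  for c d :: complex
  by (rule poly_mapping_eqI) (simp add: lookup_single when_def)

lemma (in cmodule) lin_ext_cong:
  "(\<And>x. x \<in> Poly_Mapping.keys f \<Longrightarrow> \<phi> x = \<psi> x) \<Longrightarrow>
    (\<And>x. x \<in> Poly_Mapping.keys f \<Longrightarrow> \<psi> x \<in> carrier V) \<Longrightarrow> lin_ext V \<phi> f = lin_ext V \<psi> f"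
  unfolding lin_ext_def by (rule finsum_cong') auto

text \<open>Translates between two notions of finite sum: \<open>lin_ext\<close> uses the one of the
  module, \<open>tensor_pre_mult\<close> the one of the type. They agree because
  \<open>tensor_pre\<close> adds as the type does.\<close>

lemma lin_ext_tensor_pre:
  fixes f :: "'x \<Rightarrow>\<^sub>0 complex"
  assumes "\<And>x. x \<in> Poly_Mapping.keys f \<Longrightarrow> F x \<in> carrier (tensor_pre A B)"
  shows "lin_ext (tensor_pre A B) F f
    = (\<Sum>x\<in>Poly_Mapping.keys f. Poly_Mapping.map ((*) (Poly_Mapping.lookup f x)) (F x))"
proof -
  interpret P: cmodule "tensor_pre A B" by (rule cmodule_tensor_pre)
  have finsum_eq: "(\<Oplus>\<^bsub>tensor_pre A B\<^esub>x\<in>K. G x) = (\<Sum>x\<in>K. G x)"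
    if "finite K" "\<And>x. x \<in> K \<Longrightarrow> G x \<in> carrier (tensor_pre A B)"
    for K :: "'x set" and G
    using that
  proof (induction K)
    case (insert x K)
    then show ?case by (subst P.finsum_insert) (auto simp: Pi_iff)
  qed simp
  have "Poly_Mapping.lookup f x \<odot>\<^bsub>tensor_pre A B\<^esub> F x \<in> carrier (tensor_pre A B)"
    if "x \<in> Poly_Mapping.keys f" for x
    using P.scale_closed[OF assms[OF that]] .
  from finsum_eq[OF finite_keys this] show ?thesis by (simp add: lin_ext_def)
qed

section \<open>The signed product on representatives and on classes\<close>

locale tensor_superalgebras = A: superalgebra A + B: superalgebra B
  for A :: "('a, 'm) superalg_scheme" and B :: "('b, 'n) superalg_scheme"
begin

sublocale tensor_modules A B
  by (intro tensor_modules.intro A.cmodule_axioms B.cmodule_axioms)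

abbreviation "TP \<equiv> tensor_pre A B"
abbreviation "TT \<equiv> tensor A B"

text \<open>The part of \<open>tensor_pre_mult\<close> that is free of coefficients. The full
  product is its bilinear extension, which brings the rules for \<open>lin_ext\<close> to
  bear.\<close>

definition basis_mult :: "'a \<times> 'b \<Rightarrow> 'a \<times> 'b \<Rightarrow> ('a \<times> 'b) \<Rightarrow>\<^sub>0 complex" where
  "basis_mult x y = (\<Sum>i\<in>UNIV. \<Sum>j\<in>UNIV. Poly_Mapping.single
     (fst x \<otimes>\<^bsub>A\<^esub> graded_part A j (fst y), graded_part B i (snd x) \<otimes>\<^bsub>B\<^esub> snd y) (koszul i j))"

lemma basis_mult_closed:
  "x \<in> carrier A \<times> carrier B \<Longrightarrow> y \<in> carrier A \<times> carrier B \<Longrightarrow> basis_mult x y \<in> carrier TP"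
  unfolding basis_mult_def UNIV_bit
  by (cases x; cases y) (simp add: keys_add_subset)

lemma tensor_pre_mult_eq:
  assumes f: "f \<in> carrier TP" and g: "g \<in> carrier TP"
  shows "tensor_pre_mult A B f g = lin_ext TP (\<lambda>x. lin_ext TP (basis_mult x) g) f"
proof -
  have cl: "basis_mult x y \<in> carrier TP"
    if "x \<in> Poly_Mapping.keys f" "y \<in> Poly_Mapping.keys g" for x y
    using f g that by (intro basis_mult_closed) auto
  have "lin_ext TP (basis_mult x) g \<in> carrier TP" if "x \<in> Poly_Mapping.keys f" for x
    using cl that by (intro T.M.lin_ext_closed) auto
  then show ?thesis
    using cl
    by (simp add: lin_ext_tensor_pre tensor_pre_mult_def map_scale_sum map_scale_single
        basis_mult_def case_prod_beta mult_ac cong: sum.cong del: tensor_pre_simps)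
qed

lemma tensor_pre_mult_closed:
  assumes "f \<in> carrier TP" "g \<in> carrier TP"
  shows "tensor_pre_mult A B f g \<in> carrier TP"
  unfolding tensor_pre_mult_eq[OF assms]
  by (intro T.M.lin_ext_closed basis_mult_closed) (use assms in auto)

lemma lin_ext_basis_mult_closed:
  assumes "g \<in> carrier TP" "x \<in> carrier A \<times> carrier B"
  shows "lin_ext TP (basis_mult x) g \<in> carrier TP"
  by (intro T.M.lin_ext_closed basis_mult_closed) (use assms in auto)

lemma tensor_pre_mult_linear_left:
  assumes "g \<in> carrier TP"
  shows "(\<lambda>f. tensor_pre_mult A B f g) \<in> clinear TP TP"
proof (rule clinearI)
  fix f h c assume f: "f \<in> carrier TP"
  then have cl: "\<And>x. x \<in> Poly_Mapping.keys f \<Longrightarrow> lin_ext TP (basis_mult x) g \<in> carrier TP"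
    using assms by (intro lin_ext_basis_mult_closed) auto
  show "tensor_pre_mult A B f g \<in> carrier TP"
    using f assms by (rule tensor_pre_mult_closed)
  show "tensor_pre_mult A B (c \<odot>\<^bsub>TP\<^esub> f) g = c \<odot>\<^bsub>TP\<^esub> tensor_pre_mult A B f g"
    using f assms cl T.M.scale_closed[OF f, of c]
      T.M.lin_ext_scale[OF cl]
    by (simp add: tensor_pre_mult_eq del: tensor_pre_simps(1))
  assume h: "h \<in> carrier TP"
  then have cl': "\<And>x. x \<in> Poly_Mapping.keys h \<Longrightarrow> lin_ext TP (basis_mult x) g \<in> carrier TP"
    using assms by (intro lin_ext_basis_mult_closed) auto
  show "tensor_pre_mult A B (f \<oplus>\<^bsub>TP\<^esub> h) g
      = tensor_pre_mult A B f g \<oplus>\<^bsub>TP\<^esub> tensor_pre_mult A B h g"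
    using f h assms T.M.lin_ext_add[OF cl cl'] pre_add_closed[OF f h]
    by (simp add: tensor_pre_mult_eq del: tensor_pre_simps(1))
qed

lemma tensor_pre_mult_linear_right:
  assumes f: "f \<in> carrier TP"
  shows "tensor_pre_mult A B f \<in> clinear TP TP"
proof (rule clinearI)
  fix g h c assume g: "g \<in> carrier TP"
  have keys: "x \<in> carrier A \<times> carrier B" if "x \<in> Poly_Mapping.keys f" for x
    using that f by auto
  have cl: "basis_mult x y \<in> carrier TP"
    if "x \<in> Poly_Mapping.keys f" "y \<in> Poly_Mapping.keys g" for x y
    using f g that by (intro basis_mult_closed) auto
  \<comment> \<open>The second argument sits inside the inner extension. With the outer one written
    as a plain sum, linearity can be applied summand by summand.\<close>
  have lin: "tensor_pre_mult A B f k
      = (\<Sum>x\<in>Poly_Mapping.keys f. Poly_Mapping.map ((*) (Poly_Mapping.lookup f x)) (lin_ext TP (basis_mult x) k))"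
    if "k \<in> carrier TP" for k
    using lin_ext_tensor_pre[OF lin_ext_basis_mult_closed[OF that keys], of f]
    by (simp add: tensor_pre_mult_eq[OF f that])
  show "tensor_pre_mult A B f g \<in> carrier TP"
    using f g by (rule tensor_pre_mult_closed)
  have "lin_ext TP (basis_mult x) (c \<odot>\<^bsub>TP\<^esub> g) = Poly_Mapping.map ((*) c) (lin_ext TP (basis_mult x) g)"
    if "x \<in> Poly_Mapping.keys f" for x
    using T.M.lin_ext_scale[OF cl[OF that]] by simp
  then show "tensor_pre_mult A B f (c \<odot>\<^bsub>TP\<^esub> g) = c \<odot>\<^bsub>TP\<^esub> tensor_pre_mult A B f g"
    unfolding lin[OF g] lin[OF T.M.scale_closed[OF g]]
    by (simp add: map_scale_sum map_scale_linear(3)[symmetric] mult.commute del: map_scale_linear)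
  assume h: "h \<in> carrier TP"
  have cl': "basis_mult x y \<in> carrier TP"
    if "x \<in> Poly_Mapping.keys f" "y \<in> Poly_Mapping.keys h" for x y
    using f h that by (intro basis_mult_closed) auto
  have "lin_ext TP (basis_mult x) (g \<oplus>\<^bsub>TP\<^esub> h)
      = lin_ext TP (basis_mult x) g + lin_ext TP (basis_mult x) h"
    if "x \<in> Poly_Mapping.keys f" for x
    using T.M.lin_ext_add[OF cl[OF that] cl'[OF that]] by simp
  then show "tensor_pre_mult A B f (g \<oplus>\<^bsub>TP\<^esub> h)
      = tensor_pre_mult A B f g \<oplus>\<^bsub>TP\<^esub> tensor_pre_mult A B f h"
    unfolding lin[OF g] lin[OF h] lin[OF T.M.add.m_closed[OF g h]]
    by (simp add: map_scale_linear(2) sum.distrib)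
qed

text \<open>The intended value of (a \<otimes> b)(c \<otimes> d), split by the degrees of b and c;
  only the odd-odd summand carries a sign. It is bilinear in (a, b) and in (c, d), so the universal
  property applies to it in either pair.\<close>

definition tens_mult :: "'a \<Rightarrow> 'b \<Rightarrow> 'a \<Rightarrow> 'b \<Rightarrow> (('a \<times> 'b) \<Rightarrow>\<^sub>0 complex) set" where
  "tens_mult a b c d =
     (tens A B (a \<otimes>\<^bsub>A\<^esub> graded_part A 0 c) (graded_part B 0 b \<otimes>\<^bsub>B\<^esub> d) \<oplus>\<^bsub>TT\<^esub>
      tens A B (a \<otimes>\<^bsub>A\<^esub> graded_part A 1 c) (graded_part B 0 b \<otimes>\<^bsub>B\<^esub> d)) \<oplus>\<^bsub>TT\<^esub>
     (tens A B (a \<otimes>\<^bsub>A\<^esub> graded_part A 0 c) (graded_part B 1 b \<otimes>\<^bsub>B\<^esub> d) \<oplus>\<^bsub>TT\<^esub>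
      (- 1) \<odot>\<^bsub>TT\<^esub> tens A B (a \<otimes>\<^bsub>A\<^esub> graded_part A 1 c) (graded_part B 1 b \<otimes>\<^bsub>B\<^esub> d))"

lemma proj_basis_mult:
  assumes "a \<in> carrier A" "b \<in> carrier B" "c \<in> carrier A" "d \<in> carrier B"
  shows "T.proj (basis_mult (a, b) (c, d)) = tens_mult a b c d"
proof -
  let ?s = "\<lambda>i j. Poly_Mapping.single
    (a \<otimes>\<^bsub>A\<^esub> graded_part A j c, graded_part B i b \<otimes>\<^bsub>B\<^esub> d) (koszul i j)"
  have cl: "?s i j \<in> carrier TP" for i j
    using assms by (intro single_in_pre) auto
  have cl2: "?s i j + ?s k l \<in> carrier TP" for i j k l
    using pre_add_closed[OF cl cl] .
  have eq: "basis_mult (a, b) (c, d) = (?s 0 0 + ?s 0 1) + (?s 1 0 + ?s 1 1)"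
    by (simp add: basis_mult_def UNIV_bit add.commute)
  have proj_plus: "T.proj (f + g) = T.proj f \<oplus>\<^bsub>TT\<^esub> T.proj g"
    if "f \<in> carrier TP" "g \<in> carrier TP" for f g
    using T.proj_add[OF that] by simp
  have proj_s: "T.proj (?s i j)
      = koszul i j \<odot>\<^bsub>TT\<^esub> tens A B (a \<otimes>\<^bsub>A\<^esub> graded_part A j c) (graded_part B i b \<otimes>\<^bsub>B\<^esub> d)" for i j
    using assms by (simp add: scale_tens)
  show ?thesis
    unfolding eq tens_mult_def
    using assms by (simp only: proj_plus[OF cl2 cl2] proj_plus[OF cl cl] proj_s) simp
qed

lemma tens_mult_bilinear_left:
  assumes "c \<in> carrier A" "d \<in> carrier B"
  shows "cbilinear A B TT (\<lambda>a b. tens_mult a b c d)"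
proof -
  have "cbilinear A B TT (\<lambda>a b. tens A B (a \<otimes>\<^bsub>A\<^esub> graded_part A j c) (graded_part B i b \<otimes>\<^bsub>B\<^esub> d))"
    for i j
    using assms
    by (intro tens_clinear_bilinear A.cmodule_axioms B.cmodule_axioms A.mult_clinear
        clinear_comp[OF B.mult_clinear(2) B.graded_part_clinear]) auto
  then show ?thesis
    unfolding tens_mult_def by (intro T.Q.cbilinear_add T.Q.cbilinear_scale)
qed

lemma tens_mult_bilinear_right:
  assumes "a \<in> carrier A" "b \<in> carrier B"
  shows "cbilinear A B TT (tens_mult a b)"
proof -
  have "cbilinear A B TT (\<lambda>c d. tens A B (a \<otimes>\<^bsub>A\<^esub> graded_part A j c) (graded_part B i b \<otimes>\<^bsub>B\<^esub> d))"
    for i j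
    using assms
    by (intro tens_clinear_bilinear A.cmodule_axioms B.cmodule_axioms B.mult_clinear
        clinear_comp[OF A.mult_clinear(1) A.graded_part_clinear]) auto
  then show ?thesis
    unfolding tens_mult_def[abs_def] by (intro T.Q.cbilinear_add T.Q.cbilinear_scale)
qed

text \<open>For a fixed pair y on the right, passing to classes turns multiplication by y into the
  linear extension of a bilinear map, which vanishes on \<open>tensor_null\<close>. Linearity in
  \<open>g\<close> does the rest.\<close>

lemma proj_tensor_pre_mult_null_left:
  assumes n: "n \<in> tensor_null A B" and g: "g \<in> carrier TP"
  shows "T.proj (tensor_pre_mult A B n g) = \<zero>\<^bsub>TT\<^esub>"
proof -
  have nP: "n \<in> carrier TP" using T.N_facts(1) n by blast
  have "Poly_Mapping.keys g \<subseteq> carrier A \<times> carrier B" using g by simp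
  then show ?thesis
  proof (induction g rule: poly_mapping_induct_keys)
    case zero
    show ?case
      using T.M.clinear_facts(1)[OF T.M.cmodule_axioms tensor_pre_mult_linear_right[OF nP]]
      by (simp add: T.proj_zero)
  next
    case (single y c)
    then obtain a' b' where y: "y = (a', b')" "a' \<in> carrier A" "b' \<in> carrier B" by auto
    have y1: "Poly_Mapping.single y 1 \<in> carrier TP" using y by simp
    have cl: "basis_mult x y \<in> carrier TP" if "x \<in> Poly_Mapping.keys n" for x
      using nP that y by (intro basis_mult_closed) auto
    have cl': "lin_ext TP (basis_mult x) (Poly_Mapping.single y 1) = basis_mult x y"
      if "x \<in> Poly_Mapping.keys n" for x
      using cl[OF that] by (simp add: map_scale_linear)
    have "T.proj (tensor_pre_mult A B n (Poly_Mapping.single y 1))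
        = T.proj (lin_ext TP (\<lambda>x. basis_mult x y) n)"
      unfolding tensor_pre_mult_eq[OF nP y1]
      by (subst T.M.lin_ext_cong[OF cl' cl]) auto
    also have "\<dots> = lin_ext TT (\<lambda>x. T.proj (basis_mult x y)) n"
      by (rule T.M.lin_ext_clinear[OF T.Q.cmodule_axioms T.proj_clinear cl])
    also have "\<dots> = lin_ext TT (\<lambda>x. tens_mult (fst x) (snd x) a' b') n"
    proof (rule T.Q.lin_ext_cong)
      fix x assume "x \<in> Poly_Mapping.keys n"
      then have x: "fst x \<in> carrier A" "snd x \<in> carrier B" using nP by auto
      show "T.proj (basis_mult x y) = tens_mult (fst x) (snd x) a' b'"
        using proj_basis_mult[OF x y(2,3)] y by simp
      show "tens_mult (fst x) (snd x) a' b' \<in> carrier TT"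
        using cbilinearD(1)[OF tens_mult_bilinear_left[OF y(2,3)] x] .
    qed
    also have "\<dots> = \<zero>\<^bsub>TT\<^esub>"
      by (rule pre_lift_null[OF T.Q.cmodule_axioms tens_mult_bilinear_left[OF y(2,3)] n])
    finally have "T.proj (tensor_pre_mult A B n (c \<odot>\<^bsub>TP\<^esub> Poly_Mapping.single y 1)) = \<zero>\<^bsub>TT\<^esub>"
      using T.proj_scale[OF tensor_pre_mult_closed[OF nP y1], of c]
        clinearD(3)[OF tensor_pre_mult_linear_right[OF nP] y1, of c] by simp
    then show ?case by (simp add: map_scale_single)
  next
    case (add f g)
    then have fg: "f \<in> carrier TP" "g \<in> carrier TP" by simp_all
    show ?case
      using clinearD(2)[OF tensor_pre_mult_linear_right[OF nP] fg] add.IH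
        T.proj_add[OF tensor_pre_mult_closed[OF nP fg(1)] tensor_pre_mult_closed[OF nP fg(2)]]
      by simp
  qed
qed

text \<open>The mirror image, with the roles of the extensions exchanged: for each key x of
  \<open>f\<close> the inner extension already lies in the subspace \<open>tensor_null\<close>, and
  the outer one stays there.\<close>

lemma proj_tensor_pre_mult_null_right:
  assumes n: "n \<in> tensor_null A B" and f: "f \<in> carrier TP"
  shows "T.proj (tensor_pre_mult A B f n) = \<zero>\<^bsub>TT\<^esub>"
proof -
  have nP: "n \<in> carrier TP" using T.N_facts(1) n by blast
  have "T.proj (lin_ext TP (basis_mult x) n) = \<zero>\<^bsub>TT\<^esub>" if x: "x \<in> Poly_Mapping.keys f" for x
  proof -
    obtain a b where ab: "x = (a, b)" "a \<in> carrier A" "b \<in> carrier B" using f x by (cases x) auto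
    have cl: "basis_mult x y \<in> carrier TP" if "y \<in> Poly_Mapping.keys n" for y
      using nP that ab by (intro basis_mult_closed) auto
    have "T.proj (lin_ext TP (basis_mult x) n) = lin_ext TT (\<lambda>y. T.proj (basis_mult x y)) n"
      by (rule T.M.lin_ext_clinear[OF T.Q.cmodule_axioms T.proj_clinear cl])
    also have "\<dots> = lin_ext TT (\<lambda>y. tens_mult a b (fst y) (snd y)) n"
    proof (rule T.Q.lin_ext_cong)
      fix y assume "y \<in> Poly_Mapping.keys n"
      then have y: "fst y \<in> carrier A" "snd y \<in> carrier B" using nP by auto
      show "T.proj (basis_mult x y) = tens_mult a b (fst y) (snd y)"
        using proj_basis_mult[OF ab(2,3) y] ab by simp
      show "tens_mult a b (fst y) (snd y) \<in> carrier TT"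
        using cbilinearD(1)[OF tens_mult_bilinear_right[OF ab(2,3)] y] .
    qed
    also have "\<dots> = \<zero>\<^bsub>TT\<^esub>"
      by (rule pre_lift_null[OF T.Q.cmodule_axioms tens_mult_bilinear_right[OF ab(2,3)] n])
    finally show ?thesis .
  qed
  moreover have cl: "lin_ext TP (basis_mult x) n \<in> carrier TP" if "x \<in> Poly_Mapping.keys f" for x
    using f that nP by (intro lin_ext_basis_mult_closed) auto
  ultimately have "lin_ext TP (basis_mult x) n \<in> tensor_null A B" if "x \<in> Poly_Mapping.keys f" for x
    using that T.proj_eq_zero_iff by blast
  then have "tensor_pre_mult A B f n \<in> tensor_null A B"
    unfolding tensor_pre_mult_eq[OF f nP] by (rule T.M.lin_ext_in_submodule[OF T.N])
  then show ?thesis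
    using T.proj_eq_zero_iff tensor_pre_mult_closed[OF f nP] by blast
qed

text \<open>The representatives are exchanged one at a time. Each exchange alters the product by a
  product with an element of \<open>tensor_null\<close>, which vanishes in the quotient.\<close>

lemma proj_mult:
  assumes f: "f \<in> carrier TP" and g: "g \<in> carrier TP"
  shows "T.proj f \<otimes>\<^bsub>TT\<^esub> T.proj g = T.proj (tensor_pre_mult A B f g)"
proof -
  have indep: "T.proj (tensor_pre_mult A B f' g') = T.proj (tensor_pre_mult A B f g)"
    if "f' \<in> T.proj f" "g' \<in> T.proj g" for f' g'
  proof -
    note F = T.proj_memD[OF that(1) f] and G = T.proj_memD[OF that(2) g]
    have "T.proj (tensor_pre_mult A B f' g') = T.proj (tensor_pre_mult A B f g')"
    proof -
      have "tensor_pre_mult A B f' g' \<ominus>\<^bsub>TP\<^esub> tensor_pre_mult A B f g'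
          = tensor_pre_mult A B (f' \<ominus>\<^bsub>TP\<^esub> f) g'"
        using T.M.clinear_facts(3)[OF T.M.cmodule_axioms
            tensor_pre_mult_linear_left[OF G(1)] F(1) f] by simp
      moreover have "\<dots> \<in> tensor_null A B"
        using proj_tensor_pre_mult_null_left[OF F(2) G(1)] T.proj_eq_zero_iff
          tensor_pre_mult_closed G(1) F(2) T.N_facts(1) by blast
      ultimately show ?thesis
        using T.proj_eq_iff tensor_pre_mult_closed F(1) G(1) f by metis
    qed
    also have "T.proj (tensor_pre_mult A B f g') = T.proj (tensor_pre_mult A B f g)"
    proof -
      have "tensor_pre_mult A B f g' \<ominus>\<^bsub>TP\<^esub> tensor_pre_mult A B f g
          = tensor_pre_mult A B f (g' \<ominus>\<^bsub>TP\<^esub> g)"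
        using T.M.clinear_facts(3)[OF T.M.cmodule_axioms
            tensor_pre_mult_linear_right[OF f] G(1) g] by simp
      moreover have "\<dots> \<in> tensor_null A B"
        using proj_tensor_pre_mult_null_right[OF G(2) f] T.proj_eq_zero_iff
          tensor_pre_mult_closed f G(2) T.N_facts(1) by blast
      ultimately show ?thesis
        using T.proj_eq_iff tensor_pre_mult_closed G(1) g f by metis
    qed
    finally show ?thesis .
  qed
  have "T.proj f \<otimes>\<^bsub>TT\<^esub> T.proj g
      = (\<Union>f'\<in>T.proj f. \<Union>g'\<in>T.proj g. T.proj (tensor_pre_mult A B f' g'))"
    by (simp add: tensor_def)
  also have "\<dots> = (\<Union>f'\<in>T.proj f. \<Union>g'\<in>T.proj g. T.proj (tensor_pre_mult A B f g))"
    using indep by simp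
  also have "\<dots> = T.proj (tensor_pre_mult A B f g)"
    using T.AS.a_rcos_self f g by (auto simp del: tensor_pre_simps)
  finally show ?thesis .
qed

lemma tens_mult_tens:
  assumes "a \<in> carrier A" "b \<in> carrier B" "c \<in> carrier A" "d \<in> carrier B"
  shows "tens A B a b \<otimes>\<^bsub>TT\<^esub> tens A B c d = tens_mult a b c d"
proof -
  have "basis_mult (a, b) (c, d) \<in> carrier TP"
    using assms by (intro basis_mult_closed) auto
  then show ?thesis
    using assms
    by (simp add: tens_eq_proj proj_mult tensor_pre_mult_eq map_scale_linear
        proj_basis_mult[symmetric])
qed

end

section \<open>Ring and grading axioms for the tensor product\<close>

context tensor_superalgebras
begin

text \<open>Of the four summands of \<open>tens_mult\<close> at most one survives when the two inner
  factors are homogeneous. The outer factors may be arbitrary.\<close>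

lemma tens_mult_homogeneous:
  assumes "a \<in> carrier A" "b \<in> grade B i" "c \<in> grade A j" "d \<in> carrier B"
  shows "tens A B a b \<otimes>\<^bsub>TT\<^esub> tens A B c d
    = koszul i j \<odot>\<^bsub>TT\<^esub> tens A B (a \<otimes>\<^bsub>A\<^esub> c) (b \<otimes>\<^bsub>B\<^esub> d)"
proof -
  note cl = assms(1) B.grade_closed[OF assms(2)] A.grade_closed[OF assms(3)] assms(4)
  show ?thesis
    unfolding tens_mult_tens[OF cl] tens_mult_def
    using cl assms
    by (cases i; cases j) (simp_all add: A.graded_part_homogeneous B.graded_part_homogeneous)
qed

lemma mult_closed: "s \<in> carrier TT \<Longrightarrow> t \<in> carrier TT \<Longrightarrow> s \<otimes>\<^bsub>TT\<^esub> t \<in> carrier TT"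
  by (auto elim!: T.carrierE simp: proj_mult tensor_pre_mult_closed simp del: tensor_pre_simps(1))

lemma mult_linear_left:
  assumes "t \<in> carrier TT"
  shows "(\<lambda>s. s \<otimes>\<^bsub>TT\<^esub> t) \<in> clinear TT TT"
proof -
  obtain g where g: "g \<in> carrier TP" "t = T.proj g" using assms by (rule T.carrierE)
  note lin = clinearD[OF tensor_pre_mult_linear_left[OF g(1)]]
  show ?thesis
  proof (rule clinearI)
    fix r s c assume "s \<in> carrier TT"
    then obtain f where f: "f \<in> carrier TP" "s = T.proj f" by (rule T.carrierE)
    show "s \<otimes>\<^bsub>TT\<^esub> t \<in> carrier TT"
      using f g by (simp add: proj_mult tensor_pre_mult_closed del: tensor_pre_simps)
    show "(c \<odot>\<^bsub>TT\<^esub> s) \<otimes>\<^bsub>TT\<^esub> t = c \<odot>\<^bsub>TT\<^esub> (s \<otimes>\<^bsub>TT\<^esub> t)"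
      using f g
      by (simp add: proj_mult T.proj_scale lin tensor_pre_mult_closed del: tensor_pre_simps)
    assume "r \<in> carrier TT"
    then obtain h where h: "h \<in> carrier TP" "r = T.proj h" by (rule T.carrierE)
    show "(s \<oplus>\<^bsub>TT\<^esub> r) \<otimes>\<^bsub>TT\<^esub> t = s \<otimes>\<^bsub>TT\<^esub> t \<oplus>\<^bsub>TT\<^esub> r \<otimes>\<^bsub>TT\<^esub> t"
      using f g h
      by (simp add: proj_mult T.proj_add lin tensor_pre_mult_closed del: tensor_pre_simps)
  qed
qed

lemma mult_linear_right:
  assumes "t \<in> carrier TT"
  shows "(\<otimes>\<^bsub>TT\<^esub>) t \<in> clinear TT TT"
proof -
  obtain g where g: "g \<in> carrier TP" "t = T.proj g" using assms by (rule T.carrierE)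
  note lin = clinearD[OF tensor_pre_mult_linear_right[OF g(1)]]
  show ?thesis
  proof (rule clinearI)
    fix r s c assume "s \<in> carrier TT"
    then obtain f where f: "f \<in> carrier TP" "s = T.proj f" by (rule T.carrierE)
    show "t \<otimes>\<^bsub>TT\<^esub> s \<in> carrier TT"
      using f g by (simp add: proj_mult tensor_pre_mult_closed del: tensor_pre_simps)
    show "t \<otimes>\<^bsub>TT\<^esub> (c \<odot>\<^bsub>TT\<^esub> s) = c \<odot>\<^bsub>TT\<^esub> (t \<otimes>\<^bsub>TT\<^esub> s)"
      using f g
      by (simp add: proj_mult T.proj_scale lin tensor_pre_mult_closed del: tensor_pre_simps)
    assume "r \<in> carrier TT"
    then obtain h where h: "h \<in> carrier TP" "r = T.proj h" by (rule T.carrierE)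
    show "t \<otimes>\<^bsub>TT\<^esub> (s \<oplus>\<^bsub>TT\<^esub> r) = t \<otimes>\<^bsub>TT\<^esub> s \<oplus>\<^bsub>TT\<^esub> t \<otimes>\<^bsub>TT\<^esub> r"
      using f g h
      by (simp add: proj_mult T.proj_add lin tensor_pre_mult_closed del: tensor_pre_simps)
  qed
qed

lemmas mult_add_left = clinearD(2)[OF mult_linear_left]
  and mult_scale_left = clinearD(3)[OF mult_linear_left]
  and mult_add_right = clinearD(2)[OF mult_linear_right]
  and mult_scale_right = clinearD(3)[OF mult_linear_right]

text \<open>Both factors of a pure tensor are expanded into graded parts, so that the sign rule
  becomes applicable in every case of an induction.\<close>

lemma tensor_homogeneous_induct [consumes 1, case_names tens add]:
  assumes "t \<in> carrier TT"
    and tens: "\<And>a b i j. a \<in> grade A i \<Longrightarrow> b \<in> grade B j \<Longrightarrow> P (tens A B a b)"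
    and add: "\<And>s t. s \<in> carrier TT \<Longrightarrow> t \<in> carrier TT \<Longrightarrow> P s \<Longrightarrow> P t \<Longrightarrow> P (s \<oplus>\<^bsub>TT\<^esub> t)"
  shows "P t"
  using assms(1)
proof (induction t rule: tensor_induct)
  case (tens a b)
  let ?a = "\<lambda>i. graded_part A i a" and ?b = "\<lambda>i. graded_part B i b"
  have cl: "tens A B (?a i) (?b j) \<in> carrier TT" for i j
    using tens by simp
  have P: "P (tens A B (?a i) (?b j))" for i j
    using assms(2) A.graded_part_grade[OF tens(1)] B.graded_part_grade[OF tens(2)] by blast
  have "tens A B a b = tens A B (?a 0 \<oplus>\<^bsub>A\<^esub> ?a 1) (?b 0 \<oplus>\<^bsub>B\<^esub> ?b 1)"
    using tens by (simp add: A.graded_part_decomp B.graded_part_decomp)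
  also have "\<dots> = (tens A B (?a 0) (?b 0) \<oplus>\<^bsub>TT\<^esub> tens A B (?a 0) (?b 1)) \<oplus>\<^bsub>TT\<^esub>
      (tens A B (?a 1) (?b 0) \<oplus>\<^bsub>TT\<^esub> tens A B (?a 1) (?b 1))"
    using tens by (simp add: tens_add_left tens_add_right T.Q.vec_ac)
  finally show ?case
    using add cl P by simp
qed (rule add)

text \<open>Both bracketings of (a \<otimes> b)(c \<otimes> d)(e \<otimes> f) collect the signs of
  the same three crossings: b past c, b past e, and d past e.\<close>

lemma mult_assoc:
  assumes "s \<in> carrier TT" "t \<in> carrier TT" "u \<in> carrier TT"
  shows "(s \<otimes>\<^bsub>TT\<^esub> t) \<otimes>\<^bsub>TT\<^esub> u = s \<otimes>\<^bsub>TT\<^esub> (t \<otimes>\<^bsub>TT\<^esub> u)"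
  using assms(1)
proof (induction s rule: tensor_homogeneous_induct)
  case (tens a b i j)
  note ab = tens
  show ?case using assms(2)
  proof (induction t rule: tensor_homogeneous_induct)
    case (tens c d k l)
    note cd = tens
    show ?case using assms(3)
    proof (induction u rule: tensor_homogeneous_induct)
      case (tens e f m n)
      have cl: "a \<in> carrier A" "c \<in> carrier A" "e \<in> carrier A"
          "b \<in> carrier B" "d \<in> carrier B" "f \<in> carrier B"
        using ab cd tens A.grade_closed B.grade_closed by blast+
      show ?case
        using cl ab cd tens A.grade_mult[OF cd(1) tens(1)] B.grade_mult[OF ab(2) cd(2)]
        by (simp add: tens_mult_homogeneous[where j = k] tens_mult_homogeneous[where j = m]
            tens_mult_homogeneous[where j = "k + m"] mult_scale_left mult_scale_right T.Q.scale_scale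
            koszul_add A.alg_assoc B.alg_assoc mult_ac)
    next
      case (add u v)
      have "tens A B a b \<in> carrier TT" "tens A B c d \<in> carrier TT"
        using ab cd A.grade_closed B.grade_closed by auto
      then show ?case using add by (simp add: mult_add_right mult_closed)
    qed
  next
    case (add t v)
    have "tens A B a b \<in> carrier TT" using ab A.grade_closed B.grade_closed by auto
    then show ?case using add assms(3) by (simp add: mult_add_left mult_add_right mult_closed)
  qed
next
  case (add s v)
  then show ?case using assms(2,3) by (simp add: mult_add_left mult_closed)
qed

lemma tensor_one: "\<one>\<^bsub>TT\<^esub> = tens A B \<one>\<^bsub>A\<^esub> \<one>\<^bsub>B\<^esub>"
  by (simp add: tensor_def)

lemma one_closed': "\<one>\<^bsub>A\<^esub> \<in> carrier A" "\<one>\<^bsub>B\<^esub> \<in> carrier B"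
  using A.grade_one B.grade_one A.grade_closed B.grade_closed by auto

lemma mult_one:
  assumes "t \<in> carrier TT"
  shows "\<one>\<^bsub>TT\<^esub> \<otimes>\<^bsub>TT\<^esub> t = t" "t \<otimes>\<^bsub>TT\<^esub> \<one>\<^bsub>TT\<^esub> = t"
proof -
  have cl: "tens A B \<one>\<^bsub>A\<^esub> \<one>\<^bsub>B\<^esub> \<in> carrier TT" using one_closed' by simp
  show "\<one>\<^bsub>TT\<^esub> \<otimes>\<^bsub>TT\<^esub> t = t"
    using assms
  proof (induction t rule: tensor_homogeneous_induct)
    case (tens a b i j)
    then show ?case
      using one_closed' A.grade_closed B.grade_closed
      by (simp add: tensor_one tens_mult_homogeneous[OF _ B.grade_one])
  qed (simp add: tensor_one mult_add_right cl)
  show "t \<otimes>\<^bsub>TT\<^esub> \<one>\<^bsub>TT\<^esub> = t"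
    using assms
  proof (induction t rule: tensor_homogeneous_induct)
    case (tens a b i j)
    then show ?case
      using one_closed' A.grade_closed B.grade_closed
      by (simp add: tensor_one tens_mult_homogeneous[OF _ _ A.grade_one])
  qed (simp add: tensor_one mult_add_left cl)
qed

lemma calgebra_tensor: "calgebra TT"
proof (intro calgebra.intro calgebra_axioms.intro T.Q.cmodule_axioms ringI)
  show "abelian_group TT" by (rule T.Q.M.abelian_group_axioms)
  show "Group.monoid TT"
    by (rule monoidI) (use mult_closed mult_assoc mult_one one_closed' in \<open>auto simp: tensor_one\<close>)
qed (simp_all add: mult_add_left mult_add_right mult_scale_left mult_scale_right)

abbreviation homogeneous_keys where
  "homogeneous_keys k \<equiv> {f. Poly_Mapping.keys f \<subseteq> (\<Union>i. grade A i \<times> grade B (k - i))}"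

lemma tensor_grade: "grade TT k = T.proj ` homogeneous_keys k"
  by (simp add: tensor_def)

lemma homogeneous_keys_closed: "f \<in> homogeneous_keys k \<Longrightarrow> f \<in> carrier TP"
  using A.grade_closed B.grade_closed by fastforce

lemma submodule_tensor_grade: "submodule (grade TT k) complex_alg TT"
proof (rule T.Q.csubmoduleI)
  show "grade TT k \<subseteq> carrier TT"
    using homogeneous_keys_closed T.proj_closed by (auto simp: tensor_grade simp del: tensor_pre_simps)
  have "(0 :: ('a \<times> 'b) \<Rightarrow>\<^sub>0 complex) \<in> homogeneous_keys k" by simp
  then show "\<zero>\<^bsub>TT\<^esub> \<in> grade TT k"
    using T.proj_zero by (auto simp: tensor_grade)
  fix s t c assume "s \<in> grade TT k"
  then obtain f where f: "f \<in> homogeneous_keys k" "s = T.proj f" by (auto simp: tensor_grade)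
  then have "Poly_Mapping.map ((*) c) f \<in> homogeneous_keys k"
    using keys_scale_subset by simp
  then show "c \<odot>\<^bsub>TT\<^esub> s \<in> grade TT k"
    using f T.proj_scale[OF homogeneous_keys_closed[OF f(1)]] by (auto simp: tensor_grade)
  assume "t \<in> grade TT k"
  then obtain g where g: "g \<in> homogeneous_keys k" "t = T.proj g" by (auto simp: tensor_grade)
  with f have "f + g \<in> homogeneous_keys k"
    using keys_add_subset by simp
  then show "s \<oplus>\<^bsub>TT\<^esub> t \<in> grade TT k"
    using f g T.proj_add[OF homogeneous_keys_closed[OF f(1)] homogeneous_keys_closed[OF g(1)]]
    by (auto simp: tensor_grade)
qed

lemmas tensor_grade_facts = T.Q.submodule_facts[OF submodule_tensor_grade]

lemma tens_grade:
  assumes "a \<in> grade A i" "b \<in> grade B j"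
  shows "tens A B a b \<in> grade TT (i + j)"
proof -
  have bit_eq: "(i + j) - i = j" by (cases i; cases j; simp)
  have "(a, b) \<in> (\<Union>i'. grade A i' \<times> grade B (i + j - i'))"
    by (intro UN_I[of i] SigmaI) (simp_all only: bit_eq UNIV_I assms)
  then have "Poly_Mapping.single (a, b) 1 \<in> homogeneous_keys (i + j)"
    by simp
  then show ?thesis unfolding tensor_grade tens_eq_proj by blast
qed

lemma tensor_grade_induct [consumes 1, case_names tens add]:
  assumes "t \<in> grade TT k"
    and tens: "\<And>a b i j. a \<in> grade A i \<Longrightarrow> b \<in> grade B j \<Longrightarrow> i + j = k \<Longrightarrow> P (tens A B a b)"
    and add: "\<And>s t. s \<in> grade TT k \<Longrightarrow> t \<in> grade TT k \<Longrightarrow> P s \<Longrightarrow> P t \<Longrightarrow> P (s \<oplus>\<^bsub>TT\<^esub> t)"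
  shows "P t"
proof -
  obtain f where f: "f \<in> homogeneous_keys k" and t: "t = T.proj f"
    using assms(1) by (auto simp: tensor_grade)
  have "Poly_Mapping.keys f \<subseteq> (\<Union>i. grade A i \<times> grade B (k - i))" using f by simp
  then have "P (T.proj f)"
  proof (induction f rule: poly_mapping_induct_keys)
    case zero
    have "T.proj 0 = tens A B \<zero>\<^bsub>A\<^esub> \<zero>\<^bsub>B\<^esub>"
      using T.proj_zero by simp
    then show ?case using tens[OF A.grade_zero B.grade_zero, of 0 k] by simp
  next
    case (single x c)
    then obtain a b i where x: "x = (a, b)" "a \<in> grade A i" "b \<in> grade B (k - i)" by auto
    then have "T.proj (Poly_Mapping.single x c) = tens A B (c \<odot>\<^bsub>A\<^esub> a) b"
      using A.grade_closed B.grade_closed by (simp add: scale_tens tens_scale_left)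
    moreover have "i + (k - i) = k" by (cases i; cases k; simp)
    ultimately show ?case using tens[OF A.grade_scale[OF x(2)] x(3)] by simp
  next
    case (add f g)
    then have fg: "f \<in> homogeneous_keys k" "g \<in> homogeneous_keys k" by simp_all
    then have "T.proj f \<in> grade TT k" "T.proj g \<in> grade TT k"
      unfolding tensor_grade by blast+
    then show ?case
      using assms(3) add.IH T.proj_add[OF fg[THEN homogeneous_keys_closed]] by fastforce
  qed
  then show ?thesis using t by simp
qed

lemma tensor_grade_mult:
  assumes "s \<in> grade TT k" "t \<in> grade TT l"
  shows "s \<otimes>\<^bsub>TT\<^esub> t \<in> grade TT (k + l)"
  using assms(1)
proof (induction s rule: tensor_grade_induct)
  case (tens a b i j)
  note ab = tens
  show ?case using assms(2)
  proof (induction t rule: tensor_grade_induct)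
    case (tens c d m n)
    have "tens A B (a \<otimes>\<^bsub>A\<^esub> c) (b \<otimes>\<^bsub>B\<^esub> d) \<in> grade TT ((i + m) + (j + n))"
      using ab tens by (intro tens_grade A.grade_mult B.grade_mult)
    moreover have "(i + m) + (j + n) = k + l"
      unfolding ab(3)[symmetric] tens(3)[symmetric] by (simp only: ac_simps)
    ultimately show ?case
      using ab tens A.grade_closed B.grade_closed tensor_grade_facts(5)
      by (simp add: tens_mult_homogeneous)
  next
    case (add t u)
    have "tens A B a b \<in> carrier TT" using ab A.grade_closed B.grade_closed by auto
    then show ?case
      using add tensor_grade_facts(1)[THEN subsetD] tensor_grade_facts(3)
      by (simp add: mult_add_right)
  qed
next
  case (add s u)
  then show ?case
    using assms(2) tensor_grade_facts(1)[THEN subsetD] tensor_grade_facts(3)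
    by (simp add: mult_add_left)
qed

lemma tensor_decomp:
  assumes "t \<in> carrier TT"
  shows "\<exists>u\<in>grade TT 0. \<exists>v\<in>grade TT 1. t = u \<oplus>\<^bsub>TT\<^esub> v"
  using assms
proof (induction t rule: tensor_homogeneous_induct)
  case (tens a b i j)
  then have *: "tens A B a b \<in> grade TT (i + j)" by (rule tens_grade)
  then have cl: "tens A B a b \<in> carrier TT" using tensor_grade_facts(1) by blast
  show ?case
  proof (cases "i + j")
    case zero
    then show ?thesis
      using * cl tensor_grade_facts(2) T.Q.M.r_zero[OF cl] by metis
  next
    case one
    then show ?thesis
      using * cl tensor_grade_facts(2) T.Q.M.l_zero[OF cl] by metis
  qed
next
  case (add s t)
  then obtain u v u' v' where *: "u \<in> grade TT 0" "u' \<in> grade TT 0" "v \<in> grade TT 1" "v' \<in> grade TT 1"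
    "s = u \<oplus>\<^bsub>TT\<^esub> v" "t = u' \<oplus>\<^bsub>TT\<^esub> v'" by blast
  then have "s \<oplus>\<^bsub>TT\<^esub> t = (u \<oplus>\<^bsub>TT\<^esub> u') \<oplus>\<^bsub>TT\<^esub> (v \<oplus>\<^bsub>TT\<^esub> v')"
    using tensor_grade_facts(1)[THEN subsetD] by (simp add: T.Q.vec_ac)
  then show ?case using * tensor_grade_facts(3) by blast
qed

theorem superalgebra_tensor: "superalgebra TT"
proof (rule superalgebraI)
  \<comment> \<open>The product of the two grading involutions acts on a \<otimes> b by the product
    of the signs of a and b, which is the sign of the total degree.\<close>
  let ?\<sigma> = "tensor_map A B A.parity B.parity"
  note \<sigma> = tensor_map_facts[OF A.cmodule_axioms B.cmodule_axioms A.cmodule_axioms B.cmodule_axioms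
      A.parity_clinear B.parity_clinear]
  show "calgebra TT" by (rule calgebra_tensor)
  show "\<one>\<^bsub>TT\<^esub> \<in> grade TT 0"
    using tens_grade[OF A.grade_one B.grade_one] by (simp add: tensor_one)
  show "?\<sigma> \<in> clinear TT TT" by (rule \<sigma>)
  show "?\<sigma> t = koszul k 1 \<odot>\<^bsub>TT\<^esub> t" if "t \<in> grade TT k" for k t
    using that
  proof (induction t rule: tensor_grade_induct)
    case (tens a b i j)
    then have cl: "a \<in> carrier A" "b \<in> carrier B" using A.grade_closed B.grade_closed by auto
    have "koszul k 1 = koszul i 1 * koszul j 1"
      using tens koszul_add(1)[of i j 1] by simp
    then show ?case
      using cl tens
      by (simp add: \<sigma>(2) A.parity_homogeneous B.parity_homogeneous tens_scale_left tens_scale_right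
          T.Q.scale_scale mult_ac)
  next
    case (add s t)
    then show ?case
      using tensor_grade_facts(1)[THEN subsetD] by (simp add: clinearD[OF \<sigma>(1)] T.Q.scale_add_right)
  qed
qed (rule submodule_tensor_grade tensor_grade_mult tensor_decomp; assumption?)+

end

lemma superalgebra_complex_alg: "superalgebra complex_alg"
proof (rule superalgebraI)
  interpret C: cmodule complex_alg by (rule cmodule_complex_alg)
  show "calgebra complex_alg"
    using cring_complex_alg
    by (intro calgebra.intro calgebra_axioms.intro cmodule_complex_alg) (auto simp: cring_def)
  show "submodule (grade complex_alg i) complex_alg complex_alg" for i
    by (rule C.csubmoduleI) auto
  show "(\<lambda>z. z) \<in> clinear complex_alg complex_alg"
    by (simp add: clinear_def)
  show "z = koszul i 1 \<odot>\<^bsub>complex_alg\<^esub> z" if "z \<in> grade complex_alg i" for i z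
    using that by (cases i) simp_all
  show "a \<otimes>\<^bsub>complex_alg\<^esub> b \<in> grade complex_alg (i + j)"
    if "a \<in> grade complex_alg i" "b \<in> grade complex_alg j" for i j a b
    using that by (cases i; cases j) auto
qed auto

section \<open>Universal property of the quantum superspace\<close>

context calgebra
begin

lemma cbilinear_mult: "cbilinear A A A (\<otimes>)"
  by (intro cbilinearI mult_clinear)

definition word_eval :: "('g \<Rightarrow> 'a) \<Rightarrow> 'g list \<Rightarrow> 'a" where
  "word_eval g w = foldr (\<lambda>x y. g x \<otimes> y) w \<one>"

lemma word_eval_simps [simp]: "word_eval g [] = \<one>" "word_eval g (x # w) = g x \<otimes> word_eval g w"
  by (simp_all add: word_eval_def)

context
  fixes g :: "'g \<Rightarrow> 'a"
  assumes g_closed: "\<And>x. g x \<in> carrier A"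
begin

lemma word_eval_closed [simp]: "word_eval g w \<in> carrier A"
  by (induction w) (simp_all add: g_closed)

lemma word_eval_append: "word_eval g (u @ v) = word_eval g u \<otimes> word_eval g v"
  by (induction u) (simp_all add: g_closed alg_assoc)

lemma free_eval_closed [simp]: "lin_ext A (word_eval g) f \<in> carrier A"
  by (rule lin_ext_closed) simp

lemma free_eval_single: "lin_ext A (word_eval g) (Poly_Mapping.single w c) = c \<odot> word_eval g w"
  by simp

lemma free_eval_add: "lin_ext A (word_eval g) (f + h) = lin_ext A (word_eval g) f \<oplus> lin_ext A (word_eval g) h"
  by (rule lin_ext_add) simp_all

lemma free_eval_diff: "lin_ext A (word_eval g) (f - h) = lin_ext A (word_eval g) f \<ominus> lin_ext A (word_eval g) h"
  by (rule lin_ext_diff) simp_all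

lemma free_eval_scale:
  "lin_ext A (word_eval g) (Poly_Mapping.map ((*) c) f) = c \<odot> lin_ext A (word_eval g) f"
  by (rule lin_ext_scale) simp

lemma free_eval_one: "lin_ext A (word_eval g) 1 = \<one>"
  using free_eval_single[of "[]" 1] by (simp add: single_one[symmetric] zero_list_def del: single_one)

text \<open>By bilinearity only monomials matter. Their product concatenates the words, since
  concatenation is the addition of the \<open>monoid_add\<close> instance of lists.\<close>

lemma free_eval_mult:
  "lin_ext A (word_eval g) (f * h) = lin_ext A (word_eval g) f \<otimes> lin_ext A (word_eval g) h"
proof (induction f rule: poly_mapping_induct_keys[OF subset_UNIV])
  case (2 u c)
  show ?case
  proof (induction h rule: poly_mapping_induct_keys[OF subset_UNIV])
    case (2 v d)
    show ?case
      by (simp add: mult_single plus_list_def word_eval_append scale_mult_left scale_mult_right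
          scale_scale mult.commute)
  next
    case (3 f h)
    then show ?case by (simp add: distrib_left free_eval_add alg_distrib)
  qed simp
next
  case (3 f h')
  then show ?case by (simp add: distrib_right free_eval_add alg_distrib)
qed simp

end

end

lemma (in superalgebra) word_eval_grade:
  assumes "\<And>x. g x \<in> grade A (p x)"
  shows "word_eval g w \<in> grade A (sum_list (map p w))"
  by (induction w) (auto intro: grade_mult grade_one assms)

section \<open>The free algebra and its evaluation at elements satisfying the relations\<close>

lemma free_alg_simps [simp]:
  "carrier free_alg = UNIV" "mult free_alg = (*)" "one free_alg = 1" "zero free_alg = 0"
  "add free_alg = (+)" "smult free_alg = (\<lambda>c. Poly_Mapping.map ((*) c))"
  "grade free_alg i = {f. \<forall>w\<in>Poly_Mapping.keys f. sum_list (map gen_parity w) = i}"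
  by (simp_all add: free_alg_def)

lemma cmodule_free_alg: "cmodule free_alg"
proof (rule cmoduleI)
  show "abelian_group free_alg" by (rule abelian_group_typeI) auto
qed (simp_all add: map_scale_linear)

lemma ring_free_alg: "ring free_alg"
  by (rule ringI)
    (auto simp: algebra_simps cmodule.axioms[OF cmodule_free_alg, unfolded module_def]
      intro!: monoidI)

text \<open>Scaling becomes multiplication by a constant polynomial, so that an ideal of the ring
  \<open>free_alg\<close> is also a subspace.\<close>

lemma map_scale_conv_mult:
  "Poly_Mapping.map ((*) c) f = Poly_Mapping.single [] c * f" for f :: "gen list \<Rightarrow>\<^sub>0 complex"
  by (simp add: mult_map_scale_conv_mult zero_list_def)

lemma map_scale_mult:
  fixes f g :: "gen list \<Rightarrow>\<^sub>0 complex"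
  shows "Poly_Mapping.map ((*) c) f * g = Poly_Mapping.map ((*) c) (f * g)"
    "f * Poly_Mapping.map ((*) c) g = Poly_Mapping.map ((*) c) (f * g)"
proof -
  show 1: "Poly_Mapping.map ((*) c) f * g = Poly_Mapping.map ((*) c) (f * g)" for f g :: "gen list \<Rightarrow>\<^sub>0 complex"
    by (simp add: map_scale_conv_mult mult.assoc)
  \<comment> \<open>Constants are central, because the empty word is neutral for concatenation on
    both sides.\<close>
  have "f * Poly_Mapping.single [] c = Poly_Mapping.single [] c * f"
    by (induction f rule: poly_mapping_induct_keys[OF subset_UNIV])
      (simp_all add: mult_single plus_list_def algebra_simps)
  then show "f * Poly_Mapping.map ((*) c) g = Poly_Mapping.map ((*) c) (f * g)"
    by (metis 1 map_scale_conv_mult mult.assoc)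
qed

text \<open>The data of a homomorphism out of F. Parities of the images are not demanded here; they
  enter only in \<open>hom_from_grade\<close>.\<close>

locale superspace_relations = calgebra A for q :: complex and A (structure) +
  fixes g :: "gen \<Rightarrow> 'a"
  assumes gen_closed: "g x \<in> carrier A"
    and gen_inverse: "g (X i) \<otimes> g (Xinv i) = \<one>" "g (Xinv i) \<otimes> g (X i) = \<one>"
    and gen_commute: "g (X I1) \<otimes> g (X I2) = g (X I2) \<otimes> g (X I1)"
    and gen_q_commute: "g (X i) \<otimes> g Theta = q \<odot> (g Theta \<otimes> g (X i))"
    and gen_nilpotent: "g Theta \<otimes> g Theta = \<zero>"
begin

abbreviation "eval \<equiv> lin_ext A (word_eval g)"

lemmas eval_simps = free_eval_single[OF gen_closed] free_eval_add[OF gen_closed]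
  free_eval_diff[OF gen_closed] free_eval_scale[OF gen_closed] free_eval_one[OF gen_closed]
  free_eval_mult[OF gen_closed]

lemma eval_closed [simp]: "eval f \<in> carrier A"
  by (rule free_eval_closed[OF gen_closed])

lemma eval_gen: "eval (gen_poly x) = g x"
  by (simp add: gen_poly_def gen_closed)

lemma eval_relators: "r \<in> superspace_relators q \<Longrightarrow> eval r = \<zero>"
  by (auto simp: superspace_relators_def eval_simps eval_gen gen_inverse gen_commute gen_q_commute
      gen_nilpotent gen_closed a_minus_def M.r_neg scale_mult_left)

text \<open>The kernel of the evaluation is an ideal containing the relators, and the ideal divided
  out is the least such.\<close>

lemma eval_ideal:
  assumes "r \<in> superspace_ideal q"
  shows "eval r = \<zero>"
proof -
  interpret P: ring free_alg by (rule ring_free_alg)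
  have "ideal {f. eval f = \<zero>} free_alg"
  proof (rule idealI)
    show "subgroup {f. eval f = \<zero>} (add_monoid free_alg)"
      by (rule P.add.subgroupI)
        (auto intro: exI[of _ 0] simp: eval_simps a_inv_def[symmetric] a_inv_typeI[OF P.abelian_group_axioms]
          map_scale_linear(5)[symmetric] simp del: map_scale_linear)
  qed (auto simp: eval_simps ring_free_alg)
  moreover have "superspace_relators q \<subseteq> {f. eval f = \<zero>}"
    using eval_relators by blast
  ultimately show ?thesis
    using assms unfolding superspace_ideal_def genideal_def by blast
qed

end

lemma ideal_superspace: "ideal (superspace_ideal q) free_alg"
  unfolding superspace_ideal_def by (rule ring.genideal_ideal[OF ring_free_alg]) simp

lemma submodule_superspace_ideal: "submodule (superspace_ideal q) complex_alg free_alg"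
proof -
  interpret P: cmodule free_alg by (rule cmodule_free_alg)
  interpret I: ideal "superspace_ideal q" free_alg by (rule ideal_superspace)
  show ?thesis
    by (rule P.csubmoduleI)
      (use I.a_subset I.zero_closed I.a_closed I.I_l_closed in \<open>auto simp: map_scale_conv_mult\<close>)
qed

section \<open>The quotient algebra, its universal property and its grading\<close>

locale superspace =
  fixes q :: complex
begin

abbreviation "F \<equiv> superspace q"
abbreviation "x i \<equiv> superspace_gen q (X i)"
abbreviation "xinv i \<equiv> superspace_gen q (Xinv i)"
abbreviation "\<theta> \<equiv> superspace_gen q Theta"

sublocale Q: quotient_cmodule free_alg "superspace_ideal q" F
  by (intro quotient_cmodule.intro quotient_cmodule_axioms.intro cmodule_free_alg
      submodule_superspace_ideal)
    (simp_all add: superspace_def quot_superalg_def FactRing_def)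

lemma proj_mult: "Q.proj f \<otimes>\<^bsub>F\<^esub> Q.proj h = Q.proj (f * h)"
  using ideal.rcoset_mult_add[OF ideal_superspace, of f h]
  by (simp add: superspace_def quot_superalg_def FactRing_def)

lemma one_eq: "\<one>\<^bsub>F\<^esub> = Q.proj 1"
  by (simp add: superspace_def quot_superalg_def FactRing_def)

lemma gen_eq: "superspace_gen q y = Q.proj (gen_poly y)"
  by (simp add: superspace_gen_def)

lemma calgebra_superspace: "calgebra F"
proof (intro calgebra.intro calgebra_axioms.intro Q.Q.cmodule_axioms ringI)
  show "abelian_group F" by (rule Q.Q.M.abelian_group_axioms)
  show "Group.monoid F"
    by (rule monoidI) (auto elim!: Q.carrierE simp: proj_mult one_eq mult.assoc)
qed (auto elim!: Q.carrierE simp: proj_mult Q.proj_add Q.proj_scale algebra_simps map_scale_mult)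

sublocale calgebra F by (rule calgebra_superspace)

lemma superspace_induct [consumes 1, case_names word scale add]:
  assumes "a \<in> carrier F"
    and word: "\<And>w. P (Q.proj (Poly_Mapping.single w 1))"
    and scale: "\<And>a c. a \<in> carrier F \<Longrightarrow> P a \<Longrightarrow> P (c \<odot>\<^bsub>F\<^esub> a)"
    and add: "\<And>a b. a \<in> carrier F \<Longrightarrow> b \<in> carrier F \<Longrightarrow> P a \<Longrightarrow> P b \<Longrightarrow> P (a \<oplus>\<^bsub>F\<^esub> b)"
  shows "P a"
proof -
  have single: "P (Q.proj (Poly_Mapping.single w c))" for w c
    using scale[OF Q.proj_closed word, of w c] Q.proj_scale[of "Poly_Mapping.single w 1" c]
    by (simp add: map_scale_single)
  obtain f where "a = Q.proj f" using assms(1) by (rule Q.carrierE)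
  moreover have "P (Q.proj f)"
  proof (induction f rule: poly_mapping_induct_keys[OF subset_UNIV])
    case 1
    show ?case using single[of "[]" 0] by simp
  next
    case (3 f h)
    then show ?case using add[of "Q.proj f" "Q.proj h"] Q.proj_add[of f h] by simp
  qed (rule single)
  ultimately show ?thesis by simp
qed

lemma word_Nil: "Q.proj (Poly_Mapping.single [] 1) = \<one>\<^bsub>F\<^esub>"
  by (simp add: one_eq single_one[symmetric] zero_list_def del: single_one)

lemma word_Cons:
  "Q.proj (Poly_Mapping.single (y # w) 1) = superspace_gen q y \<otimes>\<^bsub>F\<^esub> Q.proj (Poly_Mapping.single w 1)"
  by (simp add: gen_eq gen_poly_def proj_mult mult_single plus_list_def)

lemma gen_closed [simp]: "superspace_gen q y \<in> carrier F"
  by (simp add: gen_eq)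

lemma relation: "r \<in> superspace_relators q \<Longrightarrow> Q.proj r = \<zero>\<^bsub>F\<^esub>"
  using ring.genideal_self[OF ring_free_alg, of "superspace_relators q"] Q.proj_eq_zero_iff[of r]
  unfolding superspace_ideal_def by auto

lemma proj_eqI: "f - h \<in> superspace_relators q \<Longrightarrow> Q.proj f = Q.proj h"
  using Q.proj_add[of "f - h" h] relation[of "f - h"] by simp

text \<open>The tautological instance; it makes the defining relations available as equations
  between elements of F.\<close>

lemma relations_self: "superspace_relations q F (superspace_gen q)"
proof (intro superspace_relations.intro superspace_relations_axioms.intro calgebra_superspace)
  fix i
  show "x i \<otimes>\<^bsub>F\<^esub> xinv i = \<one>\<^bsub>F\<^esub>" "xinv i \<otimes>\<^bsub>F\<^esub> x i = \<one>\<^bsub>F\<^esub>" "x I1 \<otimes>\<^bsub>F\<^esub> x I2 = x I2 \<otimes>\<^bsub>F\<^esub> x I1"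
    unfolding gen_eq proj_mult one_eq
    by (rule proj_eqI; auto simp: superspace_relators_def)+
  have "Q.proj (gen_poly (X i) * gen_poly Theta)
      = Q.proj (Poly_Mapping.single [] q * (gen_poly Theta * gen_poly (X i)))"
    by (rule proj_eqI) (auto simp: superspace_relators_def)
  then show "x i \<otimes>\<^bsub>F\<^esub> \<theta> = q \<odot>\<^bsub>F\<^esub> (\<theta> \<otimes>\<^bsub>F\<^esub> x i)"
    by (simp add: gen_eq proj_mult Q.proj_scale map_scale_conv_mult)
  show "\<theta> \<otimes>\<^bsub>F\<^esub> \<theta> = \<zero>\<^bsub>F\<^esub>"
    using relation[of "gen_poly Theta * gen_poly Theta"]
    by (simp add: gen_eq proj_mult superspace_relators_def)
qed simp

definition hom_from :: "('b, 'm) superalg_scheme \<Rightarrow> (gen \<Rightarrow> 'b) \<Rightarrow> (gen list \<Rightarrow>\<^sub>0 complex) set \<Rightarrow> 'b" where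
  "hom_from B g Z = the_elem (lin_ext B (calgebra.word_eval B g) ` Z)"

context
  fixes B :: "('b, 'm) superalg_scheme" and g
  assumes rel: "superspace_relations q B g"
begin

interpretation B: superspace_relations q B g by (rule rel)

lemma eval_clinear: "B.eval \<in> clinear free_alg B"
  by (rule clinearI) (simp_all add: B.eval_simps)

lemma hom_from_proj: "hom_from B g (Q.proj f) = B.eval f"
  unfolding hom_from_def
  by (rule Q.the_elem_image_proj[OF B.cmodule_axioms eval_clinear B.eval_ideal]) simp_all

lemma hom_from_clinear: "hom_from B g \<in> clinear F B"
  unfolding hom_from_def[abs_def]
  by (rule Q.the_elem_image_clinear[OF B.cmodule_axioms eval_clinear B.eval_ideal])

lemma hom_from_mult:
  "a \<in> carrier F \<Longrightarrow> b \<in> carrier F \<Longrightarrow> hom_from B g (a \<otimes>\<^bsub>F\<^esub> b) = hom_from B g a \<otimes>\<^bsub>B\<^esub> hom_from B g b"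
  by (auto elim!: Q.carrierE simp: proj_mult hom_from_proj B.eval_simps)

lemma hom_from_one: "hom_from B g \<one>\<^bsub>F\<^esub> = \<one>\<^bsub>B\<^esub>"
  by (simp add: one_eq hom_from_proj B.eval_simps)

lemma hom_from_gen: "hom_from B g (superspace_gen q y) = g y"
  by (simp add: gen_eq hom_from_proj B.eval_gen)

end

lemma grade_eq: "grade F i = Q.proj ` grade free_alg i"
  by (simp add: superspace_def quot_superalg_def)

lemma grade_induct [consumes 1, case_names word scale add zero]:
  assumes "a \<in> grade F i"
    and word: "\<And>w. sum_list (map gen_parity w) = i \<Longrightarrow> P (Q.proj (Poly_Mapping.single w 1))"
    and scale: "\<And>a c. a \<in> carrier F \<Longrightarrow> P a \<Longrightarrow> P (c \<odot>\<^bsub>F\<^esub> a)"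
    and add: "\<And>a b. a \<in> carrier F \<Longrightarrow> b \<in> carrier F \<Longrightarrow> P a \<Longrightarrow> P b \<Longrightarrow> P (a \<oplus>\<^bsub>F\<^esub> b)"
    and zero: "P \<zero>\<^bsub>F\<^esub>"
  shows "P a"
proof -
  obtain f where f: "a = Q.proj f" and "Poly_Mapping.keys f \<subseteq> {w. sum_list (map gen_parity w) = i}"
    using assms(1) by (auto simp: grade_eq)
  from this(2) have "P (Q.proj f)"
  proof (induction f rule: poly_mapping_induct_keys)
    case zero
    show ?case using assms(5) Q.proj_zero by simp
  next
    case (single w c)
    then show ?case
      using scale[OF Q.proj_closed word, of w c] Q.proj_scale[of "Poly_Mapping.single w 1" c]
      by (simp add: map_scale_single)
  next
    case (add f h)
    then show ?case using assms(4)[of "Q.proj f" "Q.proj h"] Q.proj_add[of f h] by simp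
  qed
  then show ?thesis using f by simp
qed

lemma submodule_grade: "submodule (grade F i) complex_alg F"
proof (rule Q.Q.csubmoduleI)
  show "\<zero>\<^bsub>F\<^esub> \<in> grade F i" by (auto simp: grade_eq Q.proj_zero)
  show "a \<oplus>\<^bsub>F\<^esub> b \<in> grade F i" if "a \<in> grade F i" "b \<in> grade F i" for a b
    using that Poly_Mapping.keys_add by (fastforce simp: grade_eq Q.proj_add)
  show "c \<odot>\<^bsub>F\<^esub> a \<in> grade F i" if "a \<in> grade F i" for a c
    using that keys_map_scale by (fastforce simp: grade_eq Q.proj_scale)
qed (auto simp: grade_eq)

lemma word_grade: "Q.proj (Poly_Mapping.single w 1) \<in> grade F (sum_list (map gen_parity w))"
  by (auto simp: grade_eq)

definition parity_gen :: "gen \<Rightarrow> (gen list \<Rightarrow>\<^sub>0 complex) set" where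
  "parity_gen y = koszul (gen_parity y) 1 \<odot>\<^bsub>F\<^esub> superspace_gen q y"

text \<open>Every relator is homogeneous, so replacing \<theta> by its negative respects the
  relations. The induced endomorphism is the grading involution that \<open>superalgebraI\<close>
  asks for.\<close>

lemma parity_relations: "superspace_relations q F parity_gen"
proof -
  interpret R: superspace_relations q F "superspace_gen q" by (rule relations_self)
  show ?thesis
    by (intro superspace_relations.intro superspace_relations_axioms.intro calgebra_superspace)
      (simp_all add: parity_gen_def gen_parity_def R.gen_inverse R.gen_commute R.gen_q_commute
        R.gen_nilpotent scale_mult_left scale_mult_right Q.Q.scale_scale mult.commute)
qed

lemma superalgebra_superspace: "superalgebra F"
proof (rule superalgebraI)
  show "calgebra F" by (rule calgebra_superspace)
  show "submodule (grade F i) complex_alg F" for i by (rule submodule_grade)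
  have "(1 :: gen list \<Rightarrow>\<^sub>0 complex) \<in> grade free_alg 0"
    by (simp add: zero_list_def)
  then show "\<one>\<^bsub>F\<^esub> \<in> grade F 0" unfolding grade_eq one_eq by blast
  show "a \<otimes>\<^bsub>F\<^esub> b \<in> grade F (i + j)" if ab: "a \<in> grade F i" "b \<in> grade F j" for i j a b
  proof -
    obtain f h where fh: "f \<in> grade free_alg i" "h \<in> grade free_alg j" "a = Q.proj f" "b = Q.proj h"
      using ab by (auto simp: grade_eq)
    then have "f * h \<in> grade free_alg (i + j)"
      using Poly_Mapping.keys_mult[of f h] by (fastforce simp: plus_list_def)
    then show ?thesis using fh unfolding grade_eq by (simp only: proj_mult) blast
  qed
  note sub = Q.Q.submodule_facts[OF submodule_grade]
  show "\<exists>u\<in>grade F 0. \<exists>v\<in>grade F 1. a = u \<oplus>\<^bsub>F\<^esub> v" if "a \<in> carrier F" for a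
    using that
  proof (induction a rule: superspace_induct)
    case (word w)
    let ?w = "Q.proj (Poly_Mapping.single w 1)"
    have cl: "?w \<in> carrier F" by simp
    show ?case
    proof (cases "sum_list (map gen_parity w)")
      case zero
      then show ?thesis
        using word_grade[of w] sub(2) Q.Q.M.r_zero[OF cl] by metis
    next
      case one
      then show ?thesis
        using word_grade[of w] sub(2) Q.Q.M.l_zero[OF cl] by metis
    qed
  next
    case (scale a c)
    then obtain u v where "u \<in> grade F 0" "v \<in> grade F 1" "a = u \<oplus>\<^bsub>F\<^esub> v" by blast
    moreover from this have "c \<odot>\<^bsub>F\<^esub> a = c \<odot>\<^bsub>F\<^esub> u \<oplus>\<^bsub>F\<^esub> c \<odot>\<^bsub>F\<^esub> v"
      using sub(1)[THEN subsetD] by (simp add: Q.Q.scale_add_right)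
    ultimately show ?case using sub(5) by blast
  next
    case (add a b)
    then obtain u v u' v' where *: "u \<in> grade F 0" "u' \<in> grade F 0" "v \<in> grade F 1" "v' \<in> grade F 1"
      "a = u \<oplus>\<^bsub>F\<^esub> v" "b = u' \<oplus>\<^bsub>F\<^esub> v'" by blast
    then have "a \<oplus>\<^bsub>F\<^esub> b = (u \<oplus>\<^bsub>F\<^esub> u') \<oplus>\<^bsub>F\<^esub> (v \<oplus>\<^bsub>F\<^esub> v')"
      using sub(1)[THEN subsetD] by (simp add: Q.Q.vec_ac)
    then show ?case using * sub(3) by blast
  qed
  let ?\<sigma> = "hom_from F parity_gen"
  note \<sigma> = hom_from_clinear[OF parity_relations] hom_from_mult[OF parity_relations]
    hom_from_one[OF parity_relations] hom_from_gen[OF parity_relations]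
  show "?\<sigma> \<in> clinear F F" by (rule \<sigma>)
  have gen: "?\<sigma> (superspace_gen q y) = koszul (gen_parity y) 1 \<odot>\<^bsub>F\<^esub> superspace_gen q y" for y
    using \<sigma>(4)[of y] by (simp only: parity_gen_def)
  \<comment> \<open>The signs of the letters multiply along a word to the sign of the total
    degree.\<close>
  have word_eq: "?\<sigma> (Q.proj (Poly_Mapping.single w 1))
      = koszul (sum_list (map gen_parity w)) 1 \<odot>\<^bsub>F\<^esub> Q.proj (Poly_Mapping.single w 1)" for w
  proof (induction w)
    case (Cons y w)
    then show ?case
      by (simp add: word_Cons \<sigma>(2) gen koszul_add scale_mult_left scale_mult_right Q.Q.scale_scale
          mult.commute)
  qed (simp add: word_Nil \<sigma>(3) one_closed)
  show "?\<sigma> a = koszul i 1 \<odot>\<^bsub>F\<^esub> a" if "a \<in> grade F i" for i a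
    using that
  proof (induction a rule: grade_induct)
    case (word w)
    then show ?case using word_eq by simp
  next
    case zero
    show ?case using Q.Q.clinear_facts(1)[OF Q.Q.cmodule_axioms \<sigma>(1)] by simp
  qed (simp_all add: clinearD[OF \<sigma>(1)] Q.Q.scale_scale Q.Q.scale_add_right mult.commute)
qed

sublocale superalgebra F by (rule superalgebra_superspace)

lemma gen_grade: "superspace_gen q y \<in> grade F (gen_parity y)"
  using word_grade[of "[y]"] by (simp add: gen_eq gen_poly_def)

text \<open>The parities of the images determine the parity of every evaluated word, and a
  homogeneous class has a representative whose words all have the same parity.\<close>

lemma hom_from_grade:
  assumes "superspace_relations q B g" "superalgebra B" "\<And>y. g y \<in> grade B (gen_parity y)"
    and "a \<in> grade F i"
  shows "hom_from B g a \<in> grade B i"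
proof -
  interpret B: superalgebra B by fact
  interpret R: superspace_relations q B g by fact
  note h = hom_from_clinear[OF assms(1)]
  show ?thesis
    using assms(4)
  proof (induction a rule: grade_induct)
    case (word w)
    then show ?case
      using B.word_eval_grade[of g gen_parity w, OF assms(3)]
      by (simp add: hom_from_proj[OF assms(1)] R.eval_simps B.word_eval_closed[OF R.gen_closed])
  qed (simp_all add: clinearD[OF h] Q.Q.clinear_facts(1)[OF B.cmodule_axioms h] B.grade_add B.grade_scale)
qed

lemma hom_from_superalg_hom:
  assumes "superspace_relations q B g" "superalgebra B" "\<And>y. g y \<in> grade B (gen_parity y)"
  shows "hom_from B g \<in> superalg_hom F B"
  using hom_from_grade[OF assms] clinearD[OF hom_from_clinear[OF assms(1)]]
    hom_from_mult[OF assms(1)] hom_from_one[OF assms(1)]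
  by (auto simp: superalg_hom_def ring_hom_def)

end

section \<open>The spanning set of group-like elements and their multiples by the odd generator\<close>

text \<open>The plain opposite, without Koszul sign. The sign of a graded antihomomorphism is
  supplied later by scalar factors.\<close>

definition opposite :: "('a, 'm) superalg_scheme \<Rightarrow> ('a, 'm) superalg_scheme" where
  "opposite A = A\<lparr>mult := \<lambda>a b. b \<otimes>\<^bsub>A\<^esub> a\<rparr>"

lemma opposite_simps [simp]:
  "carrier (opposite A) = carrier A" "mult (opposite A) = (\<lambda>a b. b \<otimes>\<^bsub>A\<^esub> a)"
  "one (opposite A) = one A" "zero (opposite A) = zero A" "add (opposite A) = add A"
  "smult (opposite A) = smult A" "grade (opposite A) = grade A"
  by (simp_all add: opposite_def)

lemma clinear_opposite: "clinear V (opposite A) = clinear V A" "clinear (opposite A) V = clinear A V"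
  by (simp_all add: clinear_def)

lemma (in calgebra) calgebra_opposite: "calgebra (opposite A)"
proof -
  have ab: "abelian_group (opposite A)"
  proof (rule abelian_groupI)
    fix a assume "a \<in> carrier (opposite A)"
    then show "\<exists>b\<in>carrier (opposite A). b \<oplus>\<^bsub>opposite A\<^esub> a = \<zero>\<^bsub>opposite A\<^esub>"
      by (intro bexI[of _ "\<ominus> a"]) (simp_all add: M.l_neg)
  qed (simp_all add: vec_ac)
  have cm: "cmodule (opposite A)"
    by (rule cmoduleI[OF ab]) (simp_all add: scale_add_left scale_add_right scale_scale)
  show ?thesis
    by (intro calgebra.intro calgebra_axioms.intro cm ringI ab monoidI)
      (simp_all add: alg_assoc alg_distrib scale_mult_left scale_mult_right)
qed

text \<open>Degrees add commutatively, so reversing the product leaves the grading and its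
  involution as they are.\<close>

lemma (in superalgebra) superalgebra_opposite: "superalgebra (opposite A)"
proof (rule superalgebraI[where \<sigma> = parity])
  interpret O: calgebra "opposite A" by (rule calgebra_opposite)
  show "calgebra (opposite A)" by (rule calgebra_opposite)
  show "submodule (grade (opposite A) i) complex_alg (opposite A)" for i
    by (rule O.csubmoduleI) (use grade_closed grade_add grade_scale in auto)
  show "a \<otimes>\<^bsub>opposite A\<^esub> b \<in> grade (opposite A) (i + j)"
    if "a \<in> grade (opposite A) i" "b \<in> grade (opposite A) j" for a b i j
    using that grade_mult[of b j a i] by (simp add: add.commute)
  show "\<exists>u\<in>grade (opposite A) 0. \<exists>v\<in>grade (opposite A) 1. a = u \<oplus>\<^bsub>opposite A\<^esub> v"
    if "a \<in> carrier (opposite A)" for a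
    using that carrier_decompE[of a] by (metis opposite_simps(1,5,7))
  show "parity \<in> clinear (opposite A) (opposite A)"
    using parity_clinear by (simp add: clinear_opposite)
qed (simp_all add: grade_one parity_homogeneous)

text \<open>Multiplying the hypothesis on both sides by the inverse of a gives b a' = c a' b, and c
  can be divided out. The values needed are c = q, against \<theta>, and c = 1, among the even
  generators.\<close>

lemma (in calgebra) inverse_q_commute:
  assumes "a \<in> carrier A" "a' \<in> carrier A" "b \<in> carrier A"
    and inv: "a \<otimes> a' = \<one>" "a' \<otimes> a = \<one>" and comm: "a \<otimes> b = c \<odot> (b \<otimes> a)" and "c \<noteq> 0"
  shows "a' \<otimes> b = inverse c \<odot> (b \<otimes> a')"
proof -
  have "b \<otimes> a' = a' \<otimes> (a \<otimes> b) \<otimes> a'"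
    using assms(1-3) inv by (simp add: alg_assoc[symmetric])
  also have "\<dots> = c \<odot> (a' \<otimes> (b \<otimes> (a \<otimes> a')))"
    using assms(1-3) by (simp add: comm scale_mult_left scale_mult_right alg_assoc)
  also have "\<dots> = c \<odot> (a' \<otimes> b)"
    using assms(1-3) inv by simp
  finally show ?thesis
    using assms by (simp add: scale_scale)
qed

section \<open>Rewriting words to the spanning set\<close>

locale invertible_superspace = superspace +
  assumes q: "q \<noteq> 0"
begin

interpretation R: superspace_relations q F "superspace_gen q" by (rule relations_self)

abbreviation mulF (infixl "\<cdot>" 70) where "a \<cdot> b \<equiv> a \<otimes>\<^bsub>F\<^esub> b"

lemma cancel: "x i \<cdot> xinv i = \<one>\<^bsub>F\<^esub>" "xinv i \<cdot> x i = \<one>\<^bsub>F\<^esub>"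
  by (rule R.gen_inverse)+

lemma x_theta: "x i \<cdot> \<theta> = q \<odot>\<^bsub>F\<^esub> (\<theta> \<cdot> x i)"
  by (rule R.gen_q_commute)

lemma xinv_theta: "xinv i \<cdot> \<theta> = inverse q \<odot>\<^bsub>F\<^esub> (\<theta> \<cdot> xinv i)"
  by (rule inverse_q_commute[OF _ _ _ cancel x_theta q]) simp_all

lemma reorder:
  "x I2 \<cdot> x I1 = x I1 \<cdot> x I2" "xinv I2 \<cdot> x I1 = x I1 \<cdot> xinv I2"
  "x I2 \<cdot> xinv I1 = xinv I1 \<cdot> x I2" "xinv I2 \<cdot> xinv I1 = xinv I1 \<cdot> xinv I2"
proof -
  have commute: "a' \<cdot> b = b \<cdot> a'"
    if "a \<in> carrier F" "a' \<in> carrier F" "b \<in> carrier F" "a \<cdot> a' = \<one>\<^bsub>F\<^esub>" "a' \<cdot> a = \<one>\<^bsub>F\<^esub>" "a \<cdot> b = b \<cdot> a" for a a' b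
    using inverse_q_commute[of a a' b 1] that by simp
  show 1: "x I2 \<cdot> x I1 = x I1 \<cdot> x I2" by (rule R.gen_commute[symmetric])
  show 2: "xinv I2 \<cdot> x I1 = x I1 \<cdot> xinv I2"
    by (rule commute[OF _ _ _ cancel 1]) simp_all
  show "x I2 \<cdot> xinv I1 = xinv I1 \<cdot> x I2"
    by (rule commute[OF _ _ _ cancel 1[symmetric], symmetric]) simp_all
  show "xinv I2 \<cdot> xinv I1 = xinv I1 \<cdot> xinv I2"
    by (rule commute[OF _ _ _ cancel 2[symmetric], symmetric]) simp_all
qed

text \<open>With products bracketed to the right, adjacent factors inside a longer word occur as a
  (b z). A relation for a b must also be given in this form to act as a rewrite rule there.\<close>

lemma extend_relation:
  assumes "a \<in> carrier F" "b \<in> carrier F" "z \<in> carrier F"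
  shows "a \<cdot> b = \<one>\<^bsub>F\<^esub> \<Longrightarrow> a \<cdot> (b \<cdot> z) = z"
    and "a \<cdot> b = b \<cdot> a \<Longrightarrow> a \<cdot> (b \<cdot> z) = b \<cdot> (a \<cdot> z)"
    and "a \<cdot> b = c \<odot>\<^bsub>F\<^esub> (b \<cdot> a) \<Longrightarrow> a \<cdot> (b \<cdot> z) = c \<odot>\<^bsub>F\<^esub> (b \<cdot> (a \<cdot> z))"
    and "a \<cdot> b = \<zero>\<^bsub>F\<^esub> \<Longrightarrow> a \<cdot> (b \<cdot> z) = \<zero>\<^bsub>F\<^esub>"
  using assms by (simp_all add: alg_assoc[symmetric] scale_mult_left)

lemmas theta_square = R.gen_nilpotent

text \<open>A rewrite system that moves \<open>\<theta>\<close> to the left and orders the invertible generators.\<close>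

lemmas normalize = cancel x_theta xinv_theta reorder theta_square
  extend_relation(1)[OF gen_closed gen_closed _ cancel(1)]
  extend_relation(1)[OF gen_closed gen_closed _ cancel(2)]
  extend_relation(2)[OF gen_closed gen_closed _ reorder(1)]
  extend_relation(2)[OF gen_closed gen_closed _ reorder(2)]
  extend_relation(2)[OF gen_closed gen_closed _ reorder(3)]
  extend_relation(2)[OF gen_closed gen_closed _ reorder(4)]
  extend_relation(3)[OF gen_closed gen_closed _ x_theta]
  extend_relation(3)[OF gen_closed gen_closed _ xinv_theta]
  extend_relation(4)[OF gen_closed gen_closed _ theta_square]
  scale_mult_left scale_mult_right Q.Q.scale_scale alg_assoc

text \<open>Monomials in the invertible generators, built by left multiplication to match the
  recursion over words. No normal form with exponents is chosen.\<close>

inductive_set grouplikes :: "(gen list \<Rightarrow>\<^sub>0 complex) set set" where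
  one: "\<one>\<^bsub>F\<^esub> \<in> grouplikes"
| x: "g \<in> grouplikes \<Longrightarrow> x i \<cdot> g \<in> grouplikes"
| xinv: "g \<in> grouplikes \<Longrightarrow> xinv i \<cdot> g \<in> grouplikes"

lemma grouplike_grade: "g \<in> grouplikes \<Longrightarrow> g \<in> grade F 0"
proof (induction rule: grouplikes.induct)
  case (x g i)
  then show ?case using grade_mult[OF gen_grade, of g 0 "X i"] by (simp add: gen_parity_def)
next
  case (xinv g i)
  then show ?case using grade_mult[OF gen_grade, of g 0 "Xinv i"] by (simp add: gen_parity_def)
qed (rule grade_one)

lemma grouplike_closed: "g \<in> grouplikes \<Longrightarrow> g \<in> carrier F"
  using grouplike_grade grade_closed by blast

text \<open>Left multiplication by a generator keeps the set of multiples of g and \<theta> g: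
  moving x_i past \<theta> costs a factor q, moving its inverse costs q^-1, and a second \<theta>
  gives 0. Hence every word is a single multiple and not a longer sum.\<close>

lemma span_induct [consumes 1, case_names grouplike theta scale add]:
  assumes "a \<in> carrier F"
    and grouplike: "\<And>g. g \<in> grouplikes \<Longrightarrow> P g"
    and theta: "\<And>g. g \<in> grouplikes \<Longrightarrow> P (\<theta> \<cdot> g)"
    and scale: "\<And>a c. a \<in> carrier F \<Longrightarrow> P a \<Longrightarrow> P (c \<odot>\<^bsub>F\<^esub> a)"
    and add: "\<And>a b. a \<in> carrier F \<Longrightarrow> b \<in> carrier F \<Longrightarrow> P a \<Longrightarrow> P b \<Longrightarrow> P (a \<oplus>\<^bsub>F\<^esub> b)"
  shows "P a"
  using assms(1)
proof (induction a rule: superspace_induct)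
  case (word w)
  have "\<exists>c. \<exists>g\<in>grouplikes. \<exists>a\<in>{g, \<theta> \<cdot> g}. Q.proj (Poly_Mapping.single w 1) = c \<odot>\<^bsub>F\<^esub> a"
  proof (induction w)
    case Nil
    have "\<one>\<^bsub>F\<^esub> = 1 \<odot>\<^bsub>F\<^esub> \<one>\<^bsub>F\<^esub>" by simp
    then show ?case unfolding word_Nil using grouplikes.one by blast
  next
    case (Cons y w)
    then obtain c g a where IH: "g \<in> grouplikes" "a \<in> {g, \<theta> \<cdot> g}"
      "Q.proj (Poly_Mapping.single w 1) = c \<odot>\<^bsub>F\<^esub> a" by blast
    have cl: "g \<in> carrier F" "a \<in> carrier F" using IH grouplike_closed by auto
    have eq: "Q.proj (Poly_Mapping.single (y # w) 1) = c \<odot>\<^bsub>F\<^esub> (superspace_gen q y \<cdot> a)"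
      using cl by (simp add: word_Cons IH(3) scale_mult_right)
    have "\<exists>c'. \<exists>g'\<in>grouplikes. \<exists>a'\<in>{g', \<theta> \<cdot> g'}. superspace_gen q y \<cdot> a = c' \<odot>\<^bsub>F\<^esub> a'"
    proof (cases y)
      case (X i)
      show ?thesis
      proof (cases "a = g")
        case True
        then show ?thesis
          using cl by (intro exI[of _ 1] bexI[OF _ grouplikes.x[OF IH(1), of i]]) (simp add: X)
      next
        case False
        then show ?thesis
          using IH(2) cl
          by (intro exI[of _ q] bexI[OF _ grouplikes.x[OF IH(1), of i]]) (simp add: X normalize)
      qed
    next
      case (Xinv i)
      show ?thesis
      proof (cases "a = g")
        case True
        then show ?thesis
          using cl by (intro exI[of _ 1] bexI[OF _ grouplikes.xinv[OF IH(1), of i]]) (simp add: Xinv)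
      next
        case False
        then show ?thesis
          using IH(2) cl
          by (intro exI[of _ "inverse q"] bexI[OF _ grouplikes.xinv[OF IH(1), of i]])
            (simp add: Xinv normalize)
      qed
    next
      case Theta
      show ?thesis
      proof (cases "a = g")
        case True
        then show ?thesis
          using cl by (intro exI[of _ 1] bexI[OF _ IH(1)]) (simp add: Theta)
      next
        case False
        then show ?thesis
          \<comment> \<open>Here the word contains \<theta> twice and vanishes, so the coefficient
            is 0 and the grouplike element may stay as it is.\<close>
          using IH(2) cl by (intro exI[of _ 0] bexI[OF _ IH(1)]) (simp add: Theta normalize)
      qed
    qed
    then obtain c' g' a' where g': "g' \<in> grouplikes" "a' \<in> {g', \<theta> \<cdot> g'}"
      "superspace_gen q y \<cdot> a = c' \<odot>\<^bsub>F\<^esub> a'" by blast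
    then have "a' \<in> carrier F" using grouplike_closed by auto
    then have "Q.proj (Poly_Mapping.single (y # w) 1) = (c * c') \<odot>\<^bsub>F\<^esub> a'"
      unfolding eq g'(3) by (rule Q.Q.scale_scale)
    then show ?case using g'(1,2) by blast
  qed
  then obtain c g a where g: "g \<in> grouplikes" "a \<in> {g, \<theta> \<cdot> g}"
    "Q.proj (Poly_Mapping.single w 1) = c \<odot>\<^bsub>F\<^esub> a" by blast
  then have "a \<in> carrier F" "P a" using grouplike_closed grouplike theta by auto
  then show ?case unfolding g(3) by (rule scale)
qed (rule scale add; assumption)+

text \<open>Only spanning is required for comparing linear maps. Each identity between structure
  maps is reduced to two computations by this rule.\<close>

lemma clinear_eqI:
  assumes "h \<in> clinear F W" "h' \<in> clinear F W"
    and "\<And>g. g \<in> grouplikes \<Longrightarrow> h g = h' g" "\<And>g. g \<in> grouplikes \<Longrightarrow> h (\<theta> \<cdot> g) = h' (\<theta> \<cdot> g)"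
    and "a \<in> carrier F"
  shows "h a = h' a"
  using assms(5)
  by (induction a rule: span_induct) (simp_all add: assms(3,4) clinearD[OF assms(1)] clinearD[OF assms(2)])

end

section \<open>The Hopf structure\<close>

lemma (in cmodule) add_minus_scale:
  assumes "v \<in> carrier V"
  shows "v \<oplus> (- 1) \<odot> v = \<zero>" "(- 1) \<odot> v \<oplus> v = \<zero>"
  using assms M.r_neg[of v] M.l_neg[of v] by (simp_all add: a_inv_eq_scale)

lemma superalgebra_imp_calgebra: "superalgebra A \<Longrightarrow> calgebra A"
proof -
  assume "superalgebra A"
  then interpret superalgebra A .
  show ?thesis by (rule calgebra_axioms)
qed

lemma index_cases: "P I1 \<Longrightarrow> P I2 \<Longrightarrow> P i"
  by (cases i) auto

section \<open>The images of the generators under the structure maps\<close>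

context invertible_superspace
begin

interpretation FF: tensor_superalgebras F F
  by (intro tensor_superalgebras.intro superalgebra_superspace)

interpretation FF: superalgebra "tensor F F"
  by (rule FF.superalgebra_tensor)

lemmas cmodule_F = Q.Q.cmodule_axioms

abbreviation "k \<equiv> xinv I1 \<cdot> x I2"

lemma basic_grades:
  "x i \<in> grade F 0" "xinv i \<in> grade F 0" "\<theta> \<in> grade F 1" "k \<in> grade F 0" "\<one>\<^bsub>F\<^esub> \<in> grade F 0"
  using gen_grade[of "X i"] gen_grade[of "Xinv i"] gen_grade[of Theta]
    grade_mult[OF gen_grade gen_grade, of "Xinv I1" "X I2"] grade_one
  by (simp_all add: gen_parity_def)

definition comult_gen where
  "comult_gen y = (case y of X i \<Rightarrow> tens F F (x i) (x i) | Xinv i \<Rightarrow> tens F F (xinv i) (xinv i)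
     | Theta \<Rightarrow> tens F F \<theta> k \<oplus>\<^bsub>tensor F F\<^esub> tens F F \<one>\<^bsub>F\<^esub> \<theta>)"

lemmas tens_mult_simps =
  FF.tens_mult_homogeneous[where i = 0 and j = 0] FF.tens_mult_homogeneous[where i = 0 and j = 1]
  FF.tens_mult_homogeneous[where i = 1 and j = 0] FF.tens_mult_homogeneous[where i = 1 and j = 1]

lemma comult_relations: "superspace_relations q (tensor F F) comult_gen"
proof (intro superspace_relations.intro superspace_relations_axioms.intro FF.calgebra_tensor)
  note [simp] = basic_grades tens_mult_simps comult_gen_def FF.tens_scale_left FF.tens_scale_right
    FF.mult_add_left FF.mult_add_right FF.T.Q.scale_add_right FF.T.Q.scale_scale
    FF.T.Q.add_minus_scale
  show "comult_gen y \<in> carrier (tensor F F)" for y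
    by (cases y) simp_all
  show "comult_gen (X i) \<otimes>\<^bsub>tensor F F\<^esub> comult_gen (Xinv i) = \<one>\<^bsub>tensor F F\<^esub>"
    "comult_gen (Xinv i) \<otimes>\<^bsub>tensor F F\<^esub> comult_gen (X i) = \<one>\<^bsub>tensor F F\<^esub>" for i
    by (simp_all add: FF.tensor_one normalize)
  show "comult_gen (X I1) \<otimes>\<^bsub>tensor F F\<^esub> comult_gen (X I2)
      = comult_gen (X I2) \<otimes>\<^bsub>tensor F F\<^esub> comult_gen (X I1)"
    by (simp add: normalize)
  \<comment> \<open>Moving x_i past either summand of \<Delta>(\<theta>) yields exactly one factor
    q, since x_i commutes with k. The index is split because \<open>normalize\<close> orders
    generators with concrete indices.\<close>
  show "comult_gen (X i) \<otimes>\<^bsub>tensor F F\<^esub> comult_gen Theta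
      = q \<odot>\<^bsub>tensor F F\<^esub> (comult_gen Theta \<otimes>\<^bsub>tensor F F\<^esub> comult_gen (X i))" for i
    by (rule index_cases[of _ i]) (simp_all add: normalize)
  \<comment> \<open>The squares vanish, and the mixed terms are \<theta> \<otimes> k \<theta> and,
    with the sign of two odd inner factors, -(\<theta> \<otimes> \<theta> k). They cancel because k
    commutes with \<theta>: the factors q^-1 from x_1^-1 and q from x_2 compensate.\<close>
  show "comult_gen Theta \<otimes>\<^bsub>tensor F F\<^esub> comult_gen Theta = \<zero>\<^bsub>tensor F F\<^esub>"
    using q by (simp add: normalize)
qed

definition counit_gen :: "gen \<Rightarrow> complex" where
  "counit_gen y = (if y = Theta then 0 else 1)"

lemma counit_relations: "superspace_relations q complex_alg counit_gen"
  by (intro superspace_relations.intro superspace_relations_axioms.intro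
      superalgebra_imp_calgebra superalgebra_complex_alg)
    (simp_all add: counit_gen_def)

text \<open>This value is forced: the left antipode axiom for \<theta> reads S(\<theta>) k +
  \<theta> = 0. Hence S(\<theta>) = -\<theta> k^-1 = -\<theta> x_1 x_2^-1, and moving x_1 to the
  front costs q^-1.\<close>

abbreviation "antipode_theta \<equiv> (- inverse q) \<odot>\<^bsub>F\<^esub> (x I1 \<cdot> \<theta> \<cdot> xinv I2)"

text \<open>
  A graded antihomomorphism \<open>S\<close> becomes an ordinary antihomomorphism when it is divided by \<open>\<i>\<close> on
  the odd part, because the factors \<open>c 0 = 1\<close> and \<open>c 1 = \<i>\<close> satisfy
  \<open>c (i + j) = (-1)^(i j) c i c j\<close>.
\<close>

definition antipode_gen where
  "antipode_gen y = (case y of X i \<Rightarrow> xinv i | Xinv i \<Rightarrow> x i | Theta \<Rightarrow> (- \<i>) \<odot>\<^bsub>F\<^esub> antipode_theta)"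

text \<open>Reversing the product and inverting x_i each replace q by its inverse in the relation
  between x_i and \<theta>, so that together they preserve it.\<close>

lemma antipode_relations: "superspace_relations q (opposite F) antipode_gen"
proof (intro superspace_relations.intro superspace_relations_axioms.intro calgebra_opposite)
  show "antipode_gen y \<in> carrier (opposite F)" for y
    by (cases y) (simp_all add: antipode_gen_def)
  show "antipode_gen (X i) \<otimes>\<^bsub>opposite F\<^esub> antipode_gen Theta
      = q \<odot>\<^bsub>opposite F\<^esub> (antipode_gen Theta \<otimes>\<^bsub>opposite F\<^esub> antipode_gen (X i))" for i
    by (rule index_cases[of _ i]; use q in \<open>simp add: antipode_gen_def normalize mult.left_commute[of q]\<close>)
qed (simp_all add: antipode_gen_def normalize)

section \<open>The structure maps and their behaviour on products and degrees\<close>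

definition "\<Delta> = hom_from (tensor F F) comult_gen"
definition "\<epsilon> = hom_from complex_alg counit_gen"
definition "anti = hom_from (opposite F) antipode_gen"
definition "S a = anti (graded_part F 0 a) \<oplus>\<^bsub>F\<^esub> \<i> \<odot>\<^bsub>F\<^esub> anti (graded_part F 1 a)"

lemmas comult_clinear = hom_from_clinear[OF comult_relations, folded \<Delta>_def]
  and comult_mult = hom_from_mult[OF comult_relations, folded \<Delta>_def]
  and comult_one = hom_from_one[OF comult_relations, folded \<Delta>_def]
  and comult_on_gen = hom_from_gen[OF comult_relations, folded \<Delta>_def]
  and counit_clinear = hom_from_clinear[OF counit_relations, folded \<epsilon>_def]
  and counit_mult = hom_from_mult[OF counit_relations, folded \<epsilon>_def]
  and counit_one = hom_from_one[OF counit_relations, folded \<epsilon>_def]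
  and counit_on_gen = hom_from_gen[OF counit_relations, folded \<epsilon>_def]
  and anti_clinear = hom_from_clinear[OF antipode_relations, folded anti_def, unfolded clinear_opposite]
  and anti_mult = hom_from_mult[OF antipode_relations, folded anti_def, simplified]
  and anti_one = hom_from_one[OF antipode_relations, folded anti_def, simplified]
  and anti_on_gen = hom_from_gen[OF antipode_relations, folded anti_def]

lemma comult_hom: "\<Delta> \<in> superalg_hom F (tensor F F)"
  unfolding \<Delta>_def
proof (rule hom_from_superalg_hom[OF comult_relations FF.superalgebra_tensor])
  fix y
  have "tens F F \<theta> k \<in> grade (tensor F F) 1" "tens F F \<one>\<^bsub>F\<^esub> \<theta> \<in> grade (tensor F F) 1"
    using FF.tens_grade[of \<theta> 1 k 0] FF.tens_grade[of "\<one>\<^bsub>F\<^esub>" 0 \<theta> 1] basic_grades by simp_all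
  then show "comult_gen y \<in> grade (tensor F F) (gen_parity y)"
    using FF.tens_grade[OF basic_grades(1) basic_grades(1)]
      FF.tens_grade[OF basic_grades(2) basic_grades(2)] FF.grade_add
    by (cases y) (simp_all add: comult_gen_def gen_parity_def)
qed

lemma counit_hom: "\<epsilon> \<in> superalg_hom F complex_alg"
  unfolding \<epsilon>_def
  by (rule hom_from_superalg_hom[OF counit_relations superalgebra_complex_alg])
    (simp add: counit_gen_def gen_parity_def)

lemma anti_grade:
  assumes "a \<in> grade F i"
  shows "anti a \<in> grade F i"
proof -
  have "antipode_gen y \<in> grade (opposite F) (gen_parity y)" for y
    using grade_mult[OF grade_mult[OF basic_grades(1) basic_grades(3)] basic_grades(2), of I1 I2]
    by (cases y) (simp_all add: antipode_gen_def gen_parity_def basic_grades grade_scale)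
  from hom_from_grade[OF antipode_relations superalgebra_opposite this assms] show ?thesis
    by (simp add: anti_def)
qed

definition unit_factor :: "bit \<Rightarrow> complex" where
  "unit_factor i = (if i = 0 then 1 else \<i>)"

text \<open>The only case with a sign is i = j = 1, where 1 = (-1) \<i>^2.\<close>

lemma unit_factor_add: "unit_factor (i + j) = koszul i j * (unit_factor i * unit_factor j)"
  by (cases i; cases j) (simp_all add: unit_factor_def)

lemma antipode_homogeneous: "a \<in> grade F i \<Longrightarrow> S a = unit_factor i \<odot>\<^bsub>F\<^esub> anti a"
  using Q.Q.clinear_facts(1)[OF cmodule_F anti_clinear] grade_closed[OF anti_grade, of a i]
  by (cases i) (simp_all add: S_def unit_factor_def graded_part_homogeneous)

lemma antipode_clinear: "S \<in> clinear F F"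
  by (rule clinearI)
    (simp_all add: S_def clinearD[OF anti_clinear] graded_part_add graded_part_scale
      Q.Q.scale_add_right Q.Q.scale_scale Q.Q.vec_ac mult.commute)

text \<open>\<open>anti\<close> reverses products without a sign; the Koszul sign is the defect of
  multiplicativity of \<open>unit_factor\<close>.\<close>

lemma antipode_mult:
  assumes "a \<in> grade F i" "b \<in> grade F j"
  shows "S (a \<cdot> b) = koszul i j \<odot>\<^bsub>F\<^esub> (S b \<cdot> S a)"
proof -
  have "anti a \<in> carrier F" "anti b \<in> carrier F" "a \<in> carrier F" "b \<in> carrier F"
    using assms anti_grade grade_closed by blast+
  then show ?thesis
    using antipode_homogeneous[OF grade_mult[OF assms]] antipode_homogeneous[OF assms(1)]
      antipode_homogeneous[OF assms(2)]
    by (simp add: anti_mult unit_factor_add scale_mult_left scale_mult_right Q.Q.scale_scale mult_ac)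
qed

lemma antipode_one: "S \<one>\<^bsub>F\<^esub> = \<one>\<^bsub>F\<^esub>"
  by (simp add: antipode_homogeneous[OF grade_one] unit_factor_def anti_one)

lemma antipode_on_gen: "S (x i) = xinv i" "S (xinv i) = x i" "S \<theta> = antipode_theta"
proof -
  show "S (x i) = xinv i" "S (xinv i) = x i"
    by (simp_all add: antipode_homogeneous[OF basic_grades(1)] antipode_homogeneous[OF basic_grades(2)]
        unit_factor_def anti_on_gen antipode_gen_def)
  show "S \<theta> = antipode_theta"
    by (simp add: antipode_homogeneous[OF basic_grades(3)] unit_factor_def anti_on_gen
        antipode_gen_def Q.Q.scale_scale)
qed

lemma antipode_closed: "a \<in> carrier F \<Longrightarrow> S a \<in> carrier F"
  by (rule clinearD(1)[OF antipode_clinear])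

section \<open>Values of the structure maps on the spanning set\<close>

lemma grouplike_k: "g \<in> grouplikes \<Longrightarrow> k \<cdot> g \<in> grouplikes"
  using grouplikes.xinv[OF grouplikes.x, of g I1 I2] grouplike_closed by (simp add: alg_assoc)

lemma comult_grouplike: "g \<in> grouplikes \<Longrightarrow> \<Delta> g = tens F F g g"
proof (induction rule: grouplikes.induct)
  case (x g i)
  then show ?case
    using grouplike_grade[OF x.hyps] grouplike_closed[OF x.hyps] basic_grades
    by (simp add: comult_mult comult_on_gen comult_gen_def tens_mult_simps)
next
  case (xinv g i)
  then show ?case
    using grouplike_grade[OF xinv.hyps] grouplike_closed[OF xinv.hyps] basic_grades
    by (simp add: comult_mult comult_on_gen comult_gen_def tens_mult_simps)
qed (simp add: comult_one FF.tensor_one)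

lemma comult_theta: "\<Delta> \<theta> = tens F F \<theta> k \<oplus>\<^bsub>tensor F F\<^esub> tens F F \<one>\<^bsub>F\<^esub> \<theta>"
  by (simp add: comult_on_gen comult_gen_def)

text \<open>Since g is even, multiplying \<Delta>(\<theta>) by g \<otimes> g introduces no sign. The
  factor k g is grouplike again, so coproduct, counit and antipode are known on every even factor
  that occurs.\<close>

lemma comult_theta_grouplike:
  assumes "g \<in> grouplikes"
  shows "\<Delta> (\<theta> \<cdot> g) = tens F F (\<theta> \<cdot> g) (k \<cdot> g) \<oplus>\<^bsub>tensor F F\<^esub> tens F F g (\<theta> \<cdot> g)"
  using grouplike_grade[OF assms] grouplike_closed[OF assms] basic_grades
  by (simp add: comult_mult comult_theta comult_grouplike[OF assms] FF.mult_add_left tens_mult_simps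
      del: alg_assoc)

lemma counit_grouplike: "g \<in> grouplikes \<Longrightarrow> \<epsilon> g = 1"
  by (induction rule: grouplikes.induct)
    (simp_all add: counit_one counit_mult counit_on_gen counit_gen_def grouplike_closed)

lemma counit_theta_grouplike: "g \<in> grouplikes \<Longrightarrow> \<epsilon> (\<theta> \<cdot> g) = 0"
  by (simp add: counit_mult counit_on_gen counit_gen_def grouplike_closed)

lemma antipode_mult_grouplike:
  assumes "a \<in> grade F i" "g \<in> grouplikes"
  shows "S (a \<cdot> g) = S g \<cdot> S a"
  using antipode_mult[OF assms(1) grouplike_grade[OF assms(2)]] antipode_closed
    grouplike_closed[OF assms(2)] grade_closed[OF assms(1)] by simp

text \<open>A generator multiplied to the left of g puts its inverse at the right end of
  \<open>S g\<close>. In either order the innermost factors cancel first, and the induction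
  hypothesis handles g itself.\<close>

lemma antipode_grouplike: "g \<in> grouplikes \<Longrightarrow> S g \<cdot> g = \<one>\<^bsub>F\<^esub> \<and> g \<cdot> S g = \<one>\<^bsub>F\<^esub>"
proof (induction rule: grouplikes.induct)
  case (x g i)
  have cl: "g \<in> carrier F" "S g \<in> carrier F" using x.hyps grouplike_closed antipode_closed by auto
  have "g \<cdot> (S g \<cdot> xinv i) = xinv i"
    using x.IH cl by (intro extend_relation(1)) auto
  then show ?case
    using x cl
    by (simp add: antipode_mult_grouplike[OF basic_grades(1)] antipode_on_gen normalize)
next
  case (xinv g i)
  have cl: "g \<in> carrier F" "S g \<in> carrier F" using xinv.hyps grouplike_closed antipode_closed by auto
  have "g \<cdot> (S g \<cdot> x i) = x i"
    using xinv.IH cl by (intro extend_relation(1)) auto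
  then show ?case
    using xinv cl
    by (simp add: antipode_mult_grouplike[OF basic_grades(2)] antipode_on_gen normalize)
qed (simp add: antipode_one)

lemma antipode_k: "S k = xinv I2 \<cdot> x I1"
  using antipode_mult[OF basic_grades(2) basic_grades(1), of I1 I2]
  by (simp add: antipode_on_gen)

section \<open>Verification of the Hopf axioms\<close>

lemma tensor_map_F:
  assumes "f \<in> clinear F C" "h \<in> clinear F D" "cmodule C" "cmodule D"
  shows "tensor_map C D f h \<in> clinear (tensor F F) (tensor C D)"
    and "a \<in> carrier F \<Longrightarrow> b \<in> carrier F \<Longrightarrow> tensor_map C D f h (tens F F a b) = tens C D (f a) (h b)"
  using tensor_map_facts[OF cmodule_F cmodule_F assms(3,4,1,2)] by blast+

lemma coassoc:
  assumes "a \<in> carrier F"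
  shows "tensor_assoc F F F (tensor_map (tensor F F) F \<Delta> id (\<Delta> a))
    = tensor_map F (tensor F F) id \<Delta> (\<Delta> a)"
proof (rule clinear_eqI[OF _ _ _ _ assms])
  interpret L: tensor_modules "tensor F F" F
    by (intro tensor_modules.intro FF.T.Q.cmodule_axioms cmodule_F)
  interpret R: tensor_modules F "tensor F F"
    by (intro tensor_modules.intro FF.T.Q.cmodule_axioms cmodule_F)
  note assoc = tensor_assoc_facts[OF cmodule_F cmodule_F cmodule_F]
  note left = tensor_map_F[OF comult_clinear clinear_id FF.T.Q.cmodule_axioms cmodule_F]
  note right = tensor_map_F[OF clinear_id comult_clinear cmodule_F FF.T.Q.cmodule_axioms]
  show "(\<lambda>a. tensor_assoc F F F (tensor_map (tensor F F) F \<Delta> id (\<Delta> a)))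
      \<in> clinear F (tensor F (tensor F F))"
    by (intro clinear_comp[OF assoc(1)] clinear_comp[OF left(1)] comult_clinear)
  show "(\<lambda>a. tensor_map F (tensor F F) id \<Delta> (\<Delta> a)) \<in> clinear F (tensor F (tensor F F))"
    by (intro clinear_comp[OF right(1)] comult_clinear)
  fix g assume g: "g \<in> grouplikes"
  note gk = grouplike_k[OF g]
  note cl = grouplike_closed[OF g] grouplike_closed[OF gk]
  show "tensor_assoc F F F (tensor_map (tensor F F) F \<Delta> id (\<Delta> g))
    = tensor_map F (tensor F F) id \<Delta> (\<Delta> g)"
    using cl by (simp add: comult_grouplike[OF g] left right assoc)
  \<comment> \<open>Both sides expand to \<theta> g \<otimes> k g \<otimes> k g + g \<otimes>
    \<theta> g \<otimes> k g + g \<otimes> g \<otimes> \<theta> g. On the right this uses that k g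
    is grouplike.\<close>
  show "tensor_assoc F F F (tensor_map (tensor F F) F \<Delta> id (\<Delta> (\<theta> \<cdot> g)))
    = tensor_map F (tensor F F) id \<Delta> (\<Delta> (\<theta> \<cdot> g))"
    using cl
    by (simp add: comult_theta_grouplike[OF g] comult_grouplike[OF g] comult_grouplike[OF gk]
        clinearD[OF left(1)] clinearD[OF right(1)] clinearD[OF assoc(1)] left(2) right(2) assoc(2)
        L.tens_add_left R.tens_add_right R.T.Q.vec_ac)
qed

lemma counit_left:
  assumes "a \<in> carrier F"
  shows "tensor_lift F (\<lambda>c y. c \<odot>\<^bsub>F\<^esub> y) (tensor_map complex_alg F \<epsilon> id (\<Delta> a)) = a"
proof -
  interpret C: tensor_modules complex_alg F
    by (intro tensor_modules.intro cmodule_complex_alg cmodule_F)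
  note map = tensor_map_F[OF counit_clinear clinear_id cmodule_complex_alg cmodule_F]
  have bil: "cbilinear complex_alg F F (\<lambda>c y. c \<odot>\<^bsub>F\<^esub> y)"
    by (intro cbilinearI clinearI)
      (simp_all add: Q.Q.scale_add_right Q.Q.scale_add_left Q.Q.scale_scale mult.commute)
  note lift = C.tensor_lift_clinear[OF cmodule_F bil] C.tensor_lift_tens[OF cmodule_F bil]
  \<comment> \<open>The right-hand side is written with \<open>id\<close> so that it appears as a
    linear map of a, as \<open>clinear_eqI\<close> requires.\<close>
  have "tensor_lift F (\<lambda>c y. c \<odot>\<^bsub>F\<^esub> y) (tensor_map complex_alg F \<epsilon> id (\<Delta> a)) = id a"
  proof (rule clinear_eqI[OF _ clinear_id _ _ assms])
    show "(\<lambda>a. tensor_lift F (\<lambda>c y. c \<odot>\<^bsub>F\<^esub> y) (tensor_map complex_alg F \<epsilon> id (\<Delta> a))) \<in> clinear F F"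
      by (intro clinear_comp[OF lift(1)] clinear_comp[OF map(1)] comult_clinear)
    fix g assume g: "g \<in> grouplikes"
    note cl = grouplike_closed[OF g] grouplike_closed[OF grouplike_k[OF g]]
    show "tensor_lift F (\<lambda>c y. c \<odot>\<^bsub>F\<^esub> y) (tensor_map complex_alg F \<epsilon> id (\<Delta> g)) = id g"
      using cl by (simp add: comult_grouplike[OF g] map lift counit_grouplike[OF g])
    \<comment> \<open>The two summands of the coproduct contribute 0 times k g and 1 times \<theta>
      g.\<close>
    show "tensor_lift F (\<lambda>c y. c \<odot>\<^bsub>F\<^esub> y) (tensor_map complex_alg F \<epsilon> id (\<Delta> (\<theta> \<cdot> g))) = id (\<theta> \<cdot> g)"
      using cl
      by (simp add: comult_theta_grouplike[OF g] clinearD[OF map(1)] clinearD[OF lift(1)] map(2) lift(2)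
          counit_grouplike[OF g] counit_theta_grouplike[OF g])
  qed
  then show ?thesis by simp
qed

lemma counit_right:
  assumes "a \<in> carrier F"
  shows "tensor_lift F (\<lambda>y c. c \<odot>\<^bsub>F\<^esub> y) (tensor_map F complex_alg id \<epsilon> (\<Delta> a)) = a"
proof -
  interpret C: tensor_modules F complex_alg
    by (intro tensor_modules.intro cmodule_complex_alg cmodule_F)
  note map = tensor_map_F[OF clinear_id counit_clinear cmodule_F cmodule_complex_alg]
  have bil: "cbilinear F complex_alg F (\<lambda>y c. c \<odot>\<^bsub>F\<^esub> y)"
    by (intro cbilinearI clinearI)
      (simp_all add: Q.Q.scale_add_right Q.Q.scale_add_left Q.Q.scale_scale mult.commute)
  note lift = C.tensor_lift_clinear[OF cmodule_F bil] C.tensor_lift_tens[OF cmodule_F bil]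
  have "tensor_lift F (\<lambda>y c. c \<odot>\<^bsub>F\<^esub> y) (tensor_map F complex_alg id \<epsilon> (\<Delta> a)) = id a"
  proof (rule clinear_eqI[OF _ clinear_id _ _ assms])
    show "(\<lambda>a. tensor_lift F (\<lambda>y c. c \<odot>\<^bsub>F\<^esub> y) (tensor_map F complex_alg id \<epsilon> (\<Delta> a))) \<in> clinear F F"
      by (intro clinear_comp[OF lift(1)] clinear_comp[OF map(1)] comult_clinear)
    fix g assume g: "g \<in> grouplikes"
    note gk = grouplike_k[OF g]
    note cl = grouplike_closed[OF g] grouplike_closed[OF gk]
    show "tensor_lift F (\<lambda>y c. c \<odot>\<^bsub>F\<^esub> y) (tensor_map F complex_alg id \<epsilon> (\<Delta> g)) = id g"
      using cl by (simp add: comult_grouplike[OF g] map lift counit_grouplike[OF g])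
    \<comment> \<open>Now the first summand survives, because \<epsilon>(k g) = 1, and the second is
      killed by \<epsilon>(\<theta> g) = 0.\<close>
    show "tensor_lift F (\<lambda>y c. c \<odot>\<^bsub>F\<^esub> y) (tensor_map F complex_alg id \<epsilon> (\<Delta> (\<theta> \<cdot> g))) = id (\<theta> \<cdot> g)"
      using cl
      by (simp add: comult_theta_grouplike[OF g] clinearD[OF map(1)] clinearD[OF lift(1)] map(2) lift(2)
          counit_grouplike[OF gk] counit_theta_grouplike[OF g])
  qed
  then show ?thesis by simp
qed

lemmas mult_map_clinear = FF.tensor_lift_clinear[OF cmodule_F cbilinear_mult, folded mult_map_def]
  and mult_map_tens = FF.tensor_lift_tens[OF cmodule_F cbilinear_mult, folded mult_map_def]

lemma unit_counit_clinear: "(\<lambda>a. unit_map F (\<epsilon> a)) \<in> clinear F F"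
  by (rule clinearI)
    (simp_all add: unit_map_def clinearD[OF counit_clinear] Q.Q.scale_add_left Q.Q.scale_scale)

lemma antipode_left:
  assumes "a \<in> carrier F"
  shows "mult_map F (tensor_map F F S id (\<Delta> a)) = unit_map F (\<epsilon> a)"
proof (rule clinear_eqI[OF _ unit_counit_clinear _ _ assms])
  note map = tensor_map_F[OF antipode_clinear clinear_id cmodule_F cmodule_F]
  show "(\<lambda>a. mult_map F (tensor_map F F S id (\<Delta> a))) \<in> clinear F F"
    by (intro clinear_comp[OF mult_map_clinear] clinear_comp[OF map(1)] comult_clinear)
  fix g assume g: "g \<in> grouplikes"
  note cl = grouplike_closed[OF g] antipode_closed[OF grouplike_closed[OF g]]
    grouplike_closed[OF grouplike_k[OF g]]
  show "mult_map F (tensor_map F F S id (\<Delta> g)) = unit_map F (\<epsilon> g)"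
    using cl antipode_grouplike[OF g]
    by (simp add: comult_grouplike[OF g] map mult_map_tens counit_grouplike[OF g] unit_map_def)
  \<comment> \<open>Since S(\<theta> g) = S(g) S(\<theta>), the element k meets S(\<theta>) directly
    and S(\<theta>) k = -\<theta>. The result is the negative of the contribution S(g) \<theta> g of
    the other summand.\<close>
  have "S (\<theta> \<cdot> g) \<cdot> (k \<cdot> g) = S g \<cdot> (antipode_theta \<cdot> (k \<cdot> g))"
    unfolding antipode_mult_grouplike[OF basic_grades(3) g] antipode_on_gen
    by (rule alg_assoc) (use cl in simp_all)
  also have "antipode_theta \<cdot> (k \<cdot> g) = (- 1) \<odot>\<^bsub>F\<^esub> (\<theta> \<cdot> g)"
    using cl q by (simp add: normalize)
  also have "S g \<cdot> \<dots> = (- 1) \<odot>\<^bsub>F\<^esub> (S g \<cdot> (\<theta> \<cdot> g))"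
    using cl by (simp add: scale_mult_right)
  finally have "S (\<theta> \<cdot> g) \<cdot> (k \<cdot> g) \<oplus>\<^bsub>F\<^esub> S g \<cdot> (\<theta> \<cdot> g) = \<zero>\<^bsub>F\<^esub>"
    using cl Q.Q.add_minus_scale[of "S g \<cdot> (\<theta> \<cdot> g)"] by (simp add: Q.Q.vec_ac)
  then show "mult_map F (tensor_map F F S id (\<Delta> (\<theta> \<cdot> g))) = unit_map F (\<epsilon> (\<theta> \<cdot> g))"
    using cl
    by (simp add: comult_theta_grouplike[OF g] clinearD[OF map(1)] clinearD[OF mult_map_clinear] map(2)
        mult_map_tens antipode_closed counit_theta_grouplike[OF g] unit_map_def)
qed

lemma antipode_right:
  assumes "a \<in> carrier F"
  shows "mult_map F (tensor_map F F id S (\<Delta> a)) = unit_map F (\<epsilon> a)"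
proof (rule clinear_eqI[OF _ unit_counit_clinear _ _ assms])
  note map = tensor_map_F[OF clinear_id antipode_clinear cmodule_F cmodule_F]
  show "(\<lambda>a. mult_map F (tensor_map F F id S (\<Delta> a))) \<in> clinear F F"
    by (intro clinear_comp[OF mult_map_clinear] clinear_comp[OF map(1)] comult_clinear)
  fix g assume g: "g \<in> grouplikes"
  note cl = grouplike_closed[OF g] antipode_closed[OF grouplike_closed[OF g]]
    grouplike_closed[OF grouplike_k[OF g]]
  show "mult_map F (tensor_map F F id S (\<Delta> g)) = unit_map F (\<epsilon> g)"
    using cl antipode_grouplike[OF g]
    by (simp add: comult_grouplike[OF g] map mult_map_tens counit_grouplike[OF g] unit_map_def)
  have g_Sg: "g \<cdot> (S g \<cdot> z) = z" if "z \<in> carrier F" for z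
    using cl that antipode_grouplike[OF g] by (intro extend_relation(1)) auto
  \<comment> \<open>With S(k g) = S(g) S(k) the pair g S(g) cancels in the middle and leaves
    \<theta> k^-1. The other summand likewise reduces to S(\<theta>) = -\<theta> k^-1.\<close>
  have "(\<theta> \<cdot> g) \<cdot> S (k \<cdot> g) = \<theta> \<cdot> (xinv I2 \<cdot> x I1)"
    unfolding antipode_mult_grouplike[OF basic_grades(4) g] antipode_k
    using cl by (simp add: alg_assoc g_Sg)
  moreover have "g \<cdot> S (\<theta> \<cdot> g) = (- 1) \<odot>\<^bsub>F\<^esub> (\<theta> \<cdot> (xinv I2 \<cdot> x I1))"
    using cl q
    by (simp add: antipode_mult_grouplike[OF basic_grades(3) g] antipode_on_gen g_Sg) (simp add: normalize)
  ultimately have "(\<theta> \<cdot> g) \<cdot> S (k \<cdot> g) \<oplus>\<^bsub>F\<^esub> g \<cdot> S (\<theta> \<cdot> g) = \<zero>\<^bsub>F\<^esub>"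
    by (simp add: Q.Q.add_minus_scale)
  then show "mult_map F (tensor_map F F id S (\<Delta> (\<theta> \<cdot> g))) = unit_map F (\<epsilon> (\<theta> \<cdot> g))"
    using cl
    by (simp add: comult_theta_grouplike[OF g] clinearD[OF map(1)] clinearD[OF mult_map_clinear] map(2)
        mult_map_tens antipode_closed counit_theta_grouplike[OF g] unit_map_def)
qed

lemma antipode_grade: "a \<in> grade F i \<Longrightarrow> S a \<in> grade F i"
  by (simp add: antipode_homogeneous grade_scale anti_grade)

theorem super_hopf_superspace: "super_hopf_algebra F \<Delta> \<epsilon> S"
proof (intro super_hopf_algebra.intro super_hopf_algebra_axioms.intro superalgebra_superspace)
  show "\<Delta> \<one>\<^bsub>F\<^esub> = tens F F \<one>\<^bsub>F\<^esub> \<one>\<^bsub>F\<^esub>" by (simp add: comult_one FF.tensor_one)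
  show "\<epsilon> \<one>\<^bsub>F\<^esub> = 1" by (simp add: counit_one)
qed (simp_all add: comult_hom counit_hom clinearD[OF antipode_clinear] antipode_grade antipode_mult
    coassoc counit_left counit_right antipode_left antipode_right antipode_one)

end

theorem theorem3p3:
  fixes q :: complex
  assumes "q \<noteq> 0"
  shows "let F = superspace q; x = (\<lambda>i. superspace_gen q (X i));
             xinv = (\<lambda>i. superspace_gen q (Xinv i)); \<theta> = superspace_gen q Theta
         in \<exists>\<Delta> \<epsilon> S. super_hopf_algebra F \<Delta> \<epsilon> S \<and>
              (\<forall>i. \<Delta> (x i) = tens F F (x i) (x i)) \<and>
              \<Delta> \<theta> = tens F F \<theta> (xinv I1 \<otimes>\<^bsub>F\<^esub> x I2) \<oplus>\<^bsub>tensor F F\<^esub> tens F F \<one>\<^bsub>F\<^esub> \<theta> \<and>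
              (\<forall>i. \<epsilon> (x i) = 1) \<and> \<epsilon> \<theta> = 0 \<and>
              (\<forall>i. S (x i) = xinv i) \<and>
              S \<theta> = (- inverse q) \<odot>\<^bsub>F\<^esub> (x I1 \<otimes>\<^bsub>F\<^esub> \<theta> \<otimes>\<^bsub>F\<^esub> xinv I2)"
proof -
  interpret invertible_superspace q by unfold_locales (rule assms)
  show ?thesis
    unfolding Let_def
    by (intro exI[of _ \<Delta>] exI[of _ \<epsilon>] exI[of _ S] conjI allI super_hopf_superspace comult_theta
        antipode_on_gen)
      (simp_all add: comult_on_gen comult_gen_def counit_on_gen counit_gen_def)
qed

end
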